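(* The minor equivalence relation has only countably many equivalence classes of clones of self-dual operations on $\{0,1,2\}$.
   Context: A clone on a set is a set of finitary operations containing all projections and closed under composition. A clone of self-dual operations is a clone on $\{0,1,2\}$ all of whose operations preserve the relation $C_3=\{(0,1),(1,2),(2,0)\}$. For $f\colon A^n\to A$ and $\pi\colon\{1,\dots,n\}\to\{1,\dots,r\}$ let $f_\pi(a_1,\dots,a_r)=f(a_{\pi(1)},\dots,a_{\pi(n)})$. A map $\xi\colon\mathbf C\to\mathbf D$ between clones is minor-preserving if it preserves arities and $\xi(f_\pi)=\xi(f)_\pi$ for all $n$-ary $f\in\mathbf C$ and all $\pi\colon\{1,\dots,n\}\to\{1,\dots,r\}$. Two clones are minor equivalent if there are minor-preserving maps between them in both directions. *)

theory Defs
  imports "HOL-Library.FuncSet" "HOL-Library.Countable_Set"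
begin

text \<open>
  An operation is stored together with its arity; an \<open>n\<close>-tuple is an extensional function on
  \<open>{..<n}\<close>, so coordinates are numbered from 0. The functions are extensional as well, so that
  HOL equality of operations is equality of operations. Nullary operations are admitted here; no
  nullary operation preserves an irreflexive relation such as \<open>C3\<close>, so clones of self-dual
  operations contain none.
\<close>

type_synonym 'a operation = "nat \<times> ((nat \<Rightarrow> 'a) \<Rightarrow> 'a)"

abbreviation arity :: "'a operation \<Rightarrow> nat" where
  "arity f \<equiv> fst f"

definition tuples :: "'a set \<Rightarrow> nat \<Rightarrow> (nat \<Rightarrow> 'a) set" where
  "tuples A n = {..<n} \<rightarrow>\<^sub>E A"

definition operations :: "'a set \<Rightarrow> 'a operation set" where
  "operations A = (SIGMA n:UNIV. tuples A n \<rightarrow>\<^sub>E A)"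

definition projection :: "'a set \<Rightarrow> nat \<Rightarrow> nat \<Rightarrow> 'a operation" where
  "projection A n i = (n, \<lambda>x\<in>tuples A n. x i)"

definition composition ::
    "'a set \<Rightarrow> nat \<Rightarrow> 'a operation \<Rightarrow> (nat \<Rightarrow> 'a operation) \<Rightarrow> 'a operation" where
  "composition A k f g = (k, \<lambda>x\<in>tuples A k. snd f (\<lambda>i\<in>{..<arity f}. snd (g i) x))"

definition is_clone :: "'a set \<Rightarrow> 'a operation set \<Rightarrow> bool" where
  "is_clone A C \<longleftrightarrow>
     C \<subseteq> operations A \<and>
     (\<forall>n. \<forall>i<n. projection A n i \<in> C) \<and>
     (\<forall>k. \<forall>f\<in>C. \<forall>g. (\<forall>i<arity f. g i \<in> C \<and> arity (g i) = k) \<longrightarrow> composition A k f g \<in> C)"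

definition preserves :: "'a set \<Rightarrow> 'a operation \<Rightarrow> ('a \<times> 'a) set \<Rightarrow> bool" where
  "preserves A f R \<longleftrightarrow>
     (\<forall>x\<in>tuples A (arity f). \<forall>y\<in>tuples A (arity f).
        (\<forall>i<arity f. (x i, y i) \<in> R) \<longrightarrow> (snd f x, snd f y) \<in> R)"

definition C3 :: "(nat \<times> nat) set" where
  "C3 = {(0, 1), (1, 2), (2, 0)}"

definition self_dual_clones :: "nat operation set set" where
  "self_dual_clones = {C. is_clone {0, 1, 2} C \<and> (\<forall>f\<in>C. preserves {0, 1, 2} f C3)}"

definition minor :: "'a set \<Rightarrow> nat \<Rightarrow> (nat \<Rightarrow> nat) \<Rightarrow> 'a operation \<Rightarrow> 'a operation" where
  "minor A r \<pi> f = (r, \<lambda>x\<in>tuples A r. snd f (\<lambda>i\<in>{..<arity f}. x (\<pi> i)))"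

definition minor_preserving ::
    "'a set \<Rightarrow> 'a operation set \<Rightarrow> 'b set \<Rightarrow> 'b operation set \<Rightarrow>
     ('a operation \<Rightarrow> 'b operation) \<Rightarrow> bool" where
  "minor_preserving A C B D \<xi> \<longleftrightarrow>
     \<xi> \<in> C \<rightarrow> D \<and>
     (\<forall>f\<in>C. arity (\<xi> f) = arity f) \<and>
     (\<forall>f\<in>C. \<forall>r. \<forall>\<pi>\<in>{..<arity f} \<rightarrow> {..<r}. \<xi> (minor A r \<pi> f) = minor B r \<pi> (\<xi> f))"

definition minor_equivalent ::
    "'a set \<Rightarrow> 'a operation set \<Rightarrow> 'b set \<Rightarrow> 'b operation set \<Rightarrow> bool" where
  "minor_equivalent A C B D \<longleftrightarrow>
     (\<exists>\<xi>. minor_preserving A C B D \<xi>) \<and> (\<exists>\<xi>. minor_preserving B D A C \<xi>)"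

definition self_dual_minor_equivalence :: "(nat operation set \<times> nat operation set) set" where
  "self_dual_minor_equivalence =
     {(C, D). C \<in> self_dual_clones \<and> D \<in> self_dual_clones \<and>
              minor_equivalent {0, 1, 2} C {0, 1, 2} D}"

lemma minor_in_clone:
  assumes C: "is_clone A C" and f: "f \<in> C" and \<pi>: "\<pi> \<in> {..<arity f} \<rightarrow> {..<r}"
  shows "minor A r \<pi> f \<in> C"
proof -
  have "composition A r f (\<lambda>i. projection A r (\<pi> i)) \<in> C"
    using C f \<pi> unfolding is_clone_def by (auto simp: projection_def Pi_iff)
  moreover have "composition A r f (\<lambda>i. projection A r (\<pi> i)) = minor A r \<pi> f"
    unfolding composition_def minor_def projection_def
    by (auto intro!: restrict_ext arg_cong[where f = "snd f"])
  ultimately show ?thesis by simp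
qed

lemma minor_preserving_id: "minor_preserving A C A C (\<lambda>f. f)"
  by (simp add: minor_preserving_def)

lemma minor_preserving_comp:
  assumes "minor_preserving A C B D \<xi>" "minor_preserving B D E F \<zeta>"
  shows "minor_preserving A C E F (\<lambda>f. \<zeta> (\<xi> f))"
  using assms unfolding minor_preserving_def Pi_iff by auto

lemma equiv_self_dual_minor_equivalence:
  "equiv self_dual_clones self_dual_minor_equivalence"
proof (rule equivI)
  show "self_dual_minor_equivalence \<subseteq> self_dual_clones \<times> self_dual_clones"
    by (auto simp: self_dual_minor_equivalence_def)
  show "refl_on self_dual_clones self_dual_minor_equivalence"
    by (auto simp: refl_on_def self_dual_minor_equivalence_def minor_equivalent_def
        intro: minor_preserving_id)
  show "sym self_dual_minor_equivalence"
    by (auto simp: sym_def self_dual_minor_equivalence_def minor_equivalent_def)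
  show "trans self_dual_minor_equivalence"
    unfolding trans_def self_dual_minor_equivalence_def minor_equivalent_def
    by (blast intro: minor_preserving_comp)
qed

end

theory Submission
  imports Defs "HOL-Library.Numeral_Type"
begin

text \<open>
  Write the base set as the integers modulo 3, so that self-dual operations are those commuting
  with \<open>x \<mapsto> x + 1\<close>. Subtracting the diagonal shows that every clone is minor equivalent to its
  idempotent part. Let \<open>C\<close> be an idempotent clone.

  If \<open>C\<close> has a near-unanimity operation of arity \<open>k + 1\<close>, it is determined by its \<open>3^k\<close>-ary part
  (Baker and Pixley). If \<open>{0, 1}\<close> is not a subuniverse, then \<open>C\<close> has a majority operation, or consists of
  all affine operations, or contains the rock-paper-scissors operation \<open>rps\<close>, and then of all idempotent
  self-dual operations. Otherwise each operation \<open>F\<close> has a Boolean part \<open>bs F\<close>, its restriction to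
  \<open>{0, 1}\<close>. Up to the automorphism \<open>x \<mapsto> - x\<close> and near-unanimity, either all Boolean
  parts are projections (one class), or they are parity functions, one of them of at least three
  variables, and then \<open>C\<close> is determined by its ternary part, or \<open>rps\<close> belongs to \<open>C\<close>.

  In the last case every Boolean part lies below a variable unless there is a near-unanimity operation.
  The continuum many clones of this kind are collapsed by the map \<open>normalize\<close>, which keeps the
  Boolean part, changes the value of \<open>F\<close> at \<open>x\<close> to one computed from the Boolean part
  on the three two-block coarsenings of \<open>x\<close>, and leaves \<open>F x\<close> alone only
  when these three bits vanish. It preserves minors, and it maps \<open>C\<close> into every clone of
  this kind that has the same 9-ary part: by the decomposition lemma it is enough to interpolate at
  pairs of tuples on which all bits vanish, and a pair of tuples only sees a 9-ary minor.
\<close>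

section \<open>Functions on the integers modulo 3 and minor equivalence\<close>

text \<open>For clones containing \<open>rps\<close> no finite part can recover the clone. What
  saves the argument is that a minor-preserving map only has to land inside the target. Where the
  three bits disagree, all normal operations with the given Boolean part take one prescribed value,
  so nothing has to be matched. Where the bits vanish, these operations take all three values, which
  is the surjectivity that interpolation asks for.

  Interpolation at pairs suffices because neither \<open>rps\<close> nor the minority operation
  admits a genuine dependence among three coordinates. The relation \<open>a + b + c = 0\<close>
  shows that affine operations do, so these are treated by explicit formulas.

  Interpolation at pairs is proved differently according to whether a guarded disjunction
  \<open>p \<and> (q \<or> r)\<close> occurs among the Boolean parts or all of them are
  conjunctions.

  Apart from near-unanimity, every case is settled by one fixed finite part and so contributes
  finitely many classes; infinitely many classes can come only from the unbounded arity of
  near-unanimity operations.\<close>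

lemma Z3_exhaust: "(a::3) = 0 \<or> a = 1 \<or> a = 2"
proof (cases a rule: bit1_cases)
  case (of_int z)
  hence "z = 0 \<or> z = 1 \<or> z = 2" by auto
  thus ?thesis using of_int by auto
qed

lemma Z3_all: "(\<forall>a::3. P a) \<longleftrightarrow> P 0 \<and> P 1 \<and> P 2"
  using Z3_exhaust by metis

lemma Z3_ex: "(\<exists>a::3. P a) \<longleftrightarrow> P 0 \<or> P 1 \<or> P 2"
  using Z3_exhaust by metis

type_synonym fam = "nat \<Rightarrow> ((nat \<Rightarrow> 3) \<Rightarrow> 3) set"

text \<open>Functions read infinite sequences, and \<open>dep n\<close> says that only the first
  \<open>n\<close> entries count. Minors become plain substitution, but one function can occur at
  several arities; hence the arity argument of the map in \<open>minor_le\<close>.\<close>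

definition dep :: "nat \<Rightarrow> ((nat \<Rightarrow> 3) \<Rightarrow> 3) \<Rightarrow> bool" where
  "dep n F \<longleftrightarrow> (\<forall>x y. (\<forall>i<n. x i = y i) \<longrightarrow> F x = F y)"

lemma depD: "dep n F \<Longrightarrow> (\<And>i. i < n \<Longrightarrow> x i = y i) \<Longrightarrow> F x = F y"
  by (auto simp: dep_def)

definition minor_le :: "fam \<Rightarrow> fam \<Rightarrow> bool" where
  "minor_le K L \<longleftrightarrow> (\<exists>\<phi>. \<forall>n. \<forall>F\<in>K n. \<phi> n F \<in> L n \<and>
     (\<forall>r. \<forall>\<pi>\<in>{..<n} \<rightarrow> {..<r}.
        \<phi> r (\<lambda>x. F (\<lambda>i. x (\<pi> i))) = (\<lambda>x. \<phi> n F (\<lambda>i. x (\<pi> i)))))"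

definition minor_eq :: "fam \<Rightarrow> fam \<Rightarrow> bool" where
  "minor_eq K L \<longleftrightarrow> minor_le K L \<and> minor_le L K"

locale self_dual_fam =
  fixes K :: fam
  assumes dep: "F \<in> K n \<Longrightarrow> dep n F"
    and proj: "i < n \<Longrightarrow> (\<lambda>x. x i) \<in> K n"
    and comp: "F \<in> K m \<Longrightarrow> (\<And>i. i < m \<Longrightarrow> G i \<in> K n) \<Longrightarrow> (\<lambda>x. F (\<lambda>i. G i x)) \<in> K n"
    and rot1: "F \<in> K n \<Longrightarrow> F (\<lambda>i. x i + 1) = F x + 1"
begin

lemma minor: "F \<in> K n \<Longrightarrow> (\<And>i. i < n \<Longrightarrow> \<pi> i < r) \<Longrightarrow> (\<lambda>x. F (\<lambda>i. x (\<pi> i))) \<in> K r"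
  by (rule comp) (auto intro: proj)

lemma rot:
  assumes "F \<in> K n"
  shows "F (\<lambda>i. x i + c) = F x + c"
proof -
  have "F (\<lambda>i. x i + 2) = F x + 2"
    using rot1[OF assms, of "\<lambda>i. x i + 1"] rot1[OF assms, of x] by (simp add: add.assoc)
  thus ?thesis
    using Z3_exhaust[of c] rot1[OF assms] by auto
qed

lemma K0: "K 0 = {}"
proof -
  have False if "F \<in> K 0" for F
    using rot1[OF that, of "\<lambda>_. 0"] depD[OF dep[OF that], of "\<lambda>i. 0 + 1" "\<lambda>_. 0"] by simp
  thus ?thesis by blast
qed

lemma K_pos: "F \<in> K n \<Longrightarrow> 0 < n"
  using K0 by (cases n) auto

end

lemma minor_leI:
  assumes "\<And>n F. F \<in> K n \<Longrightarrow> \<phi> n F \<in> L n"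
    and "\<And>n F r \<pi>. F \<in> K n \<Longrightarrow> \<pi> \<in> {..<n} \<rightarrow> {..<r} \<Longrightarrow>
      \<phi> r (\<lambda>x. F (\<lambda>i. x (\<pi> i))) = (\<lambda>x. \<phi> n F (\<lambda>i. x (\<pi> i)))"
  shows "minor_le K L"
  unfolding minor_le_def using assms by (intro exI[of _ \<phi>]) auto

lemma minor_le_refl: "minor_le K K"
  by (rule minor_leI[where \<phi> = "\<lambda>n F. F"]) auto

lemma minor_le_trans:
  assumes "minor_le K L" "minor_le L M"
  shows "minor_le K M"
proof -
  obtain \<phi> where \<phi>: "\<And>n F. F \<in> K n \<Longrightarrow> \<phi> n F \<in> L n"
    "\<And>n F r \<pi>. F \<in> K n \<Longrightarrow> \<pi> \<in> {..<n} \<rightarrow> {..<r} \<Longrightarrow>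
      \<phi> r (\<lambda>x. F (\<lambda>i. x (\<pi> i))) = (\<lambda>x. \<phi> n F (\<lambda>i. x (\<pi> i)))"
    using assms(1) unfolding minor_le_def by blast
  obtain \<psi> where \<psi>: "\<And>n F. F \<in> L n \<Longrightarrow> \<psi> n F \<in> M n"
    "\<And>n F r \<pi>. F \<in> L n \<Longrightarrow> \<pi> \<in> {..<n} \<rightarrow> {..<r} \<Longrightarrow>
      \<psi> r (\<lambda>x. F (\<lambda>i. x (\<pi> i))) = (\<lambda>x. \<psi> n F (\<lambda>i. x (\<pi> i)))"
    using assms(2) unfolding minor_le_def by blast
  show ?thesis
    by (rule minor_leI[where \<phi> = "\<lambda>n F. \<psi> n (\<phi> n F)"]) (simp_all add: \<phi> \<psi>)
qed

lemma minor_eq_refl: "minor_eq K K"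
  and minor_eq_sym: "minor_eq K L \<Longrightarrow> minor_eq L K"
  and minor_eq_trans: "minor_eq K L \<Longrightarrow> minor_eq L M \<Longrightarrow> minor_eq K M"
  unfolding minor_eq_def using minor_le_refl minor_le_trans by blast+

section \<open>From clones on \<open>{0, 1, 2}\<close> to families of functions modulo 3\<close>

definition enc :: "3 \<Rightarrow> nat" where
  "enc a = (if a = 0 then 0 else if a = 1 then 1 else 2)"

definition dec :: "nat \<Rightarrow> 3" where
  "dec n = (if n = 0 then 0 else if n = 1 then 1 else 2)"

lemma dec_enc [simp]: "dec (enc a) = a"
  using Z3_exhaust[of a] by (auto simp: dec_def enc_def)

definition A3 :: "nat set" where "A3 = {0, 1, 2}"

lemma enc_dec: "n \<in> A3 \<Longrightarrow> enc (dec n) = n"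
  by (auto simp: dec_def enc_def A3_def)

lemma enc_in [simp]: "enc a \<in> A3"
  by (auto simp: enc_def A3_def)

lemma enc_C3: "(enc a, enc b) \<in> C3 \<longleftrightarrow> b = a + 1"
  using Z3_exhaust[of a] Z3_exhaust[of b] by (auto simp: enc_def C3_def)

definition fun_of :: "nat operation \<Rightarrow> (nat \<Rightarrow> 3) \<Rightarrow> 3" where
  "fun_of f x = dec (snd f (\<lambda>i\<in>{..<arity f}. enc (x i)))"

definition op_of :: "nat \<Rightarrow> ((nat \<Rightarrow> 3) \<Rightarrow> 3) \<Rightarrow> nat operation" where
  "op_of n F = (n, \<lambda>x\<in>tuples A3 n. enc (F (\<lambda>i. dec (x i))))"

definition fam_of :: "nat operation set \<Rightarrow> fam" where
  "fam_of C n = {fun_of f | f. f \<in> C \<and> arity f = n}"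

lemma enc_tuple [simp]: "(\<lambda>i\<in>{..<n}. enc (x i)) \<in> tuples A3 n"
  by (auto simp: tuples_def)

lemma enc_dec_tuple: "x \<in> tuples A3 n \<Longrightarrow> (\<lambda>i\<in>{..<n}. enc (dec (x i))) = x"
  unfolding tuples_def by (rule PiE_ext[of _ "{..<n}" "\<lambda>_. A3"]) (auto simp: enc_dec PiE_iff)

lemma dep_fun_of: "arity f = n \<Longrightarrow> dep n (fun_of f)"
  unfolding dep_def fun_of_def by (auto intro!: arg_cong[where f = dec] arg_cong[where f = "snd f"])

lemma op_of_fun_of:
  assumes "f \<in> operations A3"
  shows "op_of (arity f) (fun_of f) = f"
proof -
  obtain n g where f: "f = (n, g)" and g: "g \<in> tuples A3 n \<rightarrow>\<^sub>E A3"
    using assms by (auto simp: operations_def)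
  have "(\<lambda>x\<in>tuples A3 n. enc (fun_of f (\<lambda>i. dec (x i)))) = g"
  proof (rule PiE_ext[of _ "tuples A3 n" "\<lambda>_. A3"])
    show "(\<lambda>x\<in>tuples A3 n. enc (fun_of f (\<lambda>i. dec (x i)))) \<in> tuples A3 n \<rightarrow>\<^sub>E A3"
      by auto
    show "g \<in> tuples A3 n \<rightarrow>\<^sub>E A3" by (rule g)
    fix x assume x: "x \<in> tuples A3 n"
    have "g x \<in> A3" using g x by auto
    thus "(\<lambda>x\<in>tuples A3 n. enc (fun_of f (\<lambda>i. dec (x i)))) x = g x"
      using x by (simp add: fun_of_def f enc_dec_tuple enc_dec)
  qed
  thus ?thesis by (simp add: op_of_def f)
qed

lemma fun_of_composition:
  assumes "\<forall>i<arity f. g i \<in> operations A3 \<and> arity (g i) = k"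
  shows "fun_of (composition A3 k f g) = (\<lambda>x. fun_of f (\<lambda>i. fun_of (g i) x))"
proof
  fix x :: "nat \<Rightarrow> 3"
  have "enc (fun_of (g i) x) = snd (g i) (\<lambda>i\<in>{..<k}. enc (x i))" if "i < arity f" for i
  proof -
    have "snd (g i) (\<lambda>i\<in>{..<k}. enc (x i)) \<in> A3"
    proof (cases "g i")
      case (Pair m h)
      have "(m, h) \<in> operations A3" "m = k" using assms that Pair by (metis, metis fst_conv)
      hence "m = k" "h \<in> tuples A3 k \<rightarrow>\<^sub>E A3" by (auto simp: operations_def)
      thus ?thesis using Pair PiE_mem[OF _ enc_tuple] by auto
    qed
    thus ?thesis using assms that by (simp add: fun_of_def enc_dec)
  qed
  hence "(\<lambda>i\<in>{..<arity f}. enc (fun_of (g i) x)) =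
      (\<lambda>i\<in>{..<arity f}. snd (g i) (\<lambda>i\<in>{..<k}. enc (x i)))"
    by auto
  thus "fun_of (composition A3 k f g) x = fun_of f (\<lambda>i. fun_of (g i) x)"
    by (simp add: composition_def fun_of_def[of f] fun_of_def[of "(k, _)"] enc_tuple)
qed

lemma fun_of_minor:
  assumes "f \<in> operations A3" "\<pi> \<in> {..<arity f} \<rightarrow> {..<r}"
  shows "fun_of (minor A3 r \<pi> f) = (\<lambda>x. fun_of f (\<lambda>i. x (\<pi> i)))"
  using assms(2) by (auto simp: minor_def fun_of_def enc_tuple Pi_iff
      intro!: ext arg_cong[where f = dec] arg_cong[where f = "snd f"])

lemma op_of_minor:
  assumes "dep n G" "\<pi> \<in> {..<n} \<rightarrow> {..<r}"
  shows "op_of r (\<lambda>x. G (\<lambda>i. x (\<pi> i))) = minor A3 r \<pi> (op_of n G)"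
proof -
  have "(\<lambda>i\<in>{..<n}. x (\<pi> i)) \<in> tuples A3 n" if "x \<in> tuples A3 r" for x
    using that assms(2) unfolding tuples_def by fastforce
  thus ?thesis
    using assms by (auto simp: minor_def op_of_def intro!: restrict_ext arg_cong[where f = enc] depD[of n G])
qed

lemma self_dual_fam_of:
  assumes "C \<in> self_dual_clones"
  shows "self_dual_fam (fam_of C)"
proof -
  have C: "is_clone A3 C" and pres: "\<And>f. f \<in> C \<Longrightarrow> preserves A3 f C3"
    using assms unfolding self_dual_clones_def A3_def by auto
  have sub: "C \<subseteq> operations A3" using C by (simp add: is_clone_def)
  show ?thesis
  proof
    fix F n assume "F \<in> fam_of C n"
    thus "dep n F" by (auto simp: fam_of_def dep_fun_of)
  next
    fix i n :: nat assume i: "i < n"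
    have "fun_of (projection A3 n i) = (\<lambda>x. x i)"
      using i by (intro ext) (simp add: fun_of_def projection_def)
    moreover have "projection A3 n i \<in> C" using C i by (simp add: is_clone_def)
    ultimately show "(\<lambda>x. x i) \<in> fam_of C n"
      unfolding fam_of_def by (metis (mono_tags, lifting) fst_conv mem_Collect_eq projection_def)
  next
    fix F m n and G :: "nat \<Rightarrow> (nat \<Rightarrow> 3) \<Rightarrow> 3"
    assume "F \<in> fam_of C m" and G: "\<And>i. i < m \<Longrightarrow> G i \<in> fam_of C n"
    then obtain f where f: "f \<in> C" "arity f = m" "F = fun_of f" by (auto simp: fam_of_def)
    have "\<exists>g. g \<in> C \<and> arity g = n \<and> G i = fun_of g" if "i < m" for i
      using G[OF that] by (auto simp: fam_of_def)
    then obtain g where g: "\<And>i. i < m \<Longrightarrow> g i \<in> C \<and> arity (g i) = n \<and> G i = fun_of (g i)"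
      by metis
    have "composition A3 n f g \<in> C" using C f g by (auto simp: is_clone_def)
    moreover have "fun_of (composition A3 n f g) = (\<lambda>x. F (\<lambda>i. G i x))"
    proof -
      have "fun_of (composition A3 n f g) = (\<lambda>x. fun_of f (\<lambda>i. fun_of (g i) x))"
        using f g sub by (intro fun_of_composition) auto
      also have "\<dots> = (\<lambda>x. F (\<lambda>i. G i x))"
        using g f by (auto intro!: ext depD[OF dep_fun_of[OF f(2)]])
      finally show ?thesis .
    qed
    ultimately show "(\<lambda>x. F (\<lambda>i. G i x)) \<in> fam_of C n"
      unfolding fam_of_def by (metis (mono_tags, lifting) fst_conv mem_Collect_eq composition_def)
  next
    fix F n and x :: "nat \<Rightarrow> 3" assume "F \<in> fam_of C n"
    then obtain f where f: "f \<in> C" "arity f = n" "F = fun_of f" by (auto simp: fam_of_def)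
    let ?x = "\<lambda>i\<in>{..<n}. enc (x i)" and ?y = "\<lambda>i\<in>{..<n}. enc (x i + 1)"
    have "(snd f ?x, snd f ?y) \<in> C3"
      using pres[OF f(1)] f(2) enc_tuple[of x n] enc_tuple[of "\<lambda>i. x i + 1" n]
      unfolding preserves_def by (simp add: enc_C3)
    thus "F (\<lambda>i. x i + 1) = F x + 1"
      by (auto simp: f fun_of_def C3_def dec_def)
  qed
qed

lemma minor_preserving_of_minor_le:
  assumes C: "C \<in> self_dual_clones" and D: "D \<in> self_dual_clones"
    and le: "minor_le (fam_of C) (fam_of D)"
  shows "\<exists>\<xi>. minor_preserving A3 C A3 D \<xi>"
proof -
  have subC: "C \<subseteq> operations A3" and subD: "D \<subseteq> operations A3"
    using C D unfolding self_dual_clones_def A3_def is_clone_def by auto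
  obtain \<phi> where \<phi>: "\<And>n F. F \<in> fam_of C n \<Longrightarrow> \<phi> n F \<in> fam_of D n"
    "\<And>n F r \<pi>. F \<in> fam_of C n \<Longrightarrow> \<pi> \<in> {..<n} \<rightarrow> {..<r} \<Longrightarrow>
      \<phi> r (\<lambda>x. F (\<lambda>i. x (\<pi> i))) = (\<lambda>x. \<phi> n F (\<lambda>i. x (\<pi> i)))"
    using le unfolding minor_le_def by blast
  define \<xi> where "\<xi> f = op_of (arity f) (\<phi> (arity f) (fun_of f))" for f
  have mem: "fun_of f \<in> fam_of C (arity f)" if "f \<in> C" for f
    using that unfolding fam_of_def by blast
  have dep: "dep (arity f) (\<phi> (arity f) (fun_of f))" if "f \<in> C" for f
    using \<phi>(1)[OF mem[OF that]] by (auto simp: fam_of_def dep_fun_of)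
  have "\<xi> f \<in> D" if f: "f \<in> C" for f
  proof -
    obtain g where "g \<in> D" "arity g = arity f" "\<phi> (arity f) (fun_of f) = fun_of g"
      using \<phi>(1)[OF mem[OF f]] by (auto simp: fam_of_def)
    thus ?thesis using op_of_fun_of[of g] subD by (auto simp: \<xi>_def)
  qed
  moreover have "arity (\<xi> f) = arity f" for f by (simp add: \<xi>_def op_of_def)
  moreover have "\<xi> (minor A3 r \<pi> f) = minor A3 r \<pi> (\<xi> f)"
    if f: "f \<in> C" and \<pi>: "\<pi> \<in> {..<arity f} \<rightarrow> {..<r}" for f r \<pi>
  proof -
    have "\<xi> (minor A3 r \<pi> f) = op_of r (\<phi> r (\<lambda>x. fun_of f (\<lambda>i. x (\<pi> i))))"
      using fun_of_minor[of f \<pi> r] f \<pi> subC by (auto simp: \<xi>_def minor_def)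
    also have "\<dots> = minor A3 r \<pi> (\<xi> f)"
      using \<phi>(2)[OF mem[OF f] \<pi>] op_of_minor[OF dep[OF f] \<pi>] by (simp add: \<xi>_def)
    finally show ?thesis .
  qed
  ultimately show ?thesis unfolding minor_preserving_def by blast
qed

text \<open>Minor equivalent families may receive different numbers; each number only has to stay
  within one class. So any description with countably many outcomes that forces minor equivalence
  will do.\<close>

definition countably_many :: "fam set \<Rightarrow> bool" where
  "countably_many X \<longleftrightarrow> (\<exists>\<kappa>::fam \<Rightarrow> nat. \<forall>K\<in>X. \<forall>L\<in>X. \<kappa> K = \<kappa> L \<longrightarrow> minor_eq K L)"

lemma countably_manyI:
  assumes "countable (\<kappa> ` X)"
    and "\<And>K L. K \<in> X \<Longrightarrow> L \<in> X \<Longrightarrow> \<kappa> K = \<kappa> L \<Longrightarrow> minor_eq K L"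
  shows "countably_many X"
  unfolding countably_many_def
  by (rule exI[of _ "\<lambda>K. to_nat_on (\<kappa> ` X) (\<kappa> K)"]) (simp add: assms)

lemma countably_many_UN:
  fixes X :: "nat \<Rightarrow> fam set"
  assumes "\<And>k. countably_many (X k)"
  shows "countably_many (\<Union>k. X k)"
proof -
  obtain \<kappa> :: "nat \<Rightarrow> fam \<Rightarrow> nat" where
    \<kappa>: "\<And>k K L. K \<in> X k \<Longrightarrow> L \<in> X k \<Longrightarrow> \<kappa> k K = \<kappa> k L \<Longrightarrow> minor_eq K L"
    using assms unfolding countably_many_def by metis
  define m where "m K = (LEAST k. K \<in> X k)" for K
  have m: "K \<in> X (m K)" if "K \<in> (\<Union>k. X k)" for K
    using that unfolding m_def by (auto intro: LeastI)
  show ?thesis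
  proof (rule countably_manyI)
    show "countable ((\<lambda>K. (m K, \<kappa> (m K) K)) ` (\<Union>k. X k))" by (rule countableI_type)
    fix K L assume "K \<in> (\<Union>k. X k)" "L \<in> (\<Union>k. X k)" "(m K, \<kappa> (m K) K) = (m L, \<kappa> (m L) L)"
    thus "minor_eq K L" using \<kappa>[of K "m K" L] m[of K] m[of L] by auto
  qed
qed

lemma countably_many_Un:
  assumes "countably_many X" "countably_many Y"
  shows "countably_many (X \<union> Y)"
proof -
  have "countably_many (\<Union>k::nat. if k = 0 then X else Y)"
    by (rule countably_many_UN) (simp add: assms)
  moreover have "(\<Union>k::nat. if k = 0 then X else Y) = X \<union> Y" by (auto split: if_splits)
  ultimately show ?thesis by simp
qed

lemma countably_many_subset: "countably_many Y \<Longrightarrow> X \<subseteq> Y \<Longrightarrow> countably_many X"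
  unfolding countably_many_def by blast

lemma countably_many_reduce:
  assumes "countably_many Y" "\<And>K. K \<in> X \<Longrightarrow> \<exists>L\<in>Y. minor_eq K L"
  shows "countably_many X"
proof -
  obtain \<kappa> :: "fam \<Rightarrow> nat" where
    \<kappa>: "\<And>K L. K \<in> Y \<Longrightarrow> L \<in> Y \<Longrightarrow> \<kappa> K = \<kappa> L \<Longrightarrow> minor_eq K L"
    using assms(1) unfolding countably_many_def by metis
  obtain \<rho> where \<rho>: "\<And>K. K \<in> X \<Longrightarrow> \<rho> K \<in> Y \<and> minor_eq K (\<rho> K)"
    using assms(2) by metis
  show ?thesis unfolding countably_many_def
    by (rule exI[of _ "\<lambda>K. \<kappa> (\<rho> K)"]) (meson \<rho> \<kappa> minor_eq_trans minor_eq_sym)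
qed

lemma finite_dep: "finite {F. dep n F}"
proof -
  let ?T = "{..<n} \<rightarrow>\<^sub>E (UNIV::3 set)"
  have fin: "finite (?T \<rightarrow>\<^sub>E (UNIV::3 set))" by (intro finite_PiE) auto
  have "inj_on (\<lambda>F. restrict F ?T) {F. dep n F}"
  proof (rule inj_onI, clarify)
    fix F G assume F: "dep n F" and G: "dep n G" and eq: "restrict F ?T = restrict G ?T"
    show "F = G"
    proof
      fix x :: "nat \<Rightarrow> 3"
      have "F (restrict x {..<n}) = G (restrict x {..<n})"
        using fun_cong[OF eq, of "restrict x {..<n}"] by simp
      thus "F x = G x" using depD[OF F, of x "restrict x {..<n}"] depD[OF G, of x "restrict x {..<n}"] by simp
    qed
  qed
  moreover have "finite ((\<lambda>F. restrict F ?T) ` {F. dep n F})"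
    by (rule finite_subset[OF _ fin]) (simp add: image_subset_iff restrict_PiE_iff)
  ultimately show ?thesis by (rule finite_imageD[rotated])
qed

text \<open>Only finitely many functions depend on \<open>m\<close> variables alone, so there are
  finitely many possible \<open>m\<close>-ary parts.\<close>

lemma countably_many_finite_part:
  assumes "\<And>K. K \<in> X \<Longrightarrow> self_dual_fam K"
    and "\<And>K L. K \<in> X \<Longrightarrow> L \<in> X \<Longrightarrow> K m = L m \<Longrightarrow> minor_eq K L"
  shows "countably_many X"
proof (rule countably_manyI[where \<kappa> = "\<lambda>K. K m"])
  have "(\<lambda>K. K m) ` X \<subseteq> Pow {F. dep m F}"
    using assms(1) self_dual_fam.dep by blast
  thus "countable ((\<lambda>K. K m) ` X)"
    by (meson countable_finite finite_Pow_iff finite_dep finite_subset)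
qed (rule assms(2))

lemma countable_quotient:
  assumes "countably_many {K. self_dual_fam K}"
  shows "countable (self_dual_clones // self_dual_minor_equivalence)"
proof -
  obtain \<kappa> :: "fam \<Rightarrow> nat" where
    \<kappa>: "\<And>K L. self_dual_fam K \<Longrightarrow> self_dual_fam L \<Longrightarrow> \<kappa> K = \<kappa> L \<Longrightarrow> minor_eq K L"
    using assms unfolding countably_many_def by auto
  define cls where "cls C = self_dual_minor_equivalence `` {C}" for C
  have eq: "cls C = cls D"
    if "C \<in> self_dual_clones" "D \<in> self_dual_clones" "\<kappa> (fam_of C) = \<kappa> (fam_of D)" for C D
  proof -
    have "minor_eq (fam_of C) (fam_of D)"
      using that by (intro \<kappa> self_dual_fam_of)
    hence "(C, D) \<in> self_dual_minor_equivalence"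
      using that minor_preserving_of_minor_le
      unfolding self_dual_minor_equivalence_def minor_equivalent_def minor_eq_def A3_def by auto
    thus ?thesis unfolding cls_def
      by (rule equiv_class_eq[OF equiv_self_dual_minor_equivalence])
  qed
  have quot: "self_dual_clones // self_dual_minor_equivalence = cls ` self_dual_clones"
    by (auto simp: quotient_def cls_def)
  define pick where "pick k = (SOME C. C \<in> self_dual_clones \<and> \<kappa> (fam_of C) = k)" for k
  have "cls C = cls (pick (\<kappa> (fam_of C)))" if C: "C \<in> self_dual_clones" for C
  proof -
    have "pick (\<kappa> (fam_of C)) \<in> self_dual_clones \<and> \<kappa> (fam_of (pick (\<kappa> (fam_of C)))) = \<kappa> (fam_of C)"
      unfolding pick_def by (rule someI[of _ C]) (simp add: C)
    thus ?thesis using eq[OF C] by metis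
  qed
  hence "cls ` self_dual_clones \<subseteq> range (\<lambda>k. cls (pick k))" by blast
  thus ?thesis unfolding quot by (rule countable_subset) simp
qed

section \<open>Decomposition of subpowers\<close>

text \<open>On \<open>{a - 1, a}\<close> the value \<open>a - 1\<close> wins, so \<open>rps\<close>
  is conjunction on \<open>{0, 1}\<close>. It is commutative but not associative.\<close>

definition rps :: "3 \<Rightarrow> 3 \<Rightarrow> 3" where
  "rps a b = (if b = a + 1 then a else b)"

text \<open>A minority operation; among three distinct values the first argument wins, so it
  commutes with every permutation of the base set.\<close>

definition mino :: "3 \<Rightarrow> 3 \<Rightarrow> 3 \<Rightarrow> 3" where
  "mino a b c = (if a = b then c else if a = c then b else a)"

definition closed2 :: "(3 \<Rightarrow> 3 \<Rightarrow> 3 \<Rightarrow> 3) \<Rightarrow> (3 \<Rightarrow> 3 \<Rightarrow> bool) \<Rightarrow> bool" where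
  "closed2 t R \<longleftrightarrow> (\<forall>a b a' b' a'' b''. R a b \<longrightarrow> R a' b' \<longrightarrow> R a'' b'' \<longrightarrow> R (t a a' a'') (t b b' b''))"

definition closed3 :: "(3 \<Rightarrow> 3 \<Rightarrow> 3 \<Rightarrow> 3) \<Rightarrow> (3 \<Rightarrow> 3 \<Rightarrow> 3 \<Rightarrow> bool) \<Rightarrow> bool" where
  "closed3 t R \<longleftrightarrow> (\<forall>a b c a' b' c' a'' b'' c''. R a b c \<longrightarrow> R a' b' c' \<longrightarrow> R a'' b'' c'' \<longrightarrow>
     R (t a a' a'') (t b b' b'') (t c c' c''))"

text \<open>\<open>pairs\<close> leaves two coordinates either independent or linked by a
  permutation, and \<open>triples\<close> excludes relations such as \<open>a + b + c = 0\<close>,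
  which has full binary projections. The operation is ternary to fit \<open>mino\<close>;
  \<open>rps\<close> ignores the third argument.\<close>

locale decomposing =
  fixes t :: "3 \<Rightarrow> 3 \<Rightarrow> 3 \<Rightarrow> 3"
  assumes idem: "t a a a = a"
    and pairs: "closed2 t R \<Longrightarrow> \<forall>a. \<exists>b. R a b \<Longrightarrow> \<forall>b. \<exists>a. R a b \<Longrightarrow>
      (\<forall>a b. R a b) \<or> (\<exists>\<sigma>. bij \<sigma> \<and> (\<forall>a b. R a b \<longleftrightarrow> b = \<sigma> a))"
    and triples: "closed3 t S \<Longrightarrow> \<forall>a b. \<exists>c. S a b c \<Longrightarrow> \<forall>a c. \<exists>b. S a b c \<Longrightarrow>
      \<forall>b c. \<exists>a. S a b c \<Longrightarrow> S a b c"
begin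

text \<open>Induction on the number of points. Fix the values at all points but three: idempotence
  of \<open>t\<close> preserves them, dropping one of the three points and using the induction
  hypothesis gives full binary projections, and \<open>triples\<close> finishes.\<close>

lemma independent_interpolation:
  fixes F :: "('x \<Rightarrow> 3) set"
  assumes closed: "\<And>f g h. f \<in> F \<Longrightarrow> g \<in> F \<Longrightarrow> h \<in> F \<Longrightarrow> (\<lambda>x. t (f x) (g x) (h x)) \<in> F"
    and ne: "F \<noteq> {}"
    and surj: "\<And>x a. x \<in> Y \<Longrightarrow> \<exists>f\<in>F. f x = a"
    and ind: "\<And>x y a b. x \<in> Y \<Longrightarrow> y \<in> Y \<Longrightarrow> x \<noteq> y \<Longrightarrow> \<exists>f\<in>F. f x = a \<and> f y = b"
    and fin: "finite Y"
  shows "\<exists>f\<in>F. \<forall>x\<in>Y. f x = h x"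
  using fin surj ind
proof (induction "card Y" arbitrary: Y h rule: less_induct)
  case less
  have IH: "\<exists>f\<in>F. \<forall>x\<in>Z. f x = h' x" if "Z \<subset> Y" for Z h'
  proof (rule less.hyps)
    show "card Z < card Y" using that less.prems(1) by (simp add: psubset_card_mono)
    show "finite Z" using that less.prems(1) finite_subset by blast
  qed (use that less.prems(2,3) in blast)+
  show ?case
  proof (cases "\<exists>x y z. x \<in> Y \<and> y \<in> Y \<and> z \<in> Y \<and> x \<noteq> y \<and> x \<noteq> z \<and> y \<noteq> z")
    case True
    then obtain x y z where xyz: "x \<in> Y" "y \<in> Y" "z \<in> Y" "x \<noteq> y" "x \<noteq> z" "y \<noteq> z" by blast
    define W where "W = Y - {x, y, z}"
    define R where "R a b c \<longleftrightarrow> (\<exists>f\<in>F. (\<forall>w\<in>W. f w = h w) \<and> f x = a \<and> f y = b \<and> f z = c)" for a b c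
    have "closed3 t R"
      unfolding closed3_def
    proof (intro allI impI)
      fix a b c a' b' c' a'' b'' c''
      assume "R a b c" "R a' b' c'" "R a'' b'' c''"
      then obtain f g k where "f \<in> F" "g \<in> F" "k \<in> F"
        and *: "\<forall>w\<in>W. f w = h w" "\<forall>w\<in>W. g w = h w" "\<forall>w\<in>W. k w = h w"
        "f x = a" "f y = b" "f z = c" "g x = a'" "g y = b'" "g z = c'" "k x = a''" "k y = b''" "k z = c''"
        unfolding R_def by auto
      hence "(\<lambda>x. t (f x) (g x) (k x)) \<in> F" using closed by blast
      thus "R (t a a' a'') (t b b' b'') (t c c' c'')"
        unfolding R_def using * by (intro bexI[of _ "\<lambda>x. t (f x) (g x) (k x)"]) (simp_all add: idem)
    qed
    moreover have "\<forall>a b. \<exists>c. R a b c"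
    proof (intro allI)
      fix a b
      have "Y - {z} \<subset> Y" using xyz by blast
      then obtain f where "f \<in> F" "\<forall>u\<in>Y - {z}. f u = (if u = x then a else if u = y then b else h u)"
        using IH[of "Y - {z}" "\<lambda>u. (if u = x then a else if u = y then b else h u)"] by blast
      hence "\<forall>w\<in>W. f w = h w" "f x = a" "f y = b" using xyz by (simp_all add: W_def)
      thus "\<exists>c. R a b c" using \<open>f \<in> F\<close> unfolding R_def by blast
    qed
    moreover have "\<forall>a c. \<exists>b. R a b c"
    proof (intro allI)
      fix a c
      have "Y - {y} \<subset> Y" using xyz by blast
      then obtain f where "f \<in> F" "\<forall>u\<in>Y - {y}. f u = (if u = x then a else if u = z then c else h u)"
        using IH[of "Y - {y}" "\<lambda>u. (if u = x then a else if u = z then c else h u)"] by blast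
      hence "\<forall>w\<in>W. f w = h w" "f x = a" "f z = c" using xyz by (simp_all add: W_def)
      thus "\<exists>b. R a b c" using \<open>f \<in> F\<close> unfolding R_def by blast
    qed
    moreover have "\<forall>b c. \<exists>a. R a b c"
    proof (intro allI)
      fix b c
      have "Y - {x} \<subset> Y" using xyz by blast
      then obtain f where "f \<in> F" "\<forall>u\<in>Y - {x}. f u = (if u = y then b else if u = z then c else h u)"
        using IH[of "Y - {x}" "\<lambda>u. (if u = y then b else if u = z then c else h u)"] by blast
      hence "\<forall>w\<in>W. f w = h w" "f y = b" "f z = c" using xyz by (simp_all add: W_def)
      thus "\<exists>a. R a b c" using \<open>f \<in> F\<close> unfolding R_def by blast
    qed
    ultimately have "R (h x) (h y) (h z)" by (rule triples)
    thus ?thesis unfolding R_def W_def by (metis Diff_iff empty_iff insert_iff)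
  next
    case False
    show ?thesis
    proof (cases "\<exists>x y. x \<in> Y \<and> y \<in> Y \<and> x \<noteq> y")
      case True
      then obtain x y where xy: "x \<in> Y" "y \<in> Y" "x \<noteq> y" by blast
      hence "Y = {x, y}" using False by blast
      thus ?thesis using less.prems(3)[OF xy, of "h x" "h y"] by auto
    next
      case one: False
      show ?thesis
      proof (cases "Y = {}")
        case True thus ?thesis using ne by auto
      next
        case False
        then obtain x where "x \<in> Y" by blast
        hence "Y = {x}" using one by blast
        thus ?thesis using less.prems(2)[of x "h x"] by auto
      qed
    qed
  qed
qed

text \<open>On a maximal set of pairwise independent points the previous lemma applies. Every
  further point is linked by a permutation to a point of that set, and \<open>pw\<close> shows that
  \<open>h\<close> respects this link.\<close>

theorem interpolation:
  fixes F :: "('x \<Rightarrow> 3) set"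
  assumes closed: "\<And>f g h. f \<in> F \<Longrightarrow> g \<in> F \<Longrightarrow> h \<in> F \<Longrightarrow> (\<lambda>x. t (f x) (g x) (h x)) \<in> F"
    and ne: "F \<noteq> {}" and fin: "finite X"
    and surj: "\<And>x a. x \<in> X \<Longrightarrow> \<exists>f\<in>F. f x = a"
    and pw: "\<And>x y. x \<in> X \<Longrightarrow> y \<in> X \<Longrightarrow> \<exists>f\<in>F. f x = h x \<and> f y = h y"
  shows "\<exists>f\<in>F. \<forall>x\<in>X. f x = h x"
proof -
  define ind where "ind Y \<longleftrightarrow> Y \<subseteq> X \<and> (\<forall>x\<in>Y. \<forall>y\<in>Y. x \<noteq> y \<longrightarrow> (\<forall>a b. \<exists>f\<in>F. f x = a \<and> f y = b))" for Y
  have "ind {}" by (simp add: ind_def)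
  moreover have "\<forall>Y. ind Y \<longrightarrow> card Y < Suc (card X)"
    using fin by (auto simp: ind_def less_Suc_eq_le card_mono)
  ultimately obtain Y where Y: "ind Y" and max: "\<And>Z. ind Z \<Longrightarrow> card Z \<le> card Y"
    using ex_has_greatest_nat[of ind "{}" card "Suc (card X)"] by auto
  have finY: "finite Y" using Y fin finite_subset by (auto simp: ind_def)
  have "\<exists>f\<in>F. \<forall>x\<in>Y. f x = h x"
  proof (rule independent_interpolation[OF closed ne _ _ finY])
    show "\<exists>f\<in>F. f x = a" if "x \<in> Y" for x a
      using that Y surj by (auto simp: ind_def)
    show "\<exists>f\<in>F. f x = a \<and> f y = b" if "x \<in> Y" "y \<in> Y" "x \<noteq> y" for x y a b
      using that Y by (simp add: ind_def)
  qed
  then obtain f where f: "f \<in> F" "\<forall>x\<in>Y. f x = h x" by blast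
  have "f x = h x" if x: "x \<in> X" "x \<notin> Y" for x
  proof -
    have nind: "\<not> ind (insert x Y)" using max[of "insert x Y"] finY x by auto
    have "\<exists>y\<in>Y. \<exists>a b. \<not> (\<exists>f\<in>F. f x = a \<and> f y = b)"
    proof (rule ccontr)
      assume "\<not> ?thesis"
      hence *: "\<exists>f\<in>F. f x = a \<and> f y = b" if "y \<in> Y" for y a b using that by simp
      have "\<exists>f\<in>F. f u = a \<and> f v = b" if uv: "u \<in> insert x Y" "v \<in> insert x Y" "u \<noteq> v" for u v a b
      proof -
        consider "u = x" "v \<in> Y" | "v = x" "u \<in> Y" | "u \<in> Y" "v \<in> Y" using uv by blast
        thus ?thesis
        proof cases
          case 1 thus ?thesis using * by simp
        next
          case 2
          thus ?thesis using *[of u b a] by (simp add: conj_commute)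
        next
          case 3 thus ?thesis using Y uv(3) by (simp add: ind_def)
        qed
      qed
      hence "ind (insert x Y)" using Y x unfolding ind_def by simp
      thus False using nind by simp
    qed
    then obtain y a b where y: "y \<in> Y" and ab: "\<not> (\<exists>f\<in>F. f x = a \<and> f y = b)" by auto
    define R where "R a b \<longleftrightarrow> (\<exists>f\<in>F. f x = b \<and> f y = a)" for a b
    have yX: "y \<in> X" using y Y by (auto simp: ind_def)
    have "closed2 t R"
      unfolding closed2_def
    proof (intro allI impI)
      fix a b a' b' a'' b''
      assume "R a b" "R a' b'" "R a'' b''"
      then obtain f g k where "f \<in> F" "g \<in> F" "k \<in> F"
        and *: "f x = b" "f y = a" "g x = b'" "g y = a'" "k x = b''" "k y = a''"
        unfolding R_def by auto
      hence "(\<lambda>x. t (f x) (g x) (k x)) \<in> F" using closed by blast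
      thus "R (t a a' a'') (t b b' b'')" unfolding R_def using * by auto
    qed
    moreover have "\<forall>a. \<exists>b. R a b" "\<forall>b. \<exists>a. R a b"
      unfolding R_def using surj[OF x(1)] surj[OF yX] by blast+
    moreover have "\<not> (\<forall>a b. R a b)" using ab unfolding R_def by blast
    ultimately obtain \<sigma> where \<sigma>: "\<And>a b. R a b \<longleftrightarrow> b = \<sigma> a" using pairs by blast
    have "R (f y) (f x)" using f(1) by (auto simp: R_def)
    moreover have "R (h y) (h x)" using pw[OF x(1) yX] by (auto simp: R_def)
    ultimately show ?thesis using f(2) y \<sigma> by auto
  qed
  thus ?thesis using f by blast
qed

end

section \<open>Relations closed under the rock-paper-scissors operation\<close>

lemma rps_simps [simp]:
  "rps a a = a" "rps a (a + 1) = a" "rps (a + 1) a = a" "rps a (a - 1) = a - 1" "rps (a - 1) a = a - 1"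
  "rps (a - 1) (a + 1) = a + 1" "rps (a + 1) (a - 1) = a + 1"
  using Z3_exhaust[of a] by (auto simp: rps_def)

lemma Z3_near: "(b::3) = a - 1 \<or> b = a \<or> b = a + 1"
  using Z3_exhaust[of a] Z3_exhaust[of b] by auto

lemma Z3_desc: "(b::3) = a \<or> b = a - 1 \<or> b = a - 1 - 1"
  using Z3_exhaust[of a] Z3_exhaust[of b] by auto

text \<open>A full fibre passes from \<open>a\<close> to \<open>a - 1\<close> and so around the
  cycle; hence no fibre is full if \<open>R\<close> is not. Then \<open>b - 1\<close> can be related
  only to \<open>a + 1\<close>, and combining this pair with \<open>R a b\<close> puts
  \<open>b - 1\<close> into the fibre of \<open>a\<close> after all.\<close>

lemma rps_branch_full:
  assumes cl: "\<And>a b c d. R a b \<Longrightarrow> R c d \<Longrightarrow> R (rps a c) (rps b d)"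
    and tot: "\<forall>a. \<exists>b. R a b" "\<forall>b. \<exists>a. R a b"
    and bb': "R a b" "R a (b + 1)"
  shows "R u v"
proof (rule ccontr)
  assume nR: "\<not> R u v"
  have down: "\<forall>b. R (a - 1) b" if "\<forall>b. R a b" for a
  proof -
    obtain b where b: "R (a - 1) b" using tot by blast
    have "R (a - 1) (b - 1)" if "R (a - 1) b" for b
      using cl[OF that, of a "b - 1"] \<open>\<forall>b. R a b\<close> by simp
    from this[OF b] this[OF this[OF b]] b show ?thesis by (metis Z3_near add_diff_cancel diff_add_cancel)
  qed
  have nfull: "\<not> (\<forall>b. R a b)" for a
  proof
    assume "\<forall>b. R a b"
    from this down[OF this] down[OF down[OF this]] show False
      using nR Z3_desc[of u a] by metis
  qed
  have 1: "\<not> R a (b - 1)" using nfull[of a] bb' Z3_near[of _ b] by metis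
  have 2: "\<not> R (a - 1) (b - 1)"
  proof
    assume *: "R (a - 1) (b - 1)"
    have "R (a - 1) (b + 1)" using cl[OF * bb'(2)] by simp
    moreover have "R (a - 1) b" using cl[OF calculation bb'(1)] by simp
    ultimately show False using nfull[of "a - 1"] * Z3_near[of _ b] by metis
  qed
  obtain a' where a': "R a' (b - 1)" using tot by blast
  hence "a' = a + 1" using 1 2 Z3_near[of a' a] by metis
  thus False using cl[OF bb'(1) a'] 1 by simp
qed

text \<open>Sharper than what \<open>decomposing\<close> asks for: a permutation that respects who
  beats whom is a rotation, and rotations are what self-dual functions commute with.\<close>

lemma rps_pairs:
  assumes closed: "\<forall>a b c d. R a b \<longrightarrow> R c d \<longrightarrow> R (rps a c) (rps b d)"
    and tot: "\<forall>a. \<exists>b. R a b" "\<forall>b. \<exists>a. R a b"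
  shows "(\<forall>a b. R a b) \<or> (\<exists>c. \<forall>a b. R a b \<longleftrightarrow> b = a + c)"
proof (cases "\<forall>a b. R a b")
  case False
  have cl: "R a b \<Longrightarrow> R c d \<Longrightarrow> R (rps a c) (rps b d)" for a b c d
    using closed by blast
  have no_suc: "\<not> (R a b \<and> R a (b + 1))" for a b
    using rps_branch_full[of R a b, OF cl tot] False by blast
  have fu: "b = b'" if "R a b" "R a b'" for a b b'
    using no_suc[of a b] no_suc[of a b'] Z3_near[of b' b] that by auto
  obtain \<sigma> where \<sigma>: "\<And>a. R a (\<sigma> a)" using tot by metis
  have R: "R a b \<longleftrightarrow> b = \<sigma> a" for a b using \<sigma> fu by blast
  have "inj \<sigma>"
    using tot(2) unfolding R by (metis finite_UNIV_inj_surj finite_UNIV_surj_inj finite surjI)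
  have "\<sigma> (a + 1) = \<sigma> a + 1" for a
  proof -
    have "rps (\<sigma> a) (\<sigma> (a + 1)) = \<sigma> a" using cl[OF \<sigma>[of a] \<sigma>[of "a + 1"]] by (simp add: R)
    moreover have "\<sigma> (a + 1) \<noteq> \<sigma> a" using \<open>inj \<sigma>\<close> by (simp add: inj_eq)
    ultimately show ?thesis by (auto simp: rps_def split: if_splits)
  qed
  from this[of 0] this[of 1] have "\<sigma> a = a + \<sigma> 0" for a
    using Z3_exhaust[of a] by (auto simp: add.commute)
  thus ?thesis using R by metis
qed simp

text \<open>Each fibre over the first coordinate is full or the graph of a rotation by
  \<open>k a\<close>. One full fibre makes the preceding one full. If none is full,
  \<open>rps\<close> forces all \<open>k a\<close> to be equal, and the projection to the last two
  coordinates is too small.\<close>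

lemma rps_triples:
  assumes closed: "closed3 (\<lambda>a b c. rps a b) R"
    and 12: "\<forall>a b. \<exists>c. R a b c" and 13: "\<forall>a c. \<exists>b. R a b c" and 23: "\<forall>b c. \<exists>a. R a b c"
  shows "R a b c"
proof -
  have cl: "R a b c \<Longrightarrow> R a' b' c' \<Longrightarrow> R (rps a a') (rps b b') (rps c c')" for a b c a' b' c'
    using closed unfolding closed3_def by blast
  have fib: "(\<forall>b c. R a b c) \<or> (\<exists>k. \<forall>b c. R a b c \<longleftrightarrow> c = b + k)" for a
  proof (rule rps_pairs)
    have "rps a a = a" by (simp add: rps_def)
    thus "\<forall>b c b' c'. R a b c \<longrightarrow> R a b' c' \<longrightarrow> R a (rps b b') (rps c c')" using cl by metis
  qed (use 12 13 in auto)
  have rps_suc: "rps a (a + 1) = a" for a by (simp add: rps_def)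
  have full_down: "\<forall>b c. R a b c" if full: "\<forall>b c. R (a + 1) b c" for a
  proof (rule ccontr)
    assume "\<not> (\<forall>b c. R a b c)"
    then obtain k where k: "\<And>b c. R a b c \<longleftrightarrow> c = b + k" using fib[of a] by blast
    have "R (rps a (a + 1)) (rps 0 0) (rps (0 + k) (k - 1))"
      using full k by (intro cl) auto
    thus False using k Z3_exhaust[of k] by (auto simp: rps_def)
  qed
  show ?thesis
  proof (cases "\<exists>a. \<forall>b c. R a b c")
    case True
    then obtain a0 where a0: "\<forall>b c. R a0 b c" by blast
    hence 1: "\<forall>b c. R (a0 - 1) b c" using full_down[of "a0 - 1"] by simp
    hence 2: "\<forall>b c. R (a0 - 1 - 1) b c" using full_down[of "a0 - 1 - 1"] by simp
    thus ?thesis using a0 1 Z3_desc[of a a0] by metis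
  next
    case False
    then obtain k where k: "\<And>a b c. R a b c \<longleftrightarrow> c = b + k a" using fib by metis
    have "k a = k (a + 1)" for a
    proof -
      have "R (rps a (a + 1)) (rps b b') (rps (b + k a) (b' + k (a + 1)))" for b b'
        by (rule cl) (auto simp: k)
      hence "rps (b + k a) (b' + k (a + 1)) = rps b b' + k a" for b b' by (simp add: k rps_suc)
      from this[of 0 0] this[of 0 1] this[of 0 2] show ?thesis
        using Z3_exhaust[of "k a"] Z3_exhaust[of "k (a + 1)"] by (auto simp: rps_def split: if_splits)
    qed
    from this[of 0] this[of 1] have "k a = k 0" for a using Z3_exhaust[of a] by auto
    moreover obtain a where "R a 0 (k 0 + 1)" using 23 by blast
    ultimately have "k 0 + 1 = k 0" using k[of a 0 "k 0 + 1"] by simp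
    thus ?thesis by simp
  qed
qed

lemma bij_translation: "bij (\<lambda>a::3. a + c)"
  by (rule bij_betw_byWitness[where f' = "\<lambda>a. a - c"]) auto

interpretation rps: decomposing "\<lambda>a b c. rps a b"
proof
  show "rps a a = a" for a by (simp add: rps_def)
  fix R :: "3 \<Rightarrow> 3 \<Rightarrow> bool"
  assume "closed2 (\<lambda>a b c. rps a b) R" "\<forall>a. \<exists>b. R a b" "\<forall>b. \<exists>a. R a b"
  hence "(\<forall>a b. R a b) \<or> (\<exists>c. \<forall>a b. R a b \<longleftrightarrow> b = a + c)"
    by (intro rps_pairs) (auto simp: closed2_def)
  thus "(\<forall>a b. R a b) \<or> (\<exists>\<sigma>. bij \<sigma> \<and> (\<forall>a b. R a b \<longleftrightarrow> b = \<sigma> a))"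
    using bij_translation by blast
qed (rule rps_triples)

section \<open>Relations closed under the minority operation\<close>

lemma mino_simps [simp]:
  "mino a a c = c" "mino a b a = b" "mino a b b = a"
  by (auto simp: mino_def)

lemma mino_distinct: "a \<noteq> b \<Longrightarrow> a \<noteq> c \<Longrightarrow> mino a b c = a"
  by (auto simp: mino_def)

lemma Z3_third: "b \<noteq> (b'::3) \<Longrightarrow> c \<noteq> b \<Longrightarrow> c \<noteq> b' \<Longrightarrow> d = b \<or> d = b' \<or> d = c"
proof -
  have "\<forall>b b' c d::3. b \<noteq> b' \<longrightarrow> c \<noteq> b \<longrightarrow> c \<noteq> b' \<longrightarrow> d = b \<or> d = b' \<or> d = c"
    by (simp add: Z3_all)
  thus "b \<noteq> b' \<Longrightarrow> c \<noteq> b \<Longrightarrow> c \<noteq> b' \<Longrightarrow> d = b \<or> d = b' \<or> d = c" by blast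
qed

lemma Z3_ex_third: "\<exists>c::3. c \<noteq> b \<and> c \<noteq> b'"
proof -
  have "\<forall>b b'::3. \<exists>c. c \<noteq> b \<and> c \<noteq> b'" by (simp add: Z3_all Z3_ex)
  thus ?thesis by blast
qed

text \<open>The Mal'cev identities make \<open>R\<close> rectangular, so one element related to
  everything fills \<open>R\<close>. The branching element \<open>a\<close> is such an element:
  \<open>mino\<close> applied to \<open>b\<close>, \<open>c\<close>, \<open>b'\<close> relates
  \<open>b\<close> to a preimage \<open>a'\<close> of \<open>c\<close>, and rectangularity then
  relates \<open>a\<close> to \<open>c\<close>.\<close>

lemma mino_branch_full:
  assumes cl: "\<And>a b a' b' a'' b''. R a b \<Longrightarrow> R a' b' \<Longrightarrow> R a'' b'' \<Longrightarrow> R (mino a a' a'') (mino b b' b'')"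
    and tot: "\<forall>a. \<exists>b. R a b" "\<forall>b. \<exists>a. R a b"
    and bb': "R a b" "R a b'" "b \<noteq> b'"
  shows "R u v"
proof -
  have rect: "R a' b'" if "R a b" "R a b'" "R a' b" for a b a' b'
    using cl[OF that(3,1,2)] by simp
  obtain c where c: "c \<noteq> b" "c \<noteq> b'" using Z3_ex_third by blast
  obtain a' where a': "R a' c" using tot by blast
  have "R a' b" using cl[OF bb'(1) a' bb'(2)] c bb'(3) by (simp add: mino_distinct)
  hence "R a c" using rect[OF _ a' bb'(1)] by blast
  hence all: "R a d" for d using Z3_third[OF bb'(3) c] bb' by metis
  obtain w where "R u w" using tot by blast
  thus ?thesis using rect[OF all[of w] all[of v]] by blast
qed

lemma mino_pairs:
  assumes closed: "closed2 mino R" and tot: "\<forall>a. \<exists>b. R a b" "\<forall>b. \<exists>a. R a b"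
  shows "(\<forall>a b. R a b) \<or> (\<exists>\<sigma>. bij \<sigma> \<and> (\<forall>a b. R a b \<longleftrightarrow> b = \<sigma> a))"
proof (cases "\<forall>a b. R a b")
  case False
  have cl: "R a b \<Longrightarrow> R a' b' \<Longrightarrow> R a'' b'' \<Longrightarrow> R (mino a a' a'') (mino b b' b'')" for a b a' b' a'' b''
    using closed unfolding closed2_def by blast
  have fu: "b = b'" if "R a b" "R a b'" for a b b'
    using mino_branch_full[OF cl tot that] False by blast
  have inj: "a = a'" if "R a b" "R a' b" for a a' b
    using mino_branch_full[of "\<lambda>b a. R a b", OF cl tot(2,1) that] False by blast
  obtain \<sigma> where \<sigma>: "\<And>a. R a (\<sigma> a)" using tot by metis
  have R: "R a b \<longleftrightarrow> b = \<sigma> a" for a b using \<sigma> fu by blast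
  have "bij \<sigma>" using inj tot(2) unfolding R by (metis bijI injI surjI)
  thus ?thesis using R by blast
qed simp

text \<open>One full fibre fills \<open>R\<close> by the Mal'cev identities. Otherwise the
  permutations \<open>\<sigma> a\<close> coincide: if \<open>\<sigma> a y\<close> and
  \<open>\<sigma> b y\<close> differ, \<open>mino\<close> makes \<open>\<sigma> b\<close> send both
  elements other than \<open>y\<close> to \<open>\<sigma> a y\<close>. Then the last two coordinates
  do not project fully.\<close>

lemma mino_triples:
  assumes closed: "closed3 mino R"
    and 12: "\<forall>a b. \<exists>c. R a b c" and 13: "\<forall>a c. \<exists>b. R a b c" and 23: "\<forall>b c. \<exists>a. R a b c"
  shows "R a b c"
proof -
  have cl: "R a b c \<Longrightarrow> R a' b' c' \<Longrightarrow> R a'' b'' c'' \<Longrightarrow> R (mino a a' a'') (mino b b' b'') (mino c c' c'')"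
    for a b c a' b' c' a'' b'' c''
    using closed unfolding closed3_def by blast
  have fib: "(\<forall>b c. R a b c) \<or> (\<exists>\<sigma>. bij \<sigma> \<and> (\<forall>b c. R a b c \<longleftrightarrow> c = \<sigma> b))" for a
  proof (rule mino_pairs)
    show "closed2 mino (R a)"
      unfolding closed2_def using cl[of a _ _ a _ _ a] by simp
  qed (use 12 13 in auto)
  show ?thesis
  proof (cases "\<exists>a. \<forall>b c. R a b c")
    case True
    then obtain a0 where a0: "R a0 b c" for b c by blast
    obtain b0 where b0: "R a b0 c" using 13 by blast
    show ?thesis using cl[OF b0 a0[of b0 c] a0[of b c]] by simp
  next
    case False
    then obtain \<sigma> where bij: "bij (\<sigma> a)" and \<sigma>: "R a b c \<longleftrightarrow> c = \<sigma> a b" for a b c using fib by metis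
    have inj: "\<sigma> a b = \<sigma> a b' \<longleftrightarrow> b = b'" for a b b' using bij[of a] by (metis bij_is_inj inj_eq)
    have eq: "mino (\<sigma> a v) (\<sigma> b y) (\<sigma> b y') = \<sigma> a (mino v y y')" for a b v y y'
    proof -
      have "R (mino a b b) (mino v y y') (mino (\<sigma> a v) (\<sigma> b y) (\<sigma> b y'))"
        by (rule cl) (simp_all add: \<sigma>)
      thus ?thesis by (simp add: \<sigma>)
    qed
    have same: "\<sigma> a y = \<sigma> b y" for a b y
    proof (rule ccontr)
      assume ne: "\<sigma> a y \<noteq> \<sigma> b y"
      have "\<sigma> b y' = \<sigma> a y" if "y' \<noteq> y" for y'
        using eq[of a y b y y'] ne inj[of a y y'] that by (auto simp: mino_def split: if_splits)
      hence "\<sigma> b (y + 1) = \<sigma> b (y + 2)" by simp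
      thus False by (simp add: inj)
    qed
    obtain a' where "R a' 0 (\<sigma> 0 0 + 1)" using 23 by blast
    thus ?thesis using same[of a' 0 0] by (simp add: \<sigma>)
  qed
qed

interpretation mino: decomposing mino
  by unfold_locales (simp, rule mino_pairs, assumption+, rule mino_triples, assumption+)

section \<open>Near-unanimity and idempotence\<close>

lemma Z3_diff: "(a::3) - b = a + b + b"
  using Z3_exhaust[of b] by auto

text \<open>Canonical representatives: a function with \<open>dep n\<close> is known from its values
  on this finite set.\<close>

definition padded :: "nat \<Rightarrow> (nat \<Rightarrow> 3) set" where
  "padded n = {x. \<forall>i\<ge>n. x i = 0}"

lemma finite_padded: "finite (padded n)"
proof (rule finite_subset)
  show "padded n \<subseteq> (\<lambda>f i. if i < n then f i else 0) ` ({..<n} \<rightarrow>\<^sub>E UNIV)"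
  proof
    fix x assume "x \<in> padded n"
    hence "x = (\<lambda>i. if i < n then restrict x {..<n} i else 0)" by (auto simp: padded_def)
    thus "x \<in> (\<lambda>f i. if i < n then f i else 0) ` ({..<n} \<rightarrow>\<^sub>E UNIV)"
      by (intro image_eqI[where x = "restrict x {..<n}"]) auto
  qed
  show "finite ((\<lambda>f i. if i < n then f i else 0) ` ({..<n} \<rightarrow>\<^sub>E (UNIV::3 set)))"
    by (intro finite_imageI finite_PiE) auto
qed

definition is_nu :: "nat \<Rightarrow> ((nat \<Rightarrow> 3) \<Rightarrow> 3) \<Rightarrow> bool" where
  "is_nu n F \<longleftrightarrow> (\<forall>a b. \<forall>j<n. F (\<lambda>i. if i = j then b else a) = a)"

text \<open>Coordinates with equal columns over \<open>X\<close> can be merged without changing any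
  tuple in \<open>X\<close>, and there are at most \<open>3 ^ card X\<close> columns. A
  representative is taken from \<open>I\<close> whenever its class meets \<open>I\<close>, so that
  variables carrying a Boolean part stay among themselves.\<close>

lemma card_key_image:
  fixes X :: "(nat \<Rightarrow> 3) set" and I :: "nat set"
  assumes fin: "finite X"
  shows "\<exists>\<rho>. (\<forall>i<n. \<rho> i < n \<and> (\<forall>x\<in>X. x (\<rho> i) = x i) \<and> (i \<in> I \<longrightarrow> \<rho> i \<in> I)) \<and>
     card (\<rho> ` {..<n}) \<le> 3 ^ card X"
proof -
  define key :: "nat \<Rightarrow> (nat \<Rightarrow> 3) \<Rightarrow> 3" where "key i = (\<lambda>x\<in>X. x i)" for i
  define r where "r \<kappa> = (if \<exists>j<n. j \<in> I \<and> key j = \<kappa> then SOME j. j < n \<and> j \<in> I \<and> key j = \<kappa>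
      else SOME j. j < n \<and> key j = \<kappa>)" for \<kappa>
  have r: "r (key i) < n \<and> key (r (key i)) = key i \<and> (i \<in> I \<longrightarrow> r (key i) \<in> I)" if i: "i < n" for i
  proof (cases "\<exists>j<n. j \<in> I \<and> key j = key i")
    case True
    hence "r (key i) = (SOME j. j < n \<and> j \<in> I \<and> key j = key i)" by (simp add: r_def)
    moreover have "\<exists>j. j < n \<and> j \<in> I \<and> key j = key i" using True by blast
    ultimately show ?thesis using someI_ex[of "\<lambda>j. j < n \<and> j \<in> I \<and> key j = key i"] by simp
  next
    case False
    hence "r (key i) = (SOME j. j < n \<and> key j = key i)" by (auto simp: r_def)
    moreover have "\<exists>j. j < n \<and> key j = key i" using i by blast
    ultimately show ?thesis using someI_ex[of "\<lambda>j. j < n \<and> key j = key i"] False i by auto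
  qed
  have "x (r (key i)) = x i" if "i < n" "x \<in> X" for i x
  proof -
    have "key (r (key i)) x = key i x" using r[OF that(1)] by simp
    thus ?thesis using that(2) by (simp add: key_def)
  qed
  moreover have "card ((\<lambda>i. r (key i)) ` {..<n}) \<le> 3 ^ card X"
  proof -
    have "card ((\<lambda>i. r (key i)) ` {..<n}) \<le> card (key ` {..<n})"
      unfolding image_image[of r key, symmetric] by (rule card_image_le) simp
    also have "\<dots> \<le> card (X \<rightarrow>\<^sub>E (UNIV::3 set))"
      by (rule card_mono) (auto simp: key_def fin intro!: finite_PiE)
    also have "\<dots> = 3 ^ card X" by (simp add: card_PiE fin)
    finally show ?thesis .
  qed
  ultimately show ?thesis using r by (intro exI[of _ "\<lambda>i. r (key i)"]) auto
qed

context self_dual_fam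
begin

lemma comp2: "(\<lambda>x. f (x 0) (x 1)) \<in> K 2 \<Longrightarrow> G \<in> K n \<Longrightarrow> H \<in> K n \<Longrightarrow> (\<lambda>x. f (G x) (H x)) \<in> K n"
  using comp[of "\<lambda>x. f (x 0) (x 1)" 2 "\<lambda>i. if i = 0 then G else H" n] by simp

lemma comp3:
  "(\<lambda>x. f (x 0) (x 1) (x 2)) \<in> K 3 \<Longrightarrow> G \<in> K n \<Longrightarrow> H \<in> K n \<Longrightarrow> J \<in> K n \<Longrightarrow>
    (\<lambda>x. f (G x) (H x) (J x)) \<in> K n"
  using comp[of "\<lambda>x. f (x 0) (x 1) (x 2)" 3 "\<lambda>i. if i = 0 then G else if i = 1 then H else J" n] by simp

text \<open>The coordinates that survive are renamed into \<open>{..<m}\<close>, which gives a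
  member of the common \<open>m\<close>-ary part; renaming back happens inside
  \<open>L\<close>.\<close>

lemma collapse:
  assumes L: "self_dual_fam L" and eq: "K m = L m" and F: "F \<in> K n"
    and \<rho>: "\<And>i. i < n \<Longrightarrow> \<rho> i < n" and card: "card (\<rho> ` {..<n}) \<le> m"
  shows "(\<lambda>x. F (\<lambda>i. x (\<rho> i))) \<in> L n"
proof -
  interpret L: self_dual_fam L by (rule L)
  let ?R = "\<rho> ` {..<n}"
  obtain e where e: "inj_on e ?R" "e ` ?R \<subseteq> {..<m}"
    using card_le_inj[of ?R "{..<m}"] card by auto
  define \<tau> where "\<tau> k = (if k \<in> e ` ?R then inv_into ?R e k else 0)" for k
  have "(\<lambda>x. F (\<lambda>i. x (e (\<rho> i)))) \<in> K m"
    using minor[OF F, of "\<lambda>i. e (\<rho> i)" m] e(2) by auto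
  hence "(\<lambda>x. F (\<lambda>i. x (e (\<rho> i)))) \<in> L m" by (simp add: eq)
  moreover have "\<tau> k < n" for k
  proof (cases "k \<in> e ` ?R")
    case True
    hence "inv_into ?R e k \<in> ?R" by (rule inv_into_into)
    thus ?thesis using True \<rho> by (auto simp: \<tau>_def)
  qed (use K_pos[OF F] in \<open>simp add: \<tau>_def\<close>)
  ultimately have "(\<lambda>x. F (\<lambda>i. x (\<tau> (e (\<rho> i))))) \<in> L n"
    using L.minor[of "\<lambda>x. F (\<lambda>i. x (e (\<rho> i)))" m \<tau> n] by simp
  moreover have "F (\<lambda>i. x (\<tau> (e (\<rho> i)))) = F (\<lambda>i. x (\<rho> i))" for x
    using e(1) by (intro depD[OF dep[OF F]]) (simp add: \<tau>_def)
  ultimately show ?thesis by simp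
qed

text \<open>Up to \<open>k\<close> tuples show at most \<open>3 ^ k\<close> columns, so a common
  minor interpolates. For more tuples, take \<open>k + 1\<close> of them and, for each, a member
  that may be wrong only there; at every tuple at most one of these members errs, and
  \<open>N\<close> outvotes it.\<close>

lemma nu_determined:
  assumes L: "self_dual_fam L" and eq: "K (3 ^ k) = L (3 ^ k)"
    and N: "N \<in> L (Suc k)" "is_nu (Suc k) N"
  shows "K n \<subseteq> L n"
proof
  interpret L: self_dual_fam L by (rule L)
  fix F assume F: "F \<in> K n"
  have interp: "\<exists>G\<in>L n. \<forall>x\<in>W. G x = F x" if "finite W" for W
    using that
  proof (induction "card W" arbitrary: W rule: less_induct)
    case less
    show ?case
    proof (cases "card W \<le> k")
      case True
      obtain \<rho> where \<rho>: "\<And>i. i < n \<Longrightarrow> \<rho> i < n" "\<And>i x. i < n \<Longrightarrow> x \<in> W \<Longrightarrow> x (\<rho> i) = x i"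
        and "card (\<rho> ` {..<n}) \<le> 3 ^ card W"
        using card_key_image[OF less.prems, of n "{}"] by auto
      hence "card (\<rho> ` {..<n}) \<le> 3 ^ k"
        using power_increasing[OF True, of "3::nat"] by linarith
      hence "(\<lambda>x. F (\<lambda>i. x (\<rho> i))) \<in> L n" using collapse[OF L eq F] \<rho>(1) by blast
      moreover have "F (\<lambda>i. x (\<rho> i)) = F x" if "x \<in> W" for x
        using \<rho>(2) that by (intro depD[OF dep[OF F]])
      ultimately show ?thesis by (intro bexI[of _ "\<lambda>x. F (\<lambda>i. x (\<rho> i))"]) auto
    next
      case False
      then obtain T where T: "T \<subseteq> W" "card T = Suc k" "finite T"
        using obtain_subset_with_card_n[of "Suc k" W] less.prems by auto
      then obtain w where w: "bij_betw w {..<Suc k} T"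
        using ex_bij_betw_nat_finite[of T] by (auto simp: atLeast0LessThan)
      have "\<exists>G\<in>L n. \<forall>x\<in>W - {w j}. G x = F x" if "j < Suc k" for j
      proof (rule less.hyps)
        have "w j \<in> W" using w T(1) that by (auto simp: bij_betw_def)
        thus "card (W - {w j}) < card W" using less.prems by (rule_tac card_Diff1_less)
      qed (use less.prems in simp)
      then obtain G where G: "\<And>j. j < Suc k \<Longrightarrow> G j \<in> L n"
        "\<And>j x. j < Suc k \<Longrightarrow> x \<in> W - {w j} \<Longrightarrow> G j x = F x" by metis
      have "(\<lambda>x. N (\<lambda>j. G j x)) \<in> L n" by (rule L.comp[OF N(1)]) (rule G(1))
      moreover have "N (\<lambda>j. G j x) = F x" if x: "x \<in> W" for x
      proof -
        \<comment> \<open>The index of the one member that may be wrong at \<open>x\<close>. Outside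
          \<open>T\<close> all members are right, and any index will do.\<close>
        define j0 where "j0 = (if x \<in> T then the_inv_into {..<Suc k} w x else 0)"
        have j0: "j0 < Suc k" "\<And>j. j < Suc k \<Longrightarrow> j \<noteq> j0 \<Longrightarrow> x \<noteq> w j"
          using w the_inv_into_into[of w "{..<Suc k}" x "{..<Suc k}"] the_inv_into_f_f[of w "{..<Suc k}"]
          by (auto simp: j0_def bij_betw_def)
        have "N (\<lambda>j. G j x) = N (\<lambda>j. if j = j0 then G j0 x else F x)"
          using j0 G(2) x by (intro depD[OF L.dep[OF N(1)]]) auto
        thus ?thesis using N(2) j0(1) by (simp add: is_nu_def)
      qed
      ultimately show ?thesis by (intro bexI[of _ "\<lambda>x. N (\<lambda>j. G j x)"]) auto
    qed
  qed
  have "finite (padded n)" by (rule finite_padded)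
  then obtain G where G: "G \<in> L n" "\<And>x. x \<in> padded n \<Longrightarrow> G x = F x" using interp by blast
  have "G x = F x" for x
  proof -
    let ?y = "\<lambda>i. if i < n then x i else 0"
    have "G x = G ?y" by (rule depD[OF L.dep[OF G(1)]]) simp
    also have "\<dots> = F ?y" by (rule G(2)) (simp add: padded_def)
    also have "\<dots> = F x" by (rule depD[OF dep[OF F]]) simp
    finally show ?thesis .
  qed
  thus "F \<in> L n" using G(1) by (metis ext)
qed

end

lemma countably_many_eq:
  assumes "\<And>K. K \<in> X \<Longrightarrow> self_dual_fam K"
    and "\<And>K L n. K \<in> X \<Longrightarrow> L \<in> X \<Longrightarrow> K m = L m \<Longrightarrow> K n \<subseteq> L n"
  shows "countably_many X"
proof (rule countably_many_finite_part[OF assms(1)])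
  fix K L assume "K \<in> X" "L \<in> X" "K m = L m"
  hence "K n = L n" for n using assms(2)[of K L n] assms(2)[of L K n] by auto
  hence "K = L" by (rule ext)
  thus "minor_eq K L" by (simp add: minor_eq_refl)
qed

lemma countably_many_nu:
  "countably_many {K. self_dual_fam K \<and> (\<exists>k. \<exists>N\<in>K k. is_nu k N)}"
proof (rule countably_many_subset)
  show "countably_many (\<Union>k. {K. self_dual_fam K \<and> (\<exists>N\<in>K (Suc k). is_nu (Suc k) N)})"
  proof (rule countably_many_UN)
    fix k
    show "countably_many {K. self_dual_fam K \<and> (\<exists>N\<in>K (Suc k). is_nu (Suc k) N)}"
      by (rule countably_many_eq[where m = "3 ^ k"]) (auto dest: self_dual_fam.nu_determined)
  qed
  show "{K. self_dual_fam K \<and> (\<exists>k. \<exists>N\<in>K k. is_nu k N)}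
      \<subseteq> (\<Union>k. {K. self_dual_fam K \<and> (\<exists>N\<in>K (Suc k). is_nu (Suc k) N)})"
  proof clarify
    fix K k N assume K: "self_dual_fam K" and N: "N \<in> K k" "is_nu k N"
    then obtain k' where "k = Suc k'" using self_dual_fam.K_pos[OF K] gr0_implies_Suc by blast
    thus "K \<in> (\<Union>k. {K. self_dual_fam K \<and> (\<exists>N\<in>K (Suc k). is_nu (Suc k) N)})" using K N by auto
  qed
qed

section \<open>Idempotent parts\<close>

locale idempotent_fam = self_dual_fam +
  assumes idem: "F \<in> K n \<Longrightarrow> F (\<lambda>i. a) = a"

definition idempotent_part :: "fam \<Rightarrow> fam" where
  "idempotent_part K n = {F \<in> K n. \<forall>a. F (\<lambda>i. a) = a}"

context self_dual_fam
begin

lemma idempotent_fam_part: "idempotent_fam (idempotent_part K)"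
proof
  fix F m n and G :: "nat \<Rightarrow> (nat \<Rightarrow> 3) \<Rightarrow> 3"
  assume F: "F \<in> idempotent_part K m" and G: "\<And>i. i < m \<Longrightarrow> G i \<in> idempotent_part K n"
  have "(\<lambda>x. F (\<lambda>i. G i x)) \<in> K n"
    using F G by (rule_tac comp[of F m]) (auto simp: idempotent_part_def)
  moreover have "F (\<lambda>i. G i (\<lambda>i. a)) = a" for a
  proof -
    have "F (\<lambda>i. G i (\<lambda>i. a)) = F (\<lambda>i. a)"
      using F G by (intro depD[OF dep, of F m]) (auto simp: idempotent_part_def)
    thus ?thesis using F by (simp add: idempotent_part_def)
  qed
  ultimately show "(\<lambda>x. F (\<lambda>i. G i x)) \<in> idempotent_part K n" by (simp add: idempotent_part_def)
qed (auto simp: idempotent_part_def dep proj rot1)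

lemma minor_eq_idempotent_part: "minor_eq K (idempotent_part K)"
  unfolding minor_eq_def
proof
  show "minor_le (idempotent_part K) K"
    by (rule minor_leI[where \<phi> = "\<lambda>n F. F"]) (auto simp: idempotent_part_def)
  show "minor_le K (idempotent_part K)"
  proof (rule minor_leI[where \<phi> = "\<lambda>n F x. F x - F (\<lambda>i. 0)"])
    fix n F assume F: "F \<in> K n"
    let ?c = "F (\<lambda>i. 0)"
    have diag: "F (\<lambda>i. a) = a + ?c" for a using rot[OF F, of "\<lambda>i. 0" a] by (simp add: add.commute)
    \<comment> \<open>The diagonal of \<open>F\<close> is a rotation inside the clone; applied twice
      it subtracts \<open>?c\<close>.\<close>
    have shift: "(\<lambda>x. G x + ?c) \<in> K n" if "G \<in> K n" for G
    proof -
      have "(\<lambda>x. F (\<lambda>i. G x)) \<in> K n" by (rule comp[OF F]) (rule that)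
      moreover have "(\<lambda>x. F (\<lambda>i. G x)) = (\<lambda>x. G x + ?c)" by (rule ext) (rule diag)
      ultimately show ?thesis by simp
    qed
    have "(\<lambda>x. F x - ?c) \<in> K n" using shift[OF shift[OF F]] by (simp add: Z3_diff)
    moreover have "F (\<lambda>i. a) - ?c = a" for a using diag[of a] by simp
    ultimately show "(\<lambda>x. F x - ?c) \<in> idempotent_part K n" by (simp add: idempotent_part_def)
  qed auto
qed

end

section \<open>Non-conservative clones\<close>

lemma Z3_numerals [simp]: "(3::3) = 0" "(4::3) = 1" "(5::3) = 2" "(6::3) = 0" "- 1 = (2::3)" "- 2 = (1::3)"
  by simp_all

definition bin :: "fam \<Rightarrow> (3 \<Rightarrow> 3 \<Rightarrow> 3) \<Rightarrow> bool" where
  "bin K g \<longleftrightarrow> (\<lambda>x. g (x 0) (x 1)) \<in> K 2"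

definition ter :: "fam \<Rightarrow> (3 \<Rightarrow> 3 \<Rightarrow> 3 \<Rightarrow> 3) \<Rightarrow> bool" where
  "ter K g \<longleftrightarrow> (\<lambda>x. g (x 0) (x 1) (x 2)) \<in> K 3"

text \<open>The idempotent affine operation \<open>2 * a + 2 * b\<close>; it sends two distinct
  elements to the third.\<close>

definition aff2 :: "3 \<Rightarrow> 3 \<Rightarrow> 3" where
  "aff2 a b = - a - b"

text \<open>By rotation, every two-element subset is then a subuniverse.\<close>

definition conservative :: "fam \<Rightarrow> bool" where
  "conservative K \<longleftrightarrow> (\<forall>n. \<forall>F\<in>K n. \<forall>S. F (\<lambda>i. if i \<in> S then 1 else 0) \<in> {0, 1})"

lemma Z3_square: "(a::3) \<noteq> 0 \<Longrightarrow> a * a = 1"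
  using Z3_exhaust[of a] by auto

lemma Z3_cases_translate:
  assumes "\<And>a b. h (a + 1::3) (b + 1::3) = h a b + (1::3)" and "h 0 0 = k 0 0" "h 0 1 = k 0 1" "h 0 2 = k 0 2"
    and "\<And>a b. k (a + 1::3) (b + 1::3) = k a b + (1::3)"
  shows "h a b = k a b"
  using assms(1)[of 0 0] assms(1)[of 1 1] assms(5)[of 0 0] assms(5)[of 1 1]
    assms(1)[of 0 1] assms(1)[of 1 2] assms(5)[of 0 1] assms(5)[of 1 2]
    assms(1)[of 0 2] assms(1)[of 1 0] assms(5)[of 0 2] assms(5)[of 1 0] assms(2-4)
    Z3_exhaust[of a] Z3_exhaust[of b] by auto

lemma rps_translate: "rps (a + c) (b + c) = rps a b + c"
  by (simp add: rps_def algebra_simps)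

context self_dual_fam
begin

lemma bin_apply: "bin K g \<Longrightarrow> G \<in> K n \<Longrightarrow> H \<in> K n \<Longrightarrow> (\<lambda>x. g (G x) (H x)) \<in> K n"
  unfolding bin_def by (rule comp2)

lemma ter_apply: "ter K g \<Longrightarrow> G \<in> K n \<Longrightarrow> H \<in> K n \<Longrightarrow> J \<in> K n \<Longrightarrow> (\<lambda>x. g (G x) (H x) (J x)) \<in> K n"
  unfolding ter_def by (rule comp3)

lemma bin_fst: "bin K (\<lambda>a b. a)" and bin_snd: "bin K (\<lambda>a b. b)"
  unfolding bin_def by (rule proj, simp)+

lemma ter_1: "ter K (\<lambda>a b c. a)" and ter_2: "ter K (\<lambda>a b c. b)" and ter_3: "ter K (\<lambda>a b c. c)"
  unfolding ter_def by (rule proj, simp)+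

lemma bin_bin: "bin K g \<Longrightarrow> bin K h \<Longrightarrow> bin K k \<Longrightarrow> bin K (\<lambda>a b. g (h a b) (k a b))"
  using bin_apply[of g "\<lambda>x. h (x 0) (x 1)" 2 "\<lambda>x. k (x 0) (x 1)"] by (simp add: bin_def)

lemma bin_ter: "ter K g \<Longrightarrow> bin K h \<Longrightarrow> bin K k \<Longrightarrow> bin K l \<Longrightarrow> bin K (\<lambda>a b. g (h a b) (k a b) (l a b))"
  using ter_apply[of g "\<lambda>x. h (x 0) (x 1)" 2 "\<lambda>x. k (x 0) (x 1)" "\<lambda>x. l (x 0) (x 1)"]
  by (simp add: bin_def)

lemma ter_bin: "bin K g \<Longrightarrow> ter K h \<Longrightarrow> ter K k \<Longrightarrow> ter K (\<lambda>a b c. g (h a b c) (k a b c))"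
  using bin_apply[of g "\<lambda>x. h (x 0) (x 1) (x 2)" 3 "\<lambda>x. k (x 0) (x 1) (x 2)"]
  by (simp add: bin_def ter_def)

lemma ter_ter:
  "ter K g \<Longrightarrow> ter K h \<Longrightarrow> ter K k \<Longrightarrow> ter K l \<Longrightarrow> ter K (\<lambda>a b c. g (h a b c) (k a b c) (l a b c))"
  using ter_apply[of g "\<lambda>x. h (x 0) (x 1) (x 2)" 3 "\<lambda>x. k (x 0) (x 1) (x 2)" "\<lambda>x. l (x 0) (x 1) (x 2)"]
  by (simp add: bin_def ter_def)

lemma bin_rot: "bin K g \<Longrightarrow> g (a + c) (b + c) = g a b + c"
  using rot[of "\<lambda>x. g (x 0) (x 1)" 2 "\<lambda>i. if i = 0 then a else b" c] by (simp add: bin_def)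

lemma ter_rot: "ter K g \<Longrightarrow> g (a + d) (b + d) (c + d) = g a b c + d"
  using rot[of "\<lambda>x. g (x 0) (x 1) (x 2)" 3 "\<lambda>i. if i = 0 then a else if i = 1 then b else c" d]
  by (simp add: ter_def)

lemma bin_minor:
  assumes "F \<in> K n"
  shows "bin K (\<lambda>a b. F (\<lambda>i. if p i then a else b))"
proof -
  have "(\<lambda>y. F (\<lambda>i. y (if p i then 0 else 1))) \<in> K 2" by (rule minor[OF assms]) auto
  moreover have "(\<lambda>i. y (if p i then 0 else 1)) = (\<lambda>i. if p i then y 0 else y (1::nat))" for y :: "nat \<Rightarrow> 3"
    by auto
  ultimately show ?thesis unfolding bin_def by (simp only:)
qed

lemma ter_minor:
  assumes "F \<in> K n"
  shows "ter K (\<lambda>a b c. F (\<lambda>i. if p i then a else if q i then b else c))"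
proof -
  have "(\<lambda>y. F (\<lambda>i. y (if p i then 0 else if q i then 1 else 2))) \<in> K 3" by (rule minor[OF assms]) auto
  moreover have "(\<lambda>i. y (if p i then 0 else if q i then 1 else 2)) =
      (\<lambda>i. if p i then y 0 else if q i then y 1 else y (2::nat))" for y :: "nat \<Rightarrow> 3"
    by auto
  ultimately show ?thesis unfolding ter_def by (simp only:)
qed

lemma rps_pair:
  assumes closed: "\<And>f g. f \<in> F \<Longrightarrow> g \<in> F \<Longrightarrow> (\<lambda>x. rps (f x) (g x)) \<in> F"
    and x: "\<And>a. \<exists>f\<in>F. f x = a" and y: "\<And>a. \<exists>f\<in>F. f y = a"
  shows "(\<forall>a b. \<exists>f\<in>F. f x = a \<and> f y = b) \<or> (\<exists>c. \<forall>f\<in>F. f y = f x + c)"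
proof -
  define R where "R a b \<longleftrightarrow> (\<exists>f\<in>F. f x = a \<and> f y = b)" for a b
  have "(\<forall>a b. R a b) \<or> (\<exists>c. \<forall>a b. R a b \<longleftrightarrow> b = a + c)"
  proof (rule rps_pairs)
    show "\<forall>a b c d. R a b \<longrightarrow> R c d \<longrightarrow> R (rps a c) (rps b d)"
    proof (intro allI impI)
      fix a b c d assume "R a b" "R c d"
      then obtain f g where "f \<in> F" "g \<in> F" "f x = a" "f y = b" "g x = c" "g y = d"
        unfolding R_def by auto
      thus "R (rps a c) (rps b d)"
        unfolding R_def by (intro bexI[of _ "\<lambda>x. rps (f x) (g x)"] closed) auto
    qed
    show "\<forall>a. \<exists>b. R a b" "\<forall>b. \<exists>a. R a b" using x y unfolding R_def by blast+
  qed
  thus ?thesis unfolding R_def by blast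
qed

end

lemma is_nu_3: "(\<And>a b. f a a b = a) \<Longrightarrow> (\<And>a b. f a b a = a) \<Longrightarrow> (\<And>a b. f b a a = a) \<Longrightarrow>
    is_nu 3 (\<lambda>x. f (x 0) (x 1) (x 2))"
  by (auto simp: is_nu_def less_Suc_eq numeral_3_eq_3)

context idempotent_fam
begin

lemma bin_idem: "bin K g \<Longrightarrow> g a a = a"
  using idem[of "\<lambda>x. g (x 0) (x 1)" 2 a] by (simp add: bin_def)

lemma ter_idem: "ter K g \<Longrightarrow> g a a a = a"
  using idem[of "\<lambda>x. g (x 0) (x 1) (x 2)" 3 a] by (simp add: ter_def)

lemma not_conservative_bin:
  assumes "\<not> conservative K"
  obtains g where "bin K g" "g 0 1 = 2"
proof -
  obtain n F S where F: "F \<in> K n" "F (\<lambda>i. if i \<in> S then 1 else 0) \<notin> {0, 1}"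
    using assms by (auto simp: conservative_def)
  let ?g = "\<lambda>a b. F (\<lambda>i. if i \<notin> S then a else b)"
  have "?g 0 1 = F (\<lambda>i. if i \<in> S then 1 else 0)" by (rule arg_cong[where f = F]) auto
  hence "?g 0 1 = 2" using F(2) Z3_exhaust[of "?g 0 1"] by auto
  thus thesis by (rule that[OF bin_minor[OF F(1)]])
qed

text \<open>At a nonconstant tuple projections give two values and \<open>g\<close> the third, so
  only pairs of tuples need attention. If two tuples are linked, the projections show that one is a
  rotation of the other, and every self-dual \<open>F\<close> respects that.\<close>

lemma all_of_rps_not_conservative:
  assumes s: "bin K rps" and nc: "\<not> conservative K"
    and F: "dep n F" "\<And>x c. F (\<lambda>i. x i + c) = F x + c" "\<And>a. F (\<lambda>i. a) = a" and n: "0 < n"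
  shows "F \<in> K n"
proof -
  obtain g where g: "bin K g" "g 0 1 = 2" using not_conservative_bin[OF nc] .
  define X where "X = padded n - {x. \<exists>a. \<forall>i<n. x i = a}"
  have closed: "(\<lambda>x. rps (f x) (h x)) \<in> K n" if "f \<in> K n" "h \<in> K n" for f h
    using bin_apply[OF s that] .
  have surj: "\<exists>f\<in>K n. f x = a" if x: "x \<in> X" for x a
  proof -
    have "\<not> (\<forall>i<n. x i = x 0)" using x by (auto simp: X_def)
    then obtain i where i: "i < n" "x i \<noteq> x 0" by blast
    show ?thesis
    proof (cases "a = x 0 \<or> a = x i")
      case True thus ?thesis using proj[OF i(1)] proj[OF n] by auto
    next
      case False
      have up: "g u (u + 1) = u + 2" for u using bin_rot[OF g(1), of 0 u 1] g(2) by (simp add: add.commute)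
      have "(\<lambda>x. g (x 0) (x i)) \<in> K n" "(\<lambda>x. g (x i) (x 0)) \<in> K n"
        using bin_apply[OF g(1) proj[OF n] proj[OF i(1)]] bin_apply[OF g(1) proj[OF i(1)] proj[OF n]] .
      moreover have "g (x 0) (x i) = a \<or> g (x i) (x 0) = a"
      proof -
        consider "x i = x 0 + 1" | "x 0 = x i + 1" using i(2) Z3_near[of "x i" "x 0"] by fastforce
        thus ?thesis
        proof cases
          case 1
          hence "g (x 0) (x i) = x 0 + 2" using up by simp
          moreover have "a = x 0 + 2" using False 1 Z3_near[of a "x 0"] by (auto simp: Z3_diff)
          ultimately show ?thesis by simp
        next
          case 2
          hence "g (x i) (x 0) = x i + 2" using up by simp
          moreover have "a = x i + 2" using False 2 Z3_near[of a "x i"] by (auto simp: Z3_diff)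
          ultimately show ?thesis by simp
        qed
      qed
      ultimately show ?thesis by auto
    qed
  qed
  have "\<exists>G\<in>K n. \<forall>x\<in>X. G x = F x"
  proof (rule rps.interpolation)
    show "finite X" using finite_padded by (simp add: X_def)
    show "K n \<noteq> {}" using proj[OF n] by auto
    fix x y assume xy: "x \<in> X" "y \<in> X"
    consider "\<forall>a b. \<exists>f\<in>K n. f x = a \<and> f y = b" | c where "\<forall>f\<in>K n. f y = f x + c"
      using rps_pair[of "K n" x y, OF closed surj[OF xy(1)] surj[OF xy(2)]] by blast
    thus "\<exists>G\<in>K n. G x = F x \<and> G y = F y"
    proof cases
      case 1 thus ?thesis by blast
    next
      case 2
      have "F y = F (\<lambda>i. x i + c)"
        by (rule depD[OF F(1)]) (use 2 proj in auto)
      hence "F y = F x + c" by (simp add: F(2))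
      moreover obtain G where "G \<in> K n" "G x = F x" using surj[OF xy(1)] by blast
      ultimately show ?thesis using 2 by (intro bexI[of _ G]) auto
    qed
  qed (use closed surj in auto)
  then obtain G where G: "G \<in> K n" "\<And>x. x \<in> X \<Longrightarrow> G x = F x" by blast
  have "G x = F x" for x
  proof (cases "\<exists>a. \<forall>i<n. x i = a")
    case True
    then obtain a where a: "\<And>i. i < n \<Longrightarrow> x i = a" by blast
    have "G x = G (\<lambda>i. a)" by (rule depD[OF dep[OF G(1)]]) (rule a)
    moreover have "F x = F (\<lambda>i. a)" by (rule depD[OF F(1)]) (rule a)
    ultimately show ?thesis using idem[OF G(1)] F(3) by simp
  next
    case False
    let ?y = "\<lambda>i. if i < n then x i else 0"
    have "G x = G ?y" by (rule depD[OF dep[OF G(1)]]) simp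
    also have "\<dots> = F ?y" using False by (intro G(2)) (auto simp: X_def padded_def)
    also have "\<dots> = F x" by (rule depD[OF F(1)]) simp
    finally show ?thesis .
  qed
  hence "G = F" by blast
  thus ?thesis using G(1) by simp
qed

lemma bin_val:
  assumes "bin K g"
  shows "g a a = a" "g 1 2 = g 0 1 + 1" "g 2 0 = g 0 1 + 2" "g 1 0 = g 0 2 + 1" "g 2 1 = g 0 2 + 2"
  using bin_idem[OF assms] bin_rot[OF assms, of 0 1 1] bin_rot[OF assms, of 0 2 1]
    bin_rot[OF assms, of 0 1 2] bin_rot[OF assms, of 0 2 2] by simp_all

lemma bin_is:
  assumes g: "bin K g" and "\<And>a b. k (a + 1) (b + 1) = k a b + 1" "k 0 0 = 0" "g 0 1 = k 0 1" "g 0 2 = k 0 2"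
  shows "bin K k"
proof -
  have "g a b = k a b" for a b
    by (rule Z3_cases_translate) (use assms in \<open>auto simp: bin_rot bin_idem\<close>)
  hence "g = k" by blast
  thus ?thesis using g by simp
qed

lemma affine_step:
  assumes aff: "bin K aff2" and G: "G \<in> K n" and H: "H \<in> K n" and J: "J \<in> K n"
  shows "(\<lambda>x. G x + c * (H x - J x)) \<in> K n"
proof -
  have 1: "(\<lambda>x. G x + (H x - J x)) \<in> K n" if "G \<in> K n" for G
    using bin_apply[OF aff J bin_apply[OF aff that H]] by (simp add: aff2_def algebra_simps)
  show ?thesis using Z3_exhaust[of c] G 1[OF G] 1[OF 1[OF G]] by (auto simp: algebra_simps)
qed

lemma bin_affine_step:
  assumes "bin K aff2" "bin K g" "bin K h" "bin K k"
  shows "bin K (\<lambda>a b. g a b + c * (h a b - k a b))"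
  using affine_step[OF assms(1), of "\<lambda>x. g (x 0) (x 1)" 2 "\<lambda>x. h (x 0) (x 1)" "\<lambda>x. k (x 0) (x 1)" c] assms(2-4)
  by (simp add: bin_def)

lemma ter_affine_step:
  assumes "bin K aff2" "ter K g" "ter K h" "ter K k"
  shows "ter K (\<lambda>a b d. g a b d + c * (h a b d - k a b d))"
  using affine_step[OF assms(1), of "\<lambda>x. g (x 0) (x 1) (x 2)" 3 "\<lambda>x. h (x 0) (x 1) (x 2)"
      "\<lambda>x. k (x 0) (x 1) (x 2)" c] assms(2-4)
  by (simp add: ter_def)

text \<open>For an idempotent self-dual \<open>g\<close> the sum \<open>g 0 1 + g 0 2\<close>
  vanishes exactly when \<open>g a b = a + g 0 1 * (b - a)\<close>. The operation leaving
  \<open>{0, 1}\<close> generates \<open>rps\<close> unless it is \<open>aff2\<close>; together with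
  \<open>aff2\<close>, any non-affine binary operation generates \<open>rps\<close>.\<close>

lemma not_conservative_cases:
  assumes "\<not> conservative K"
  shows "bin K rps \<or> (bin K aff2 \<and> (\<forall>g. bin K g \<longrightarrow> g 0 1 + g 0 2 = 0))"
proof -
  obtain g where g: "bin K g" "g 0 1 = 2" using not_conservative_bin[OF assms] .
  have h: "bin K rps" if h: "bin K h" "h 0 1 = 2" "h 0 2 = 2" for h
    by (rule bin_is[OF bin_bin[OF h(1) bin_fst bin_bin[OF h(1) bin_snd bin_fst]]])
      (simp_all add: rps_translate bin_val[OF h(1)] h(2,3), simp_all add: rps_def)
  consider "g 0 2 = 2" | "g 0 2 = 0" | "g 0 2 = 1" using Z3_exhaust[of "g 0 2"] by blast
  thus ?thesis
  proof cases
    case 1 thus ?thesis using h[OF g] by blast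
  next
    case 2
    have "bin K rps"
      by (rule h[OF bin_bin[OF g(1) g(1) bin_bin[OF g(1) bin_snd bin_fst]]])
        (simp_all add: bin_val[OF g(1)] g(2) 2)
    thus ?thesis ..
  next
    case 3
    have aff: "bin K aff2"
      by (rule bin_is[OF g(1)]) (simp_all add: aff2_def g(2) 3)
    have "bin K rps" if k: "bin K k" "k 0 1 + k 0 2 \<noteq> 0" for k
    proof -
      define p where "p = k 0 1"
      define q where "q = k 0 2"
      have pq: "p + q \<noteq> 0 \<longrightarrow> (p + q) * p + (- p - q) * p = 0 \<and> (p + q) * p * 2 + (- p - q) * q = 2" for p q :: 3
        using Z3_exhaust[of p] Z3_exhaust[of q] by auto
      \<comment> \<open>The coefficient \<open>(p + q) * p\<close> cancels the value at
        \<open>(0, 1)\<close>. At \<open>(0, 2)\<close> twice the square of \<open>p + q\<close>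
        remains, which is 2 because a nonzero square is 1.\<close>
      have "bin K (\<lambda>a b. (a + (p + q) * p * (b - a)) + (- (p + q)) * (k a b - a))"
        by (intro bin_affine_step aff bin_fst bin_snd k(1))
      thus ?thesis
        by (rule bin_is) (use k(2) pq[of p q] in \<open>simp_all add: rps_translate, simp_all add: rps_def p_def q_def\<close>)
    qed
    thus ?thesis using aff by blast
  qed
qed

end

section \<open>Clones whose binary operations are affine\<close>

context idempotent_fam
begin

lemma ter_line:
  assumes sum0: "\<forall>g. bin K g \<longrightarrow> g 0 1 + g 0 2 = 0" and f: "ter K f"
  shows "f x y y = y + f 1 0 0 * (x - y)" "f y x y = y + f 0 1 0 * (x - y)" "f y y x = y + f 0 0 1 * (x - y)"
proof -
  have line: "g a b = a + g 0 1 * (b - a)" if g: "bin K g" for g a b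
  proof (rule Z3_cases_translate[where h = g and k = "\<lambda>a b. a + g 0 1 * (b - a)"])
    have "g 0 2 = - g 0 1" using sum0[rule_format, OF g] by (simp add: eq_neg_iff_add_eq_0 add.commute)
    thus "g 0 2 = 0 + g 0 1 * (2 - 0)" using Z3_exhaust[of "g 0 1"] by auto
  qed (use g in \<open>simp_all add: bin_rot bin_idem\<close>)
  show "f x y y = y + f 1 0 0 * (x - y)"
    using line[OF bin_ter[OF f bin_snd bin_fst bin_fst], where a = y and b = x] .
  show "f y x y = y + f 0 1 0 * (x - y)"
    using line[OF bin_ter[OF f bin_fst bin_snd bin_fst], where a = y and b = x] .
  show "f y y x = y + f 0 0 1 * (x - y)"
    using line[OF bin_ter[OF f bin_fst bin_fst bin_snd], where a = y and b = x] .
qed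

lemma majority_of_sum_ne_1:
  assumes aff: "bin K aff2" and sum0: "\<forall>g. bin K g \<longrightarrow> g 0 1 + g 0 2 = 0" and f: "ter K f"
    and ne: "f 1 0 0 + f 0 1 0 + f 0 0 1 \<noteq> 1"
  shows "\<exists>N\<in>K 3. is_nu 3 N"
proof -
  define a where "a = f 1 0 0"
  define b where "b = f 0 1 0"
  define c where "c = f 0 0 1"
  \<comment> \<open>With \<open>s = a + b + c - 1\<close> this is \<open>- s\<close>, so
    \<open>m * s = - 1\<close>. In \<open>g\<close> the contributions of \<open>x\<close> alone and
    of \<open>y\<close> alone cancel, and
    \<open>g y y x = x + (x - y) * (m * s) = y\<close>.\<close>
  define m where "m = - (a + b + c - 1)"
  define g where "g x y z = z + m * (f x y z - z) + (- m * a) * (x - z) + (- m * b) * (y - z)" for x y z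
  have g: "ter K g"
    unfolding g_def[abs_def] by (intro ter_affine_step aff f ter_1 ter_2 ter_3)
  have l: "f x y y = y + a * (x - y)" "f y x y = y + b * (x - y)" "f y y x = y + c * (x - y)" for x y
    unfolding a_def b_def c_def by (rule ter_line[OF sum0 f])+
  have "(a + b + c - 1) * (a + b + c - 1) = 1"
    by (rule Z3_square) (use ne in \<open>simp add: a_def b_def c_def\<close>)
  hence mm: "m * (a + b + c - 1) = -1" unfolding m_def by (metis mult_minus_left)
  have "g x y y = y" "g y x y = y" for x y
    by (simp_all add: g_def l algebra_simps)
  moreover have "g y y x = y" for x y
  proof -
    have "g y y x = x + (x - y) * (m * (a + b + c - 1))"
      by (simp add: g_def l algebra_simps)
    thus ?thesis by (simp only: mm) simp
  qed
  ultimately have "is_nu 3 (\<lambda>x. g (x 0) (x 1) (x 2))" by (intro is_nu_3) auto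
  thus ?thesis using g unfolding ter_def by blast
qed

text \<open>\<open>t m\<close> is the first projection plus \<open>m\<close> times the deviation of
  \<open>f\<close> from the affine form, which vanishes as soon as two arguments agree. A nonzero
  deviation \<open>d\<close> at \<open>(0, 1, 2)\<close> leads to an operation with coefficient sum
  other than 1, hence to a majority operation.\<close>

lemma ternary_affine:
  assumes aff: "bin K aff2" and sum0: "\<forall>g. bin K g \<longrightarrow> g 0 1 + g 0 2 = 0"
    and nonu: "\<not> (\<exists>N\<in>K 3. is_nu 3 N)" and f: "ter K f"
  shows "f x y z = f 1 0 0 * x + f 0 1 0 * y + f 0 0 1 * z"
proof -
  define a where "a = f 1 0 0"
  define b where "b = f 0 1 0"
  define c where "c = f 0 0 1"
  have abc: "c = 1 - a - b"
    using majority_of_sum_ne_1[OF aff sum0 f] nonu by (auto simp: a_def b_def c_def algebra_simps)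
  have l: "f x y y = y + a * (x - y)" "f y x y = y + b * (x - y)" "f y y x = y + c * (x - y)" for x y
    unfolding a_def b_def c_def by (rule ter_line[OF sum0 f])+
  define t where "t m x y z = x + m * (f x y z - z) + (- m * a) * (x - z) + (- m * b) * (y - z)" for m x y z
  have t: "ter K (t m)" for m
    unfolding t_def[abs_def] by (intro ter_affine_step aff f ter_1 ter_2 ter_3)
  have t_semi: "t m x x y = x" "t m x y x = x" "t m x y y = x" for m x y
    by (simp_all add: t_def l abc algebra_simps)
  \<comment> \<open>Putting \<open>aff2 x y\<close> in the last place gives a binary operation with
    these two values at \<open>(0, 1)\<close> and \<open>(0, 2)\<close>.\<close>
  have opp: "t m 0 1 2 + t m 0 2 1 = 0" for m
    using sum0[rule_format, OF bin_ter[OF t bin_fst bin_snd aff], of m] by (simp add: aff2_def)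
  define d where "d = t 1 0 1 2"
  have td: "t d 0 1 2 = d * d" unfolding d_def by (simp add: t_def algebra_simps)
  have d0: "d = 0"
  proof (rule ccontr)
    assume "d \<noteq> 0"
    hence "d * d = 1" by (rule Z3_square)
    hence t012: "t d 0 1 2 = 1" using td by simp
    hence t021: "t d 0 2 1 = 2" using opp[of d] Z3_exhaust[of "t d 0 2 1"] by auto
    \<comment> \<open>The coefficients of \<open>h\<close> are 1, 1 and 0: at
      \<open>(0, 1, 0)\<close> the last argument of \<open>t d\<close> becomes
      \<open>aff2 1 0 = 2\<close>, and \<open>t d 0 1 2 = 1\<close>.\<close>
    define h where "h x y z = t d x y (aff2 y z)" for x y z
    have "ter K h" unfolding h_def[abs_def] by (rule ter_ter[OF t ter_1 ter_2 ter_bin[OF aff ter_2 ter_3]])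
    moreover have "h 1 0 0 + h 0 1 0 + h 0 0 1 \<noteq> 1"
      by (simp add: h_def aff2_def t_semi t012)
    ultimately show False using majority_of_sum_ne_1[OF aff sum0] nonu by blast
  qed
  have f012: "f 0 1 2 = b + c * 2"
  proof -
    have "t 1 0 1 2 = f 0 1 2 - 2 - a * (0 - 2) - b * (1 - 2)" by (simp add: t_def)
    hence "f 0 1 2 = 2 + a * (0 - 2) + b * (1 - 2)" using d0 by (simp add: d_def algebra_simps)
    thus ?thesis using Z3_exhaust[of a] Z3_exhaust[of b] abc by auto
  qed
  have f021: "f 0 2 1 = b * 2 + c"
  proof -
    have "t 1 0 2 1 = 0" using opp[of 1] d0 by (simp add: d_def)
    moreover have "t 1 0 2 1 = f 0 2 1 - 1 - a * (0 - 1) - b * (2 - 1)" by (simp add: t_def)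
    ultimately have "f 0 2 1 = 1 + a * (0 - 1) + b * (2 - 1)" by (simp add: algebra_simps)
    thus ?thesis using Z3_exhaust[of a] Z3_exhaust[of b] abc by auto
  qed
  have "f 0 y z = b * y + c * z" for y z
  proof -
    consider "y = z" | "y = 0" | "z = 0" | "y = 1" "z = 2" | "y = 2" "z = 1"
      using Z3_exhaust[of y] Z3_exhaust[of z] by auto
    thus ?thesis
    proof cases
      case 1 thus ?thesis by (simp add: l(1) abc algebra_simps)
    next
      case 2 thus ?thesis by (simp add: l(3))
    next
      case 3 thus ?thesis by (simp add: l(2))
    qed (simp_all add: f012 f021)
  qed
  moreover have "f x y z = f 0 (y - x) (z - x) + x" using ter_rot[OF f, of 0 x "y - x" "z - x"] by simp
  ultimately have "f x y z = b * (y - x) + c * (z - x) + x" by simp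
  hence "f x y z = a * x + b * y + c * z" by (simp add: abc algebra_simps)
  thus ?thesis by (simp add: a_def b_def c_def)
qed

text \<open>Ternary minors along disjoint sets make \<open>u\<close> additive, so it is a sum of
  weights of single coordinates. A tuple is then split into its block of ones and its block of
  twos.\<close>

lemma op_affine:
  assumes tern: "\<And>f x y z. ter K f \<Longrightarrow> f x y z = f 1 0 0 * x + f 0 1 0 * y + f 0 0 1 * z" and F: "F \<in> K n"
  shows "\<exists>w. (\<Sum>i<n. w i) = 1 \<and> (\<forall>x. F x = (\<Sum>i<n. w i * x i))"
proof -
  define u where "u S = F (\<lambda>i. if i \<in> S then 1 else 0)" for S
  have add: "u (S \<union> T) = u S + u T" if "S \<inter> T = {}" for S T
  proof -
    have "u (S \<union> T) = F (\<lambda>i. if i \<in> S then 1 else if i \<in> T then 1 else 0)"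
      unfolding u_def by (rule arg_cong[where f = F]) auto
    moreover have "u S = F (\<lambda>i. if i \<in> S then 1 else if i \<in> T then 0 else 0)"
      unfolding u_def by (rule arg_cong[where f = F]) auto
    moreover have "u T = F (\<lambda>i. if i \<in> S then 0 else if i \<in> T then 1 else 0)"
      unfolding u_def using that by (intro arg_cong[where f = F] ext) auto
    ultimately show ?thesis
      using tern[OF ter_minor[OF F, of "\<lambda>i. i \<in> S" "\<lambda>i. i \<in> T"], of 1 1 0] by simp
  qed
  have sum: "u S = (\<Sum>i\<in>S. u {i})" if "finite S" for S
    using that
  proof (induction S rule: finite_induct)
    case empty thus ?case using idem[OF F, of 0] by (simp add: u_def)
  next
    case (insert i S) thus ?case using add[of "{i}" S] by simp
  qed
  have local: "u S = (\<Sum>i\<in>S \<inter> {..<n}. u {i})" for S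
  proof -
    have "u S = u (S \<inter> {..<n})" unfolding u_def by (rule depD[OF dep[OF F]]) auto
    also have "\<dots> = (\<Sum>i\<in>S \<inter> {..<n}. u {i})" by (rule sum) simp
    finally show ?thesis .
  qed
  have "F x = (\<Sum>i<n. u {i} * x i)" for x
  proof -
    have "F x = F (\<lambda>i. if x i = 1 then 1 else if x i = 2 then 2 else 0)"
      using Z3_exhaust by (intro arg_cong[where f = F] ext) (metis (full_types))
    also have "\<dots> = F (\<lambda>i. if x i = 1 then 1 else if x i = 2 then 0 else 0)
        + 2 * F (\<lambda>i. if x i = 1 then 0 else if x i = 2 then 1 else 0)"
      using tern[OF ter_minor[OF F, of "\<lambda>i. x i = 1" "\<lambda>i. x i = 2"], of 1 2 0] by (simp add: mult.commute)
    also have "F (\<lambda>i. if x i = 1 then 1 else if x i = 2 then 0 else 0) = u {i. x i = 1}"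
      unfolding u_def by (rule arg_cong[where f = F]) auto
    also have "F (\<lambda>i. if x i = 1 then 0 else if x i = 2 then 1 else 0) = u {i. x i = 2}"
      unfolding u_def by (rule arg_cong[where f = F]) auto
    also have "u {i. x i = 1} + 2 * u {i. x i = 2} =
        (\<Sum>i<n. if x i = 1 then u {i} else 0) + 2 * (\<Sum>i<n. if x i = 2 then u {i} else 0)"
      unfolding local[of "{i. x i = _}"] by (simp add: sum.inter_restrict Int_commute)
    also have "\<dots> = (\<Sum>i<n. u {i} * x i)"
      unfolding sum_distrib_left sum.distrib[symmetric]
    proof (rule sum.cong)
      fix i show "(if x i = 1 then u {i} else 0) + 2 * (if x i = 2 then u {i} else 0) = u {i} * x i"
        using Z3_exhaust[of "x i"] by auto
    qed simp
    finally show ?thesis .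
  qed
  moreover have "(\<Sum>i<n. u {i}) = 1"
    using calculation[of "\<lambda>i. 1"] idem[OF F, of 1] by simp
  ultimately show ?thesis by (intro exI[of _ "\<lambda>i. u {i}"]) simp
qed

lemma affine_mem:
  assumes aff: "bin K aff2" and n: "0 < n" and w: "(\<Sum>i<n. w i) = 1"
  shows "(\<lambda>x. \<Sum>i<n. w i * x i) \<in> K n"
proof -
  have "(\<lambda>x. x 0 + (\<Sum>i<m. w i * (x i - x 0))) \<in> K n" if "m \<le> n" for m
    using that
  proof (induction m)
    case 0 thus ?case using proj[OF n] by simp
  next
    case (Suc m)
    hence IH: "(\<lambda>x. x 0 + (\<Sum>i<m. w i * (x i - x 0))) \<in> K n" and m: "m < n" by auto
    show ?case using affine_step[OF aff IH proj[OF m] proj[OF n], of "w m"] by (simp add: add.assoc)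
  qed
  from this[of n] have "(\<lambda>x. x 0 + (\<Sum>i<n. w i * (x i - x 0))) \<in> K n" by simp
  moreover have "x 0 + (\<Sum>i<n. w i * (x i - x 0)) = (\<Sum>i<n. w i * x i)" for x
  proof -
    have "(\<Sum>i<n. w i * (x i - x 0)) = (\<Sum>i<n. w i * x i) - (\<Sum>i<n. w i) * x 0"
      by (simp add: right_diff_distrib sum_subtractf sum_distrib_right)
    thus ?thesis by (simp add: w)
  qed
  ultimately show ?thesis by simp
qed

end

lemma countably_many_not_conservative:
  "countably_many {K. idempotent_fam K \<and> \<not> conservative K}"
proof (rule countably_many_subset)
  let ?R = "{K. idempotent_fam K \<and> \<not> conservative K \<and> bin K rps}"
  let ?A = "{K. idempotent_fam K \<and> bin K aff2 \<and>
    (\<forall>n. \<forall>F\<in>K n. \<exists>w. (\<Sum>i<n. w i) = 1 \<and> (\<forall>x. F x = (\<Sum>i<n. w i * x i)))}"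
  let ?N = "{K. self_dual_fam K \<and> (\<exists>k. \<exists>N\<in>K k. is_nu k N)}"
  have "countably_many ?R"
  proof (rule countably_many_eq)
    fix K L n assume "K \<in> ?R" "L \<in> ?R"
    then interpret K: idempotent_fam K + L: idempotent_fam L by simp_all
    show "K n \<subseteq> L n"
    proof
      fix F assume F: "F \<in> K n"
      show "F \<in> L n"
        by (rule L.all_of_rps_not_conservative)
          (use \<open>L \<in> ?R\<close> K.dep[OF F] K.rot[OF F] K.idem[OF F] K.K_pos[OF F] in auto)
    qed
  qed (auto simp: idempotent_fam_def)
  moreover have "countably_many ?A"
  proof (rule countably_many_eq)
    fix K L n assume K: "K \<in> ?A" and L: "L \<in> ?A"
    then interpret K: idempotent_fam K + L: idempotent_fam L by simp_all
    show "K n \<subseteq> L n"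
    proof
      fix F assume F: "F \<in> K n"
      then obtain w where w: "(\<Sum>i<n. w i) = 1" "\<And>x. F x = (\<Sum>i<n. w i * x i)" using K by blast
      have "(\<lambda>x. \<Sum>i<n. w i * x i) \<in> L n"
        by (rule L.affine_mem) (use L K.K_pos[OF F] w(1) in auto)
      moreover have "F = (\<lambda>x. \<Sum>i<n. w i * x i)" using w(2) by blast
      ultimately show "F \<in> L n" by simp
    qed
  qed (auto simp: idempotent_fam_def)
  ultimately show "countably_many (?R \<union> (?A \<union> ?N))"
    using countably_many_nu by (intro countably_many_Un)
  show "{K. idempotent_fam K \<and> \<not> conservative K} \<subseteq> ?R \<union> (?A \<union> ?N)"
  proof
    fix K assume K: "K \<in> {K. idempotent_fam K \<and> \<not> conservative K}"
    then interpret K: idempotent_fam K by simp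
    show "K \<in> ?R \<union> (?A \<union> ?N)"
    proof (cases "bin K rps \<or> (\<exists>N\<in>K 3. is_nu 3 N)")
      case True thus ?thesis using K K.self_dual_fam_axioms by blast
    next
      case False
      hence "bin K aff2" "\<forall>g. bin K g \<longrightarrow> g 0 1 + g 0 2 = 0"
        using K.not_conservative_cases K by blast+
      hence "f x y z = f 1 0 0 * x + f 0 1 0 * y + f 0 0 1 * z" if "ter K f" for f x y z
        using False that by (intro K.ternary_affine) auto
      hence "\<exists>w. (\<Sum>i<n. w i) = 1 \<and> (\<forall>x. F x = (\<Sum>i<n. w i * x i))" if "F \<in> K n" for F n
        using that by (intro K.op_affine) auto
      thus ?thesis using \<open>bin K aff2\<close> K by simp
    qed
  qed
qed

section \<open>Boolean parts and clones of parity type\<close>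

text \<open>\<open>a\<close> stands for true and \<open>a - 1\<close> for false. Distinct values
  modulo 3 are neighbours, so every two-valued tuple has this form.\<close>

definition step_tuple :: "3 \<Rightarrow> nat set \<Rightarrow> nat \<Rightarrow> 3" where
  "step_tuple a S i = (if i \<in> S then a else a - 1)"

definition bs :: "((nat \<Rightarrow> 3) \<Rightarrow> 3) \<Rightarrow> nat set \<Rightarrow> bool" where
  "bs F S \<longleftrightarrow> F (step_tuple 1 S) = 1"

lemma bs_minor: "bs (\<lambda>x. F (\<lambda>i. x (\<pi> i))) S \<longleftrightarrow> bs F (\<pi> -` S)"
proof -
  have "(\<lambda>i. step_tuple 1 S (\<pi> i)) = step_tuple 1 (\<pi> -` S)" by (auto simp: step_tuple_def)
  thus ?thesis by (simp add: bs_def)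
qed

lemma bs_proj [simp]: "bs (\<lambda>x. x i) S \<longleftrightarrow> i \<in> S"
  by (simp add: bs_def step_tuple_def)

text \<open>The conjugate of \<open>rps\<close> under negation; on \<open>{0, 1}\<close> it is
  disjunction.\<close>

definition join :: "3 \<Rightarrow> 3 \<Rightarrow> 3" where
  "join a b = - rps (- a) (- b)"

lemma join_translate: "join (a + c) (b + c) = join a b + c"
  using rps_translate[of "- a" "- c" "- b"] by (simp add: join_def algebra_simps)

locale conservative_fam = idempotent_fam +
  assumes cons: "conservative K"
begin

lemma step_value:
  assumes F: "F \<in> K n"
  shows "F (step_tuple a S) = (if bs F S then a else a - 1)"
proof -
  have "step_tuple 1 S = (\<lambda>i. if i \<in> S then 1 else 0)" by (auto simp: step_tuple_def)
  hence 1: "F (step_tuple 1 S) = (if bs F S then 1 else 0)"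
    using cons F unfolding conservative_def bs_def by auto
  have "step_tuple a S = (\<lambda>i. step_tuple 1 S i + (a - 1))" by (auto simp: step_tuple_def)
  hence "F (step_tuple a S) = F (step_tuple 1 S) + (a - 1)" using rot[OF F] by simp
  thus ?thesis by (simp add: 1)
qed

lemma bs_local: "F \<in> K n \<Longrightarrow> (\<And>i. i < n \<Longrightarrow> i \<in> S \<longleftrightarrow> i \<in> T) \<Longrightarrow> bs F S \<longleftrightarrow> bs F T"
  unfolding bs_def using depD[OF dep, of F n "step_tuple 1 S" "step_tuple 1 T"]
  by (simp add: step_tuple_def)

lemma bs_comp:
  assumes "F \<in> K m" "\<And>i. i < m \<Longrightarrow> G i \<in> K n"
  shows "bs (\<lambda>x. F (\<lambda>i. G i x)) S \<longleftrightarrow> bs F {i. bs (G i) S}"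
proof -
  have "F (\<lambda>i. G i (step_tuple 1 S)) = F (step_tuple 1 {i. bs (G i) S})"
    by (rule depD[OF dep[OF assms(1)]]) (simp add: step_value[OF assms(2)] step_tuple_def)
  thus ?thesis by (simp add: bs_def)
qed

lemma bs_full: "F \<in> K n \<Longrightarrow> (\<And>i. i < n \<Longrightarrow> i \<in> S) \<Longrightarrow> bs F S"
  unfolding bs_def using depD[OF dep, of F n "step_tuple 1 S" "\<lambda>i. 1"] idem[of F n 1]
  by (simp add: step_tuple_def)

lemma bs_disjoint: "F \<in> K n \<Longrightarrow> (\<And>i. i < n \<Longrightarrow> i \<notin> S) \<Longrightarrow> \<not> bs F S"
  unfolding bs_def using depD[OF dep, of F n "step_tuple 1 S" "\<lambda>i. 0"] idem[of F n 0]
  by (simp add: step_tuple_def)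

text \<open>Merging the variables inside \<open>S\<close> and those outside gives a binary operation
  that is commutative on \<open>{0, 1}\<close>, hence conjunction or disjunction there; rotation
  determines the rest.\<close>

lemma rps_or_join:
  assumes "F \<in> K n" and "bs F S = bs F (- S)"
  shows "bin K rps \<or> bin K join"
proof -
  define g where "g a b = F (\<lambda>i. if i \<in> S then a else b)" for a b
  have g: "bin K g" unfolding g_def[abs_def] by (rule bin_minor[OF assms(1)])
  have "(\<lambda>i. if i \<in> S then 1 else 0) = step_tuple 1 S" "(\<lambda>i. if i \<in> S then 0 else 1) = step_tuple 1 (- S)"
    by (auto simp: step_tuple_def)
  hence g10: "g 1 0 = (if bs F S then 1 else 0)" and g01: "g 0 1 = (if bs F (- S) then 1 else 0)"
    using step_value[OF assms(1), of 1] by (simp_all add: g_def)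
  have g02: "g 0 2 = (if bs F S then 0 else 2)"
    using g10 bin_rot[OF g, of 1 2 0] by (auto split: if_splits)
  show ?thesis
  proof (cases "bs F S")
    case True
    have "bin K join"
      by (rule bin_is[OF g]) (use True assms(2) in \<open>simp_all add: g01 g02 join_translate, simp_all add: join_def rps_def\<close>)
    thus ?thesis ..
  next
    case False
    have "bin K rps"
      by (rule bin_is[OF g]) (use False assms(2) in \<open>simp_all add: g01 g02 rps_translate, simp_all add: rps_def\<close>)
    thus ?thesis ..
  qed
qed

end

section \<open>Self-dual Boolean parts: projections and parity functions\<close>

locale parity_fam = conservative_fam +
  assumes no_rps: "\<not> bin K rps" and no_join: "\<not> bin K join"
    and no_majority: "\<not> (\<exists>N\<in>K 3. is_nu 3 N)"
begin

lemma bs_Compl: "F \<in> K n \<Longrightarrow> bs F (- S) \<longleftrightarrow> \<not> bs F S"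
  using rps_or_join no_rps no_join by blast

lemma two_valued:
  assumes F: "F \<in> K n"
  shows "F (\<lambda>i. if i \<in> S then a else b) = (if bs F S then a else b)"
proof -
  consider "b = a - 1" | "b = a" | "b = a + 1" using Z3_near by blast
  thus ?thesis
  proof cases
    case 1
    hence "(\<lambda>i. if i \<in> S then a else b) = step_tuple a S" by (auto simp: step_tuple_def)
    thus ?thesis using step_value[OF F, of a S] 1 by simp
  next
    case 2 thus ?thesis by (simp only: if_cancel idem[OF F])
  next
    case 3
    hence "(\<lambda>i. if i \<in> S then a else b) = step_tuple b (- S)" by (auto simp: step_tuple_def)
    thus ?thesis using step_value[OF F, of b "- S"] 3 bs_Compl[OF F] by simp
  qed
qed

text \<open>Up to the order of arguments \<open>f\<close> is a Pixley operation, and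
  \<open>f a b (f a b c)\<close> is a majority operation.\<close>

lemma no_pixley:
  assumes f: "ter K f" and "\<And>a b. f a b b = a" "\<And>a b. f b a b = a" "\<And>a b. f b b a = b"
  shows False
proof -
  have "ter K (\<lambda>a b c. f a b (f a b c))" by (rule ter_ter[OF f ter_1 ter_2 f])
  moreover have "is_nu 3 (\<lambda>x. f (x 0) (x 1) (f (x 0) (x 1) (x 2)))"
    by (rule is_nu_3) (simp_all add: assms)
  ultimately show False using no_majority unfolding ter_def by blast
qed

text \<open>The bits \<open>bs F S\<close>, \<open>bs F T\<close> and
  \<open>\<not> bs F (S \<union> T)\<close> tell at which places \<open>f\<close> follows a single
  dissenting argument. If there is no such place, \<open>f\<close> is a majority operation; if there
  are exactly two, it is a Pixley operation up to permutation. An odd number remains.\<close>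

lemma bs_Un:
  assumes F: "F \<in> K n" and ST: "S \<inter> T = {}"
  shows "bs F (S \<union> T) \<longleftrightarrow> (bs F S \<noteq> bs F T)"
proof -
  define f where "f a b c = F (\<lambda>i. if i \<in> S then a else if i \<in> T then b else c)" for a b c
  have f: "ter K f" unfolding f_def[abs_def] by (rule ter_minor[OF F])
  have f1: "f a b b = (if bs F S then a else b)" for a b
    using two_valued[OF F, of S a b] by (simp only: f_def if_cancel)
  have f2: "f b a b = (if bs F T then a else b)" for a b
  proof -
    have "(\<lambda>i. if i \<in> S then b else if i \<in> T then a else b) = (\<lambda>i. if i \<in> T then a else b)"
      using ST by (intro ext) auto
    thus ?thesis using two_valued[OF F, of T a b] by (simp add: f_def)
  qed
  have f3: "f b b a = (if bs F (S \<union> T) then b else a)" for a b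
  proof -
    have "(\<lambda>i. if i \<in> S then b else if i \<in> T then b else a) = (\<lambda>i. if i \<in> S \<union> T then b else a)"
      by auto
    thus ?thesis using two_valued[OF F, of "S \<union> T" b a] by (simp add: f_def)
  qed
  show ?thesis
  proof (rule ccontr)
    assume "\<not> ?thesis"
    then consider (none) "\<not> bs F S" "\<not> bs F T" "bs F (S \<union> T)"
      | (12) "bs F S" "bs F T" "bs F (S \<union> T)" | (13) "bs F S" "\<not> bs F T" "\<not> bs F (S \<union> T)"
      | (23) "\<not> bs F S" "bs F T" "\<not> bs F (S \<union> T)" by blast
    thus False
    proof cases
      case none
      hence "is_nu 3 (\<lambda>x. f (x 0) (x 1) (x 2))" by (intro is_nu_3) (simp_all add: f1 f2 f3)
      thus False using f no_majority unfolding ter_def by blast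
    next
      case 12
      thus False using no_pixley[OF f] by (simp add: f1 f2 f3)
    next
      case 13
      thus False using no_pixley[OF ter_ter[OF f ter_1 ter_3 ter_2]] by (simp add: f1 f2 f3)
    next
      case 23
      thus False using no_pixley[OF ter_ter[OF f ter_3 ter_2 ter_1]] by (simp add: f1 f2 f3)
    qed
  qed
qed

lemma bs_parity:
  assumes F: "F \<in> K n"
  shows "bs F S \<longleftrightarrow> odd (card ({i. i < n \<and> bs F {i}} \<inter> S))"
proof -
  have fin: "bs F T \<longleftrightarrow> odd (card ({i. i < n \<and> bs F {i}} \<inter> T))" if "finite T" "T \<subseteq> {..<n}" for T
    using that
  proof (induction T rule: finite_induct)
    case empty thus ?case using bs_disjoint[OF F, of "{}"] by simp
  next
    case (insert i T)
    have "bs F (insert i T) \<longleftrightarrow> (bs F {i} \<noteq> bs F T)" using bs_Un[OF F, of "{i}" T] insert.hyps by simp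
    moreover have "card ({i. i < n \<and> bs F {i}} \<inter> insert i T) =
        (if bs F {i} then Suc (card ({i. i < n \<and> bs F {i}} \<inter> T)) else card ({i. i < n \<and> bs F {i}} \<inter> T))"
      using insert.hyps insert.prems by (auto simp: Int_insert_right)
    ultimately show ?case using insert.IH insert.prems by simp
  qed
  have "bs F S \<longleftrightarrow> bs F (S \<inter> {..<n})" by (rule bs_local[OF F]) auto
  also have "\<dots> \<longleftrightarrow> odd (card ({i. i < n \<and> bs F {i}} \<inter> (S \<inter> {..<n})))" by (rule fin) auto
  also have "{i. i < n \<and> bs F {i}} \<inter> (S \<inter> {..<n}) = {i. i < n \<and> bs F {i}} \<inter> S" by auto
  finally show ?thesis .
qed

text \<open>
  By self-duality \<open>f\<close> is determined by its values at \<open>(0, 1, 2)\<close> and \<open>(0, 2, 1)\<close>; the terms for the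
  nine cases were found by search.
\<close>
lemma ter_mino_of_minority:
  assumes f: "ter K f" and m: "\<And>a b. f a b b = a" "\<And>a b. f b a b = a" "\<And>a b. f b b a = a"
  shows "ter K mino"
proof -
  have val: "f 1 2 0 = f 0 1 2 + 1" "f 2 0 1 = f 0 1 2 + 2" "f 1 0 2 = f 0 2 1 + 1" "f 2 1 0 = f 0 2 1 + 2"
    using ter_rot[OF f, of 0 1 1 2] ter_rot[OF f, of 0 2 1 2] ter_rot[OF f, of 0 1 2 1] ter_rot[OF f, of 0 2 2 1]
    by simp_all
  have is_mino: "ter K mino"
    if t: "ter K t" and tm: "\<And>a b. t a b b = a" "\<And>a b. t b a b = a" "\<And>a b. t b b a = a"
      and t0: "t 0 1 2 = 0" "t 0 2 1 = 0" for t
  proof -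
    have "t a b c = mino a b c" for a b c
    proof -
      consider "b = c" | "a = c" | "a = b" | "b = a + 1" "c = a + 2" | "b = a + 2" "c = a + 1"
        using Z3_near[of b a] Z3_near[of c a] by (auto simp: Z3_diff)
      thus ?thesis
      proof cases
        case 4
        thus ?thesis using ter_rot[OF t, of 0 a 1 2] t0 by (simp add: mino_def add.commute)
      next
        case 5
        thus ?thesis using ter_rot[OF t, of 0 a 2 1] t0 by (simp add: mino_def add.commute)
      qed (simp_all add: tm)
    qed
    hence "t = mino" by (intro ext)
    thus ?thesis using t by simp
  qed
  consider "f 0 1 2 = 0" "f 0 2 1 = 0" | "f 0 1 2 = 1" "f 0 2 1 = 2" | "f 0 1 2 = 2" "f 0 2 1 = 1"
    | "f 0 1 2 = 0" "f 0 2 1 = 2" | "f 0 1 2 = 1" "f 0 2 1 = 0"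
    | "f 0 1 2 = 0" "f 0 2 1 = 1" | "f 0 1 2 = 2" "f 0 2 1 = 0"
    | "f 0 1 2 = 1" "f 0 2 1 = 1" | "f 0 1 2 = 2" "f 0 2 1 = 2"
    using Z3_exhaust[of "f 0 1 2"] Z3_exhaust[of "f 0 2 1"] by blast
  thus ?thesis
  proof cases
    case 1 show ?thesis by (rule is_mino[OF f]) (simp_all add: m 1)
  next
    case 2 show ?thesis
      by (rule is_mino[OF ter_ter[OF f ter_2 ter_1 ter_3]]) (simp_all add: m val 2)
  next
    case 3 show ?thesis
      by (rule is_mino[OF ter_ter[OF f ter_2 ter_3 ter_1]]) (simp_all add: m val 3)
  next
    case 4 show ?thesis
      by (rule is_mino[OF ter_ter[OF f ter_1 ter_2 ter_ter[OF f ter_1 ter_ter[OF f ter_1 ter_3 ter_2] ter_2]]])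
        (simp_all add: m val 4)
  next
    case 5 show ?thesis
      by (rule is_mino[OF ter_ter[OF f ter_1 ter_2 ter_ter[OF f ter_1 ter_ter[OF f ter_1 ter_3 ter_2] ter_2]]])
        (simp_all add: m val 5)
  next
    case 6 show ?thesis
      by (rule is_mino[OF ter_ter[OF f ter_1 ter_2 ter_ter[OF f ter_2 ter_1 f]]]) (simp_all add: m val 6)
  next
    case 7 show ?thesis
      by (rule is_mino[OF ter_ter[OF f ter_1 ter_2 ter_ter[OF f ter_2 ter_1 f]]]) (simp_all add: m val 7)
  next
    case 8 show ?thesis
      by (rule is_mino[OF ter_ter[OF f ter_1 ter_2 ter_ter[OF f ter_1 ter_2 ter_ter[OF f ter_2 ter_1 ter_3]]]])
        (simp_all add: m val 8)
  next
    case 9 show ?thesis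
      by (rule is_mino[OF ter_ter[OF f ter_1 ter_2 ter_ter[OF f ter_1 ter_2 ter_ter[OF f ter_2 ter_1 ter_3]]]])
        (simp_all add: m val 9)
  qed
qed

text \<open>Grouping the variables into \<open>{i}\<close>, \<open>{j}\<close> and the rest gives an
  operation that follows the dissenting argument at all three places, a minority operation.\<close>

lemma ter_mino_of_three:
  assumes F: "F \<in> K n" and ij: "bs F {i}" "bs F {j}" "i \<noteq> j"
    and rest: "bs F (- {i, j})"
  shows "ter K mino"
proof -
  define f where "f a b c = F (\<lambda>l. if l \<in> {i} then a else if l \<in> {j} then b else c)" for a b c
  have f: "ter K f" unfolding f_def[abs_def] by (rule ter_minor[OF F])
  have "f a b b = a" for a b
    using two_valued[OF F, of "{i}" a b] ij by (simp only: f_def if_cancel if_True)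
  moreover have "f b a b = a" for a b
  proof -
    have "(\<lambda>l. if l \<in> {i} then b else if l \<in> {j} then a else b) = (\<lambda>l. if l \<in> {j} then a else b)"
      using ij(3) by auto
    thus ?thesis using two_valued[OF F, of "{j}" a b] ij by (simp add: f_def)
  qed
  moreover have "f b b a = a" for a b
  proof -
    have "(\<lambda>l. if l \<in> {i} then b else if l \<in> {j} then b else a) = (\<lambda>l. if l \<in> - {i, j} then a else b)"
      by auto
    thus ?thesis using two_valued[OF F, of "- {i, j}" a b] rest by (simp add: f_def)
  qed
  ultimately show ?thesis by (rule ter_mino_of_minority[OF f])
qed

lemma projections_or_mino:
  "(\<forall>n. \<forall>F\<in>K n. \<exists>i<n. \<forall>S. bs F S \<longleftrightarrow> i \<in> S) \<or> ter K mino"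
proof (rule disjCI)
  assume nm: "\<not> ter K mino"
  show "\<forall>n. \<forall>F\<in>K n. \<exists>i<n. \<forall>S. bs F S \<longleftrightarrow> i \<in> S"
  proof (intro allI ballI)
    fix n F assume F: "F \<in> K n"
    define I where "I = {i. i < n \<and> bs F {i}}"
    have par: "bs F S \<longleftrightarrow> odd (card (I \<inter> S))" for S unfolding I_def by (rule bs_parity[OF F])
    have "finite I" by (simp add: I_def)
    have "odd (card I)" using par[of UNIV] bs_full[OF F, of UNIV] by simp
    then obtain i where i: "i \<in> I" by (metis card.empty ex_in_conv even_zero)
    have "I = {i}"
    proof (rule ccontr)
      assume "I \<noteq> {i}"
      then obtain j where j: "j \<in> I" "i \<noteq> j" using i by blast
      have "bs F (- {i, j}) \<longleftrightarrow> odd (card (I - {i, j}))" using par[of "- {i, j}"] by (simp add: Diff_eq)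
      also have "card (I - {i, j}) = card I - 2" using i j \<open>finite I\<close> by (simp add: card_Diff_subset)
      also have "odd (card I - 2)"
        using \<open>odd (card I)\<close> card_mono[OF \<open>finite I\<close>, of "{i, j}"] i j by simp
      finally have "bs F (- {i, j})" by simp
      thus False using ter_mino_of_three[OF F, of i j] i j nm by (auto simp: I_def)
    qed
    have "bs F S \<longleftrightarrow> i \<in> S" for S
      using par[of S] unfolding \<open>I = {i}\<close> by (cases "i \<in> S") simp_all
    moreover have "i < n" using i by (simp add: I_def)
    ultimately show "\<exists>i<n. \<forall>S. bs F S \<longleftrightarrow> i \<in> S" by blast
  qed
qed

end

text \<open>\<open>F\<close> is sent to the projection that its Boolean part selects. This commutes
  with minors by \<open>bs_minor\<close>, and projections lie in every target.\<close>

lemma minor_le_of_projections: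
  assumes "\<forall>n. \<forall>F\<in>K n. \<exists>i<n. \<forall>S. bs F S \<longleftrightarrow> i \<in> S" and L: "self_dual_fam L"
  shows "minor_le K L"
proof -
  define p where "p F = (THE i. \<forall>S. bs F S \<longleftrightarrow> i \<in> S)" for F
  have p: "p F = i" if "\<And>S. bs F S \<longleftrightarrow> i \<in> S" for F i
    unfolding p_def
  proof (rule the_equality)
    fix j assume "\<forall>S. bs F S \<longleftrightarrow> j \<in> S"
    hence "j \<in> {i}" using that by blast
    thus "j = i" by simp
  qed (use that in simp)
  have pF: "p F < n \<and> (\<forall>S. bs F S \<longleftrightarrow> p F \<in> S)" if F: "F \<in> K n" for F n
  proof -
    obtain i where i: "i < n" "\<And>S. bs F S \<longleftrightarrow> i \<in> S" using assms(1) F by blast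
    thus ?thesis using p[OF i(2)] by simp
  qed
  show ?thesis
  proof (rule minor_leI[where \<phi> = "\<lambda>n F x. x (p F)"])
    show "(\<lambda>x. x (p F)) \<in> L n" if "F \<in> K n" for n F
      by (rule self_dual_fam.proj[OF L]) (use pF[OF that] in simp)
    fix n F r and \<pi> :: "nat \<Rightarrow> nat" assume F: "F \<in> K n"
    have "p (\<lambda>x. F (\<lambda>i. x (\<pi> i))) = \<pi> (p F)"
      by (rule p) (use pF[OF F] in \<open>simp add: bs_minor[of F \<pi>]\<close>)
    thus "(\<lambda>x. x (p (\<lambda>x. F (\<lambda>i. x (\<pi> i))))) = (\<lambda>x. x (\<pi> (p F)))" by simp
  qed
qed

lemma countably_many_projections:
  "countably_many {K. self_dual_fam K \<and> (\<forall>n. \<forall>F\<in>K n. \<exists>i<n. \<forall>S. bs F S \<longleftrightarrow> i \<in> S)}"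
  (is "countably_many ?X")
proof (rule countably_manyI[where \<kappa> = "\<lambda>_. 0::nat"])
  fix K L assume K: "K \<in> ?X" and L: "L \<in> ?X"
  have "minor_le K L" by (rule minor_le_of_projections) (use K L in auto)
  moreover have "minor_le L K" by (rule minor_le_of_projections) (use K L in auto)
  ultimately show "minor_eq K L" by (simp add: minor_eq_def)
qed simp

section \<open>Clones with a minority operation and their ternary parts\<close>

context parity_fam
begin

lemma bs_mino:
  assumes "ter K mino" "G \<in> K n" "H \<in> K n" "J \<in> K n"
  shows "bs (\<lambda>x. mino (G x) (H x) (J x)) S \<longleftrightarrow> (bs G S \<longleftrightarrow> (bs H S \<longleftrightarrow> bs J S))"
proof -
  have "bs (\<lambda>x. mino (G x) (H x) (J x)) S \<longleftrightarrow>
      mino (if bs G S then 1 else 0) (if bs H S then 1 else 0) (if bs J S then 1 else 0) = 1"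
    unfolding bs_def[of "\<lambda>x. mino (G x) (H x) (J x)"]
    by (simp only: step_value[OF assms(2)] step_value[OF assms(3)] step_value[OF assms(4)] diff_self)
  thus ?thesis by (simp add: mino_def)
qed

lemma parity_mem:
  assumes mino: "ter K mino" and I: "I \<subseteq> {..<n}" "odd (card I)"
  shows "\<exists>G\<in>K n. \<forall>S. bs G S \<longleftrightarrow> odd (card (I \<inter> S))"
  using I
proof (induction "card I" arbitrary: I rule: less_induct)
  case less
  have fin: "finite I" using less.prems(1) finite_subset by blast
  obtain i where i: "i \<in> I" using less.prems(2) by (metis card.empty ex_in_conv even_zero)
  show ?case
  proof (cases "I = {i}")
    case True
    have "(\<lambda>x. x i) \<in> K n" using i less.prems(1) proj by blast
    moreover have "bs (\<lambda>x. x i) S \<longleftrightarrow> odd (card (I \<inter> S))" for S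
      by (cases "i \<in> S") (simp_all add: True)
    ultimately show ?thesis by (intro bexI[of _ "\<lambda>x. x i"]) auto
  next
    case False
    then obtain j where j: "j \<in> I" "j \<noteq> i" using i by blast
    define J where "J = I - {i, j}"
    have "I = insert i (insert j J)" "i \<notin> J" "j \<notin> J" "finite J" using i j fin by (auto simp: J_def)
    hence card: "card I = Suc (Suc (card J))" using j(2) by simp
    have "\<exists>G\<in>K n. \<forall>S. bs G S \<longleftrightarrow> odd (card (J \<inter> S))"
      by (rule less.hyps) (use card less.prems in \<open>auto simp: J_def\<close>)
    then obtain G where G: "G \<in> K n" "\<And>S. bs G S \<longleftrightarrow> odd (card (J \<inter> S))" by blast
    have pi: "(\<lambda>x. x i) \<in> K n" and pj: "(\<lambda>x. x j) \<in> K n" using i j less.prems(1) proj by blast+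
    have "bs (\<lambda>x. mino (G x) (x i) (x j)) S \<longleftrightarrow> odd (card (I \<inter> S))" for S
    proof -
      have "I \<inter> S = (J \<inter> S) \<union> ({i} \<inter> S) \<union> ({j} \<inter> S)" using i j by (auto simp: J_def)
      moreover have "card ((J \<inter> S) \<union> ({i} \<inter> S) \<union> ({j} \<inter> S)) = card (J \<inter> S) + card ({i} \<inter> S) + card ({j} \<inter> S)"
        using fin j(2) by (subst card_Un_disjoint; (subst card_Un_disjoint)?) (auto simp: J_def)
      ultimately have card: "card (I \<inter> S) = card (J \<inter> S) + card ({i} \<inter> S) + card ({j} \<inter> S)"
        by (simp only:)
      show ?thesis
        unfolding bs_mino[OF mino G(1) pi pj] G(2) card bs_proj
        by (cases "i \<in> S"; cases "j \<in> S") simp_all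
    qed
    thus ?thesis using ter_apply[OF mino G(1) pi pj] by (intro bexI[of _ "\<lambda>x. mino (G x) (x i) (x j)"]) auto
  qed
qed

text \<open>On bits, \<open>u\<close> and \<open>v\<close> are added twice and cancel. If
  \<open>u x\<close>, \<open>G x\<close> and \<open>v x\<close> are distinct, the inner
  \<open>mino\<close> gives \<open>u x\<close> and the outer one \<open>v x\<close>, so the value of
  \<open>G\<close> at \<open>x\<close> is exchanged for \<open>v x\<close>.\<close>

lemma exchange:
  assumes mino: "ter K mino" and G: "G \<in> K n" and u: "u \<in> K n" and v: "v \<in> K n"
  shows "(\<lambda>x. mino (mino (u x) (G x) (v x)) (u x) (v x)) \<in> K n"
    and "bs (\<lambda>x. mino (mino (u x) (G x) (v x)) (u x) (v x)) S \<longleftrightarrow> bs G S"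
proof -
  have 1: "(\<lambda>x. mino (u x) (G x) (v x)) \<in> K n" by (rule ter_apply[OF mino u G v])
  show "(\<lambda>x. mino (mino (u x) (G x) (v x)) (u x) (v x)) \<in> K n" by (rule ter_apply[OF mino 1 u v])
  show "bs (\<lambda>x. mino (mino (u x) (G x) (v x)) (u x) (v x)) S \<longleftrightarrow> bs G S"
    unfolding bs_mino[OF mino 1 u v] bs_mino[OF mino u G v] by blast
qed

text \<open>Tuples with at most two values are decided by the Boolean part; at the others
  \<open>F\<close> is interpolated by members of \<open>K\<close> with its Boolean part. If
  \<open>x\<close> and \<open>y\<close> are linked by \<open>\<sigma>\<close>, then \<open>y\<close>
  is \<open>\<sigma>\<close> of \<open>x\<close> coordinatewise, so the pair sees only a ternary
  minor of \<open>F\<close>, which lies in \<open>K\<close>.\<close>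

lemma parity_determined:
  assumes K': "parity_fam K'" and eq: "K' 3 = K 3" and mino: "ter K mino" and F: "F \<in> K' n"
  shows "F \<in> K n"
proof -
  interpret K': parity_fam K' by (rule K')
  define Fs where "Fs = {G \<in> K n. \<forall>S. bs G S \<longleftrightarrow> bs F S}"
  have FsK: "G \<in> K n" and Fsb: "bs G S \<longleftrightarrow> bs F S" if "G \<in> Fs" for G S
    using that by (simp_all add: Fs_def)
  define X where "X = {x \<in> padded n. \<forall>a. \<exists>i<n. x i = a}"
  have closed: "(\<lambda>x. mino (G x) (H x) (J x)) \<in> Fs" if "G \<in> Fs" "H \<in> Fs" "J \<in> Fs" for G H J
    unfolding Fs_def mem_Collect_eq
    using ter_apply[OF mino FsK[OF that(1)] FsK[OF that(2)] FsK[OF that(3)]]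
      bs_mino[OF mino FsK[OF that(1)] FsK[OF that(2)] FsK[OF that(3)]]
      Fsb[OF that(1)] Fsb[OF that(2)] Fsb[OF that(3)] by blast
  define I where "I = {i. i < n \<and> bs F {i}}"
  have par: "bs F S \<longleftrightarrow> odd (card (I \<inter> S))" for S unfolding I_def by (rule K'.bs_parity[OF F])
  have "I \<subseteq> {..<n}" by (auto simp: I_def)
  moreover have "odd (card I)" using par[of UNIV] K'.bs_full[OF F, of UNIV] by simp
  ultimately obtain G0 where G0: "G0 \<in> K n" "\<And>S. bs G0 S \<longleftrightarrow> odd (card (I \<inter> S))"
    using parity_mem[OF mino] by blast
  hence G0: "G0 \<in> Fs" by (simp add: Fs_def par)
  have surj: "\<exists>G\<in>Fs. G x = a" if x: "x \<in> X" for x a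
  proof (cases "G0 x = a")
    case True thus ?thesis using G0 by blast
  next
    case False
    obtain u where u: "u \<noteq> G0 x" "u \<noteq> a" using Z3_ex_third by blast
    obtain j where j: "j < n" "x j = u" using x unfolding X_def by blast
    obtain k where k: "k < n" "x k = a" using x unfolding X_def by blast
    let ?G = "\<lambda>x. mino (mino (x j) (G0 x) (x k)) (x j) (x k)"
    have "?G \<in> Fs"
      using exchange[OF mino FsK[OF G0] proj[OF j(1)] proj[OF k(1)]] Fsb[OF G0] by (simp add: Fs_def)
    moreover have "?G x = a"
      using u False by (simp add: j(2) k(2) mino_distinct)
    ultimately show ?thesis by (intro bexI[of _ ?G])
  qed
  have "\<exists>G\<in>Fs. \<forall>x\<in>X. G x = F x"
  proof (rule mino.interpolation)
    show "(\<lambda>x. mino (f x) (g x) (h x)) \<in> Fs" if "f \<in> Fs" "g \<in> Fs" "h \<in> Fs" for f g h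
      using closed that by blast
    show "Fs \<noteq> {}" using G0 by blast
    show "finite X" using finite_padded by (simp add: X_def)
    show "\<exists>f\<in>Fs. f x = a" if "x \<in> X" for x a by (rule surj[OF that])
    fix x y assume x: "x \<in> X" and y: "y \<in> X"
    define R where "R a b \<longleftrightarrow> (\<exists>G\<in>Fs. G x = a \<and> G y = b)" for a b
    have "closed2 mino R"
      unfolding closed2_def
    proof (intro allI impI)
      fix a b a' b' a'' b''
      assume "R a b" "R a' b'" "R a'' b''"
      then obtain f g k where fgk: "f \<in> Fs" "g \<in> Fs" "k \<in> Fs"
        and *: "f x = a" "f y = b" "g x = a'" "g y = b'" "k x = a''" "k y = b''"
        unfolding R_def by auto
      show "R (mino a a' a'') (mino b b' b'')"
        unfolding R_def using * by (intro bexI[OF _ closed[OF fgk]]) auto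
    qed
    moreover have "\<forall>a. \<exists>b. R a b" "\<forall>b. \<exists>a. R a b"
      unfolding R_def using surj[OF x] surj[OF y] by blast+
    ultimately consider "\<forall>a b. R a b" | \<sigma> where "bij \<sigma>" "\<And>a b. R a b \<longleftrightarrow> b = \<sigma> a"
      using mino_pairs by blast
    hence "R (F x) (F y)"
    proof cases
      case 2
      have inj: "\<sigma> a = \<sigma> b \<longleftrightarrow> a = b" for a b using 2(1) by (simp add: bij_is_inj inj_eq)
      have \<sigma>: "G y = \<sigma> (G x)" if "G \<in> Fs" for G using 2(2)[of "G x" "G y"] that by (auto simp: R_def)
      have y_eq: "y j = \<sigma> (x j)" if j: "j < n" for j
      proof (rule ccontr)
        assume ne: "y j \<noteq> \<sigma> (x j)"
        obtain v2 where v2: "\<sigma> v2 = y j" using 2(1) by (metis bij_pointE)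
        have "v2 \<noteq> x j" using ne v2 by auto
        obtain v3 where v3: "v3 \<noteq> x j" "v3 \<noteq> v2" using Z3_ex_third by blast
        obtain G1 G2 G3 where G: "G1 \<in> Fs" "G1 x = x j" "G2 \<in> Fs" "G2 x = v2" "G3 \<in> Fs" "G3 x = v3"
          using surj[OF x] by meson
        \<comment> \<open>\<open>?N\<close> has the Boolean part of \<open>F\<close>: the variable
          \<open>x j\<close> is added twice and that part three times. Its values are
          \<open>x j\<close> at \<open>x\<close> and \<open>y j\<close> at \<open>y\<close>, so the
          link yields \<open>y j = \<sigma> (x j)\<close>.\<close>
        let ?M = "\<lambda>x. mino (x j) (G1 x) (G2 x)" and ?N = "\<lambda>x. mino (x j) (mino (x j) (G1 x) (G2 x)) (G3 x)"
        have M: "?M \<in> K n" by (rule ter_apply[OF mino proj[OF j] FsK[OF G(1)] FsK[OF G(3)]])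
        have "?N \<in> K n" by (rule ter_apply[OF mino proj[OF j] M FsK[OF G(5)]])
        moreover have "bs ?N S \<longleftrightarrow> bs F S" for S
          unfolding bs_mino[OF mino proj[OF j] M FsK[OF G(5)]]
            bs_mino[OF mino proj[OF j] FsK[OF G(1)] FsK[OF G(3)]]
          using Fsb[OF G(1)] Fsb[OF G(3)] Fsb[OF G(5)] by blast
        ultimately have "?N \<in> Fs" by (simp add: Fs_def)
        hence "?N y = \<sigma> (?N x)" by (rule \<sigma>)
        moreover have "?N x = x j"
          using \<open>v2 \<noteq> x j\<close> v3 by (simp add: G mino_distinct)
        moreover have "?N y = y j"
          using \<open>v2 \<noteq> x j\<close> v3
          by (simp add: \<sigma>[OF G(1)] \<sigma>[OF G(3)] \<sigma>[OF G(5)] G v2[symmetric] mino_distinct inj)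
        ultimately show False using ne by simp
      qed
      define f where "f a b c = F (\<lambda>i. if x i = 0 then a else if x i = 1 then b else c)" for a b c
      have "ter K' f" unfolding f_def[abs_def] by (rule K'.ter_minor[OF F])
      hence f: "ter K f" by (simp add: ter_def eq)
      obtain G0 G1 G2 where G: "G0 \<in> Fs" "G0 x = 0" "G1 \<in> Fs" "G1 x = 1" "G2 \<in> Fs" "G2 x = 2"
        using surj[OF x] by meson
      \<comment> \<open>The arguments of \<open>f\<close> take the values 0, 1, 2 at
        \<open>x\<close>, hence \<open>\<sigma> 0\<close>, \<open>\<sigma> 1\<close>,
        \<open>\<sigma> 2\<close> at \<open>y\<close>. On step tuples all three agree with
        \<open>F\<close>, so by idempotence \<open>?H\<close> does too.\<close>
      let ?H = "\<lambda>z. f (G0 z) (G1 z) (G2 z)"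
      have H: "?H \<in> K n" by (rule ter_apply[OF f FsK[OF G(1)] FsK[OF G(3)] FsK[OF G(5)]])
      have "bs ?H S \<longleftrightarrow> bs F S" for S
      proof -
        have "?H (step_tuple 1 S) = (if bs F S then 1 else 1 - 1)"
          using step_value[OF FsK[OF G(1)], of 1 S] step_value[OF FsK[OF G(3)], of 1 S]
            step_value[OF FsK[OF G(5)], of 1 S] Fsb[OF G(1)] Fsb[OF G(3)] Fsb[OF G(5)] ter_idem[OF f]
          by simp
        thus ?thesis unfolding bs_def[of ?H] by simp
      qed
      hence "?H \<in> Fs" using H by (simp add: Fs_def)
      moreover have "?H x = F x"
      proof -
        have "(\<lambda>i. if x i = 0 then 0 else if x i = 1 then 1 else 2) = x"
          using Z3_exhaust by (intro ext) (metis (full_types))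
        thus ?thesis by (simp add: G f_def)
      qed
      moreover have "?H y = F y"
      proof -
        have "(if x i = 0 then \<sigma> 0 else if x i = 1 then \<sigma> 1 else \<sigma> 2) = \<sigma> (x i)" for i
          using Z3_exhaust[of "x i"] by auto
        hence "f (\<sigma> 0) (\<sigma> 1) (\<sigma> 2) = F (\<lambda>i. \<sigma> (x i))" by (simp only: f_def)
        also have "\<dots> = F y" by (rule depD[OF K'.dep[OF F]]) (simp add: y_eq)
        finally show ?thesis by (simp add: \<sigma>[OF G(1)] \<sigma>[OF G(3)] \<sigma>[OF G(5)] G)
      qed
      ultimately show ?thesis unfolding R_def by (intro bexI[of _ ?H]) auto
    qed simp
    thus "\<exists>f\<in>Fs. f x = F x \<and> f y = F y" by (simp add: R_def)
  qed
  then obtain G where G: "G \<in> Fs" "\<And>x. x \<in> X \<Longrightarrow> G x = F x" by blast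
  have "G x = F x" for x
  proof (cases "\<forall>a. \<exists>i<n. x i = a")
    case True
    let ?y = "\<lambda>i. if i < n then x i else 0"
    have "G x = G ?y" by (rule depD[OF dep[OF FsK[OF G(1)]]]) simp
    also have "\<dots> = F ?y" using True by (intro G(2)) (auto simp: X_def padded_def)
    also have "\<dots> = F x" by (rule depD[OF K'.dep[OF F]]) simp
    finally show ?thesis .
  next
    case False
    then obtain c where c: "\<And>i. i < n \<Longrightarrow> x i \<noteq> c" by blast
    obtain a b where ab: "a \<noteq> b" "a \<noteq> c" "b \<noteq> c" using Z3_ex_third by metis
    let ?y = "\<lambda>i. if i \<in> {i. x i = a} then a else b"
    have y: "x i = ?y i" if "i < n" for i
      using Z3_third[OF ab(1), of c "x i"] ab c[OF that] by auto
    have "G x = G ?y" by (rule depD[OF dep[OF FsK[OF G(1)]] y])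
    also have "\<dots> = F ?y" by (simp only: two_valued[OF FsK[OF G(1)]] K'.two_valued[OF F] Fsb[OF G(1)])
    also have "\<dots> = F x" by (rule depD[OF K'.dep[OF F] y, symmetric])
    finally show ?thesis .
  qed
  hence "G = F" by blast
  thus ?thesis using FsK[OF G(1)] by simp
qed

end

lemma countably_many_parity: "countably_many {K. parity_fam K}"
proof (rule countably_many_subset)
  let ?P = "{K. self_dual_fam K \<and> (\<forall>n. \<forall>F\<in>K n. \<exists>i<n. \<forall>S. bs F S \<longleftrightarrow> i \<in> S)}"
  let ?M = "{K. parity_fam K \<and> ter K mino}"
  have "countably_many ?M"
  proof (rule countably_many_eq)
    show "self_dual_fam K" if "K \<in> ?M" for K
    proof -
      interpret parity_fam K using that by simp
      show ?thesis by (rule self_dual_fam_axioms)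
    qed
    show "K n \<subseteq> L n" if "K \<in> ?M" "L \<in> ?M" "K 3 = L 3" for K L n
      using parity_fam.parity_determined[of L K] that by blast
  qed
  thus "countably_many (?P \<union> ?M)" by (rule countably_many_Un[OF countably_many_projections])
  show "{K. parity_fam K} \<subseteq> ?P \<union> ?M"
  proof
    fix K assume "K \<in> {K. parity_fam K}"
    then interpret parity_fam K by simp
    show "K \<in> ?P \<union> ?M"
      using projections_or_mino self_dual_fam_axioms parity_fam_axioms by simp
  qed
qed

section \<open>Clones containing the rock-paper-scissors operation\<close>

definition bit :: "bool \<Rightarrow> 3" where
  "bit p = (if p then 1 else 0)"

lemma bit_simps [simp]: "bit True = 1" "bit False = 0" "rps (bit p) (bit q) = bit (p \<and> q)"
  by (auto simp: bit_def rps_def)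

lemma step_tuple_bit: "step_tuple 1 S = (\<lambda>j. bit (j \<in> S))"
  by (auto simp: step_tuple_def bit_def)

text \<open>The bit of the coarsening of \<open>x\<close> in which the block of \<open>a\<close>
  reads false and everything else true.\<close>

definition cut :: "((nat \<Rightarrow> 3) \<Rightarrow> 3) \<Rightarrow> (nat \<Rightarrow> 3) \<Rightarrow> 3 \<Rightarrow> bool" where
  "cut F x a \<longleftrightarrow> bs F {j. x j \<noteq> a}"

text \<open>
  At most one \<open>a\<close> satisfies the premises, none does if and only if the three bits
  \<open>cut F x\<close> agree, and on tuples with at most two values every \<open>F\<close> already obeys the rule.
\<close>
definition normal :: "((nat \<Rightarrow> 3) \<Rightarrow> 3) \<Rightarrow> bool" where
  "normal F \<longleftrightarrow> (\<forall>x a. cut F x (a - 1) \<longrightarrow> \<not> cut F x a \<longrightarrow> F x = a)"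

definition normalize :: "((nat \<Rightarrow> 3) \<Rightarrow> 3) \<Rightarrow> (nat \<Rightarrow> 3) \<Rightarrow> 3" where
  "normalize F x = (if \<exists>a. cut F x (a - 1) \<and> \<not> cut F x a
     then THE a. cut F x (a - 1) \<and> \<not> cut F x a else F x)"

text \<open>Disjunction behind a guard \<open>p\<close>; plain disjunction cannot occur where every
  Boolean part lies below a variable.\<close>

definition or_op :: "(3 \<Rightarrow> 3 \<Rightarrow> 3 \<Rightarrow> 3) \<Rightarrow> bool" where
  "or_op g \<longleftrightarrow> (\<forall>p q r. g (bit p) (bit q) (bit r) = bit (p \<and> (q \<or> r)))"

text \<open>Since \<open>rps\<close> is not associative, a product over a set depends on its
  bracketing. On values in \<open>{a - 1, a}\<close> it is a conjunction, and only this is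
  recorded.\<close>

definition product_on :: "nat set \<Rightarrow> ((nat \<Rightarrow> 3) \<Rightarrow> 3) \<Rightarrow> bool" where
  "product_on J p \<longleftrightarrow> (\<forall>y a. (\<forall>i\<in>J. y i = a \<or> y i = a - 1) \<longrightarrow>
     p y = (if \<forall>i\<in>J. y i = a then a else a - 1))"

lemma product_onD: "product_on J p \<Longrightarrow> (\<And>i. i \<in> J \<Longrightarrow> y i = a \<or> y i = a - 1) \<Longrightarrow>
    p y = (if \<forall>i\<in>J. y i = a then a else a - 1)"
  by (simp add: product_on_def)

lemma bs_product: "product_on J p \<Longrightarrow> bs p S \<longleftrightarrow> J \<subseteq> S"
  using product_onD[of J p "step_tuple 1 S" 1] by (auto simp: bs_def step_tuple_def)

text \<open>Multiplying by \<open>u x\<close> turns \<open>x\<close> into the two-valued tuple that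
  separates \<open>u x - 1\<close> from the other values, so \<open>F\<close> is evaluated on a
  coarsening.\<close>

definition shift_by :: "((nat \<Rightarrow> 3) \<Rightarrow> 3) \<Rightarrow> ((nat \<Rightarrow> 3) \<Rightarrow> 3) \<Rightarrow> (nat \<Rightarrow> 3) \<Rightarrow> 3" where
  "shift_by F u x = F (\<lambda>j. rps (x j) (u x))"

text \<open>Meant for a variable \<open>i\<close> that bounds the Boolean part of \<open>F\<close>.
  From one shift on, the iterates are normal and keep that Boolean part; where all bits vanish each
  shift subtracts 1, so three consecutive iterates realise all values.\<close>

primrec nproj :: "((nat \<Rightarrow> 3) \<Rightarrow> 3) \<Rightarrow> nat \<Rightarrow> nat \<Rightarrow> (nat \<Rightarrow> 3) \<Rightarrow> 3" where
  "nproj F i 0 = (\<lambda>x. x i)"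
| "nproj F i (Suc k) = shift_by F (nproj F i k)"

section \<open>The three bits of a tuple and the normalizing map\<close>

lemma cut_unique:
  assumes "cut F x (a - 1)" "\<not> cut F x a" "cut F x (b - 1)" "\<not> cut F x b"
  shows "a = b"
  using assms Z3_near[of b a] by (auto simp: algebra_simps)

text \<open>Bits that are not constant must drop from true to false somewhere around the cycle of
  three values.\<close>

lemma cut_exists:
  assumes "cut F x a" "\<not> cut F x b"
  shows "\<exists>c. cut F x (c - 1) \<and> \<not> cut F x c"
proof (cases "cut F x (a + 1)")
  case True
  hence "b \<noteq> a" "b \<noteq> a + 1" using assms by auto
  hence "b = a + 1 + 1" using Z3_near[of b a] by (auto simp: Z3_diff add.assoc)
  hence "b - 1 = a + 1" by (simp only: add_diff_cancel)
  hence "cut F x (b - 1)" using True by (simp only:)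
  thus ?thesis using assms(2) by blast
next
  case False thus ?thesis using assms(1) by (intro exI[of _ "a + 1"]) simp
qed

lemma normalize_eqI: "cut F x (a - 1) \<Longrightarrow> \<not> cut F x a \<Longrightarrow> normalize F x = a"
  unfolding normalize_def using cut_unique[of F x] by (auto intro!: the_equality)

lemma normalize_outside: "(\<And>a. \<not> cut F x a) \<Longrightarrow> normalize F x = F x"
  by (simp add: normalize_def)

lemma cut_minor: "cut (\<lambda>x. F (\<lambda>i. x (\<pi> i))) x a \<longleftrightarrow> cut F (\<lambda>i. x (\<pi> i)) a"
  unfolding cut_def bs_minor[of F \<pi>] by (simp add: vimage_def)

lemma normalize_minor:
  "normalize (\<lambda>x. F (\<lambda>i. x (\<pi> i))) = (\<lambda>x. normalize F (\<lambda>i. x (\<pi> i)))"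
  unfolding normalize_def cut_minor[of F \<pi>] ..

lemma cut_cong: "(\<And>S. bs G S \<longleftrightarrow> bs F S) \<Longrightarrow> cut G x a \<longleftrightarrow> cut F x a"
  by (simp add: cut_def)

lemma normal_cong_rps:
  assumes "normal G" "normal H" "\<And>S. bs G S \<longleftrightarrow> bs F S" "\<And>S. bs H S \<longleftrightarrow> bs F S"
    "\<And>S. bs (\<lambda>x. rps (G x) (H x)) S \<longleftrightarrow> bs F S"
  shows "normal (\<lambda>x. rps (G x) (H x))"
  unfolding normal_def
proof (intro allI impI)
  fix x a
  assume "cut (\<lambda>x. rps (G x) (H x)) x (a - 1)" "\<not> cut (\<lambda>x. rps (G x) (H x)) x a"
  hence "cut F x (a - 1)" "\<not> cut F x a" using cut_cong[OF assms(5)] by blast+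
  hence "G x = a" "H x = a"
    using assms(1,2) cut_cong[OF assms(3)] cut_cong[OF assms(4)] unfolding normal_def by blast+
  thus "rps (G x) (H x) = a" by simp
qed

section \<open>Boolean parts and normal operations in the presence of \<open>rps\<close>\<close>

locale rps_fam = conservative_fam +
  assumes rps: "bin K rps" and no_nu: "\<not> (\<exists>k. \<exists>N\<in>K k. is_nu k N)"
begin

lemma bits_value: "F \<in> K n \<Longrightarrow> F (\<lambda>j. bit (P j)) = bit (bs F {j. P j})"
  using step_value[of F n 1 "{j. P j}"] by (simp add: step_tuple_bit bit_def)

lemma bit_value: "F \<in> K n \<Longrightarrow> F (step_tuple 1 S) = bit (bs F S)"
  using step_value[of F n 1 S] by (simp add: bit_def)

lemma bs_rps: "G \<in> K n \<Longrightarrow> H \<in> K n \<Longrightarrow> bs (\<lambda>x. rps (G x) (H x)) S \<longleftrightarrow> bs G S \<and> bs H S"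
  unfolding bs_def[of "\<lambda>x. rps (G x) (H x)"] by (simp only: bit_value bit_simps) (simp add: bit_def)

lemma bs_or:
  assumes "or_op g" "G \<in> K n" "H \<in> K n" "J \<in> K n"
  shows "bs (\<lambda>x. g (G x) (H x) (J x)) S \<longleftrightarrow> bs G S \<and> (bs H S \<or> bs J S)"
  unfolding bs_def[of "\<lambda>x. g (G x) (H x) (J x)"] bit_value[OF assms(2)] bit_value[OF assms(3)]
    bit_value[OF assms(4)]
  using assms(1) by (simp add: or_op_def) (simp add: bit_def)

lemma rps_product:
  assumes "finite J" "J \<noteq> {}" "J \<subseteq> {..<m}"
  shows "\<exists>p\<in>K m. product_on J p"
  using assms
proof (induction J rule: finite_ne_induct)
  case (singleton i)
  hence "(\<lambda>x. x i) \<in> K m" by (intro proj) simp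
  moreover have "product_on {i} (\<lambda>x. x i)" by (simp add: product_on_def)
  ultimately show ?case by (intro bexI[of _ "\<lambda>x. x i"])
next
  case (insert i J)
  hence "J \<subseteq> {..<m}" by simp
  from insert.IH[OF this] obtain p where p: "p \<in> K m" "product_on J p" by (elim bexE)
  have "product_on (insert i J) (\<lambda>y. rps (y i) (p y))"
    unfolding product_on_def
  proof (intro allI impI)
    fix y :: "nat \<Rightarrow> 3" and a assume y: "\<forall>j\<in>insert i J. y j = a \<or> y j = a - 1"
    have "p y = (if \<forall>i\<in>J. y i = a then a else a - 1)" by (rule product_onD[OF p(2)]) (use y in simp)
    thus "rps (y i) (p y) = (if \<forall>i\<in>insert i J. y i = a then a else a - 1)"
      using y by auto
  qed
  moreover have "(\<lambda>y. rps (y i) (p y)) \<in> K m"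
    using insert.prems by (intro bin_apply[OF rps _ p(1)] proj) simp
  ultimately show ?case by (intro bexI[of _ "\<lambda>y. rps (y i) (p y)"])
qed

text \<open>
  If no variable bounds the Boolean part, each coordinate \<open>j\<close> is missed by a true set \<open>S j\<close>. Doubling
  the indices of these sets and feeding \<open>F\<close> the products of at least two variables gives a
  near-unanimity operation.
\<close>
lemma guard_exists:
  assumes F: "F \<in> K n"
  shows "\<exists>i<n. \<forall>S. bs F S \<longrightarrow> i \<in> S"
proof (rule ccontr)
  assume "\<not> ?thesis"
  then obtain S where S: "\<And>i. i < n \<Longrightarrow> bs F (S i)" "\<And>i. i < n \<Longrightarrow> i \<notin> S i" by metis
  define J where "J j = {l. l < 2 * n \<and> j \<notin> S (l div 2)}" for j
  have J: "finite (J j)" "J j \<subseteq> {..<2 * n}" for j by (auto simp: J_def)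
  have Jmem: "2 * j \<in> J j" "2 * j + 1 \<in> J j" if "j < n" for j using S(2)[OF that] that by (auto simp: J_def)
  have "\<exists>p. p \<in> K (2 * n) \<and> product_on (J j) p" if "j < n" for j
    using rps_product[OF J(1) _ J(2), of j] Jmem(1)[OF that] by blast
  then obtain p where p: "\<And>j. j < n \<Longrightarrow> p j \<in> K (2 * n)" "\<And>j. j < n \<Longrightarrow> product_on (J j) (p j)"
    by metis
  have "(\<lambda>y. F (\<lambda>j. p j y)) \<in> K (2 * n)" by (rule comp[OF F]) (rule p(1))
  moreover have "is_nu (2 * n) (\<lambda>y. F (\<lambda>j. p j y))"
    unfolding is_nu_def
  proof (intro allI impI)
    fix a b :: 3 and l assume l: "l < 2 * n"
    let ?y = "\<lambda>i. if i = l then b else a"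
    consider "b = a - 1" | "b = a" | "b = a + 1" using Z3_near by blast
    thus "F (\<lambda>j. p j ?y) = a"
    proof cases
      case 1
      have "p j ?y = step_tuple a (S (l div 2)) j" if "j < n" for j
      proof -
        have "p j ?y = (if \<forall>i\<in>J j. ?y i = a then a else a - 1)" by (rule product_onD[OF p(2)[OF that]]) (simp add: 1)
        also have "(\<forall>i\<in>J j. ?y i = a) \<longleftrightarrow> j \<in> S (l div 2)" using l 1 by (auto simp: J_def)
        finally show ?thesis by (simp add: step_tuple_def)
      qed
      hence "F (\<lambda>j. p j ?y) = F (step_tuple a (S (l div 2)))" by (rule depD[OF dep[OF F]])
      thus ?thesis using step_value[OF F] S(1)[of "l div 2"] l by simp
    next
      case 2
      have "p j ?y = a" if "j < n" for j using product_onD[OF p(2)[OF that], of ?y a] 2 by simp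
      hence "F (\<lambda>j. p j ?y) = F (\<lambda>j. a)" by (rule depD[OF dep[OF F]])
      thus ?thesis using idem[OF F] by simp
    next
      case 3
      have "p j ?y = a" if "j < n" for j
      proof -
        have "p j ?y = (if \<forall>i\<in>J j. ?y i = a + 1 then a + 1 else a + 1 - 1)"
          by (rule product_onD[OF p(2)[OF that]]) (simp add: 3)
        \<comment> \<open>A single entry \<open>a + 1\<close> loses against \<open>a\<close>, and
          \<open>J j\<close> contains both \<open>2 * j\<close> and \<open>2 * j + 1\<close>, so
          some entry is \<open>a\<close>. This is the purpose of the doubling.\<close>
        moreover have "\<not> (\<forall>i\<in>J j. ?y i = a + 1)"
        proof
          assume "\<forall>i\<in>J j. ?y i = a + 1"
          hence "i = l" if "i \<in> J j" for i using that by (auto split: if_splits)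
          from this[OF Jmem(1)[OF that]] this[OF Jmem(2)[OF that]] show False by simp
        qed
        ultimately show ?thesis by simp
      qed
      hence "F (\<lambda>j. p j ?y) = F (\<lambda>j. a)" by (rule depD[OF dep[OF F]])
      thus ?thesis using idem[OF F] by simp
    qed
  qed
  ultimately show False using no_nu by blast
qed

text \<open>The bit at the value of a bounding variable is false, so bits that agree all
  vanish.\<close>

lemma cut_guard: "(\<And>S. bs F S \<Longrightarrow> i \<in> S) \<Longrightarrow> \<not> cut F x (x i)"
  unfolding cut_def by auto

lemma cut_range:
  assumes F: "F \<in> K n" and "\<not> cut F x a"
  shows "\<exists>j<n. x j = a"
proof (rule ccontr)
  assume "\<not> ?thesis"
  hence "bs F {j. x j \<noteq> a}" by (intro bs_full[OF F]) auto
  thus False using assms(2) by (simp add: cut_def)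
qed

lemma cut_local:
  assumes F: "F \<in> K n" and "\<And>j. j < n \<Longrightarrow> x j = y j"
  shows "cut F x a \<longleftrightarrow> cut F y a"
  unfolding cut_def by (rule bs_local[OF F]) (simp add: assms(2))

lemma shift_by_value:
  assumes F: "F \<in> K n"
  shows "shift_by F u x = (if cut F x (u x - 1) then u x else u x - 1)"
proof -
  have "(\<lambda>j. rps (x j) (u x)) = step_tuple (u x) {j. x j \<noteq> u x - 1}"
    by (auto simp: rps_def step_tuple_def)
  thus ?thesis using step_value[OF F] by (simp add: shift_by_def cut_def)
qed

lemma shift_by_mem: "F \<in> K n \<Longrightarrow> u \<in> K n \<Longrightarrow> shift_by F u \<in> K n"
  unfolding shift_by_def[abs_def] by (rule comp) (auto intro: bin_apply[OF rps] proj)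

text \<open>On bits, every variable is conjoined with \<open>u\<close>, which lies above
  \<open>F\<close>.\<close>

lemma bs_shift_by:
  assumes F: "F \<in> K n" and u: "u \<in> K n" and le: "\<And>S. bs F S \<Longrightarrow> bs u S"
  shows "bs (shift_by F u) S \<longleftrightarrow> bs F S"
proof -
  have "bs (shift_by F u) S \<longleftrightarrow> bs F {j. bs (\<lambda>x. rps (x j) (u x)) S}"
    unfolding shift_by_def[abs_def]
    by (rule bs_comp[OF F]) (auto intro: bin_apply[OF rps] proj u)
  also have "\<dots> \<longleftrightarrow> bs F (if bs u S then S else {})"
    by (rule bs_local[OF F]) (simp add: bs_rps[OF proj u])
  also have "\<dots> \<longleftrightarrow> bs F S" using le[of S] bs_disjoint[OF F, of "{}"] by auto
  finally show ?thesis .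
qed

context
  fixes F n i
  assumes F: "F \<in> K n" and i: "i < n" and guard: "\<And>S. bs F S \<Longrightarrow> i \<in> S"
begin

lemma nproj_mem: "nproj F i k \<in> K n"
  by (induction k) (auto simp: F i intro: proj shift_by_mem)

lemma bs_nproj: "bs (nproj F i (Suc k)) S \<longleftrightarrow> bs F S"
proof (induction k arbitrary: S)
  case 0 show ?case using bs_shift_by[OF F proj[OF i]] guard by simp
next
  case (Suc k) show ?case using bs_shift_by[OF F nproj_mem[of "Suc k"]] Suc by simp
qed

text \<open>The true bit at \<open>a - 1\<close> excludes \<open>x i = a - 1\<close>. From
  \<open>a\<close> or \<open>a + 1\<close> the first shift arrives at \<open>a\<close>, and further
  shifts stay there.\<close>

lemma nproj_cut:
  assumes "cut F x (a - 1)" "\<not> cut F x a"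
  shows "nproj F i (Suc k) x = a"
proof (induction k)
  case 0
  have "x i \<noteq> a - 1" using cut_guard[of F i x] guard assms(1) by auto
  hence "x i = a \<or> x i = a + 1" using Z3_near by blast
  thus ?case using assms by (auto simp: shift_by_value[OF F])
next
  case (Suc k)
  thus ?case using assms by (simp add: shift_by_value[OF F])
qed

lemma normal_nproj: "normal (nproj F i (Suc k))"
  unfolding normal_def using cut_cong[OF bs_nproj] nproj_cut by blast

lemma nproj_uncut: "(\<And>a. \<not> cut F x a) \<Longrightarrow> nproj F i k x = x i - of_nat k"
  by (induction k) (simp_all add: shift_by_value[OF F] algebra_simps)

end

text \<open>\<open>I\<close> collects the variables that bound \<open>F\<close>. If \<open>I\<close>
  is true but some larger set is false, this failure of monotonicity yields
  \<open>p \<and> (q \<longrightarrow> r)\<close> and hence \<open>or_op\<close>. If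
  \<open>I\<close> is false, a smallest true set and a true set missing one of its elements have a
  false intersection, and the two sets yield \<open>or_op\<close>.\<close>

lemma conjunction_or:
  assumes no: "\<not> (\<exists>g. ter K g \<and> or_op g)" and F: "F \<in> K n"
  shows "\<exists>I. I \<subseteq> {..<n} \<and> I \<noteq> {} \<and> (\<forall>S. bs F S \<longleftrightarrow> I \<subseteq> S)"
proof -
  define I where "I = {i. i < n \<and> (\<forall>S. bs F S \<longrightarrow> i \<in> S)}"
  have I: "I \<subseteq> {..<n}" "I \<noteq> {}" using guard_exists[OF F] by (auto simp: I_def)
  have sub: "I \<subseteq> S" if "bs F S" for S using that by (auto simp: I_def)
  have "bs F S" if S: "I \<subseteq> S" for S
  proof (rule ccontr)
    assume nS: "\<not> bs F S"
    show False
    proof (cases "bs F I")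
      case True
      define c where "c p q r = F (\<lambda>j. if j \<in> I then p else if j \<in> S then q else rps q r)" for p q r
      have "(\<lambda>x. F (\<lambda>j. (\<lambda>x. if j \<in> I then x 0 else if j \<in> S then x 1 else rps (x 1) (x 2)) x)) \<in> K 3"
      proof (rule comp[OF F])
        fix j
        show "(\<lambda>x. if j \<in> I then x 0 else if j \<in> S then x 1 else rps (x 1) (x 2)) \<in> K 3"
          using proj[of 0 3] proj[of 1 3] bin_apply[OF rps proj[of 1 3] proj[of 2 3]]
          by (cases "j \<in> I"; cases "j \<in> S") simp_all
      qed
      hence c: "ter K c" by (simp only: ter_def c_def)
      have cb: "c (bit p) (bit q) (bit r) = bit (p \<and> (q \<longrightarrow> r))" for p q r
      proof -
        let ?P = "\<lambda>j. (j \<in> I \<and> p) \<or> (j \<notin> I \<and> j \<in> S \<and> q) \<or> (j \<notin> I \<and> j \<notin> S \<and> q \<and> r)"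
        have "(\<lambda>j. if j \<in> I then bit p else if j \<in> S then bit q else rps (bit q) (bit r)) = (\<lambda>j. bit (?P j))"
          by auto
        hence "c (bit p) (bit q) (bit r) = bit (bs F {j. ?P j})" by (simp only: c_def bits_value[OF F])
        also have "bs F {j. ?P j} \<longleftrightarrow> p \<and> (q \<longrightarrow> r)"
        proof -
          consider "\<not> p" | "p" "\<not> q" | "p" "q" "\<not> r" | "p" "q" "r" by blast
          thus ?thesis
          proof cases
            case 1 thus ?thesis using sub[of "{j. ?P j}"] I(2) by auto
          next
            case 2
            hence "{j. ?P j} = I" by auto
            thus ?thesis using 2 True by simp
          next
            case 3
            hence "{j. ?P j} = S" using S by auto
            thus ?thesis using 3 nS by simp
          next
            case 4
            hence "bs F {j. ?P j}" by (intro bs_full[OF F]) auto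
            thus ?thesis using 4 by simp
          qed
        qed
        finally show ?thesis .
      qed
      \<comment> \<open>\<open>(q \<longrightarrow> r) \<longrightarrow> r\<close> is
        \<open>q \<or> r\<close>.\<close>
      have "ter K (\<lambda>p q r. c p (c p q r) r)" by (rule ter_ter[OF c ter_1 c ter_3])
      moreover have "or_op (\<lambda>p q r. c p (c p q r) r)" unfolding or_op_def cb
        by (intro allI arg_cong[where f = bit]) blast
      ultimately show False using no by blast
    next
      case False
      have "\<exists>T. T \<subseteq> {..<n} \<and> bs F T" using bs_full[OF F, of "{..<n}"] by auto
      then obtain T1 where T1: "T1 \<subseteq> {..<n}" "bs F T1"
        and min: "\<And>T. T \<subseteq> {..<n} \<Longrightarrow> bs F T \<Longrightarrow> card T1 \<le> card T"
        using ex_has_least_nat[of "\<lambda>T. T \<subseteq> {..<n} \<and> bs F T" _ card] by metis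
      have "I \<noteq> T1" using T1(2) False by auto
      then obtain k where k: "k \<in> T1" "k \<notin> I" using sub[OF T1(2)] by blast
      then obtain T2 where T2: "bs F T2" "k \<notin> T2" using T1(1) by (auto simp: I_def)
      have n12: "\<not> bs F (T1 \<inter> T2)"
      proof
        assume "bs F (T1 \<inter> T2)"
        hence "card T1 \<le> card (T1 \<inter> T2)" by (intro min) (use T1 in auto)
        moreover have "T1 \<inter> T2 \<subset> T1" using k T2 by blast
        moreover have "finite T1" using T1(1) finite_subset by blast
        ultimately show False using psubset_card_mono[of T1 "T1 \<inter> T2"] by simp
      qed
      define g where "g p q r = F (\<lambda>j. if j \<in> T1 \<inter> T2 then p else if j \<in> T1 then q else if j \<in> T2 then r
          else rps p (rps q r))" for p q r
      have "(\<lambda>x. F (\<lambda>j. (\<lambda>x. if j \<in> T1 \<inter> T2 then x 0 else if j \<in> T1 then x 1 else if j \<in> T2 then x 2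
          else rps (x 0) (rps (x 1) (x 2))) x)) \<in> K 3"
      proof (rule comp[OF F])
        fix j
        show "(\<lambda>x. if j \<in> T1 \<inter> T2 then x 0 else if j \<in> T1 then x 1 else if j \<in> T2 then x 2
            else rps (x 0) (rps (x 1) (x 2))) \<in> K 3"
          using proj[of 0 3] proj[of 1 3] proj[of 2 3]
            bin_apply[OF rps proj[of 0 3] bin_apply[OF rps proj[of 1 3] proj[of 2 3]]]
          by (cases "j \<in> T1"; cases "j \<in> T2") simp_all
      qed
      hence "ter K g" by (simp only: ter_def g_def)
      moreover have "or_op g"
        unfolding or_op_def
      proof (intro allI)
        fix p q r
        let ?P = "\<lambda>j. (j \<in> T1 \<inter> T2 \<and> p) \<or> (j \<in> T1 - T2 \<and> q) \<or> (j \<in> T2 - T1 \<and> r) \<or>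
          (j \<notin> T1 \<union> T2 \<and> p \<and> q \<and> r)"
        have "(\<lambda>j. if j \<in> T1 \<inter> T2 then bit p else if j \<in> T1 then bit q else if j \<in> T2 then bit r
            else rps (bit p) (rps (bit q) (bit r))) = (\<lambda>j. bit (?P j))"
          by auto
        hence "g (bit p) (bit q) (bit r) = bit (bs F {j. ?P j})" by (simp only: g_def bits_value[OF F])
        also have "bs F {j. ?P j} \<longleftrightarrow> p \<and> (q \<or> r)"
        proof -
          consider "\<not> p" | "p" "\<not> q" "\<not> r" | "p" "q" "\<not> r" | "p" "\<not> q" "r" | "p" "q" "r" by blast
          thus ?thesis
          proof cases
            case 1
            thus ?thesis using sub[of "{j. ?P j}"] sub[OF T1(2)] sub[OF T2(1)] I(2) by auto
          next
            case 2
            hence "{j. ?P j} = T1 \<inter> T2" by auto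
            thus ?thesis using 2 n12 by simp
          next
            case 3
            hence "{j. ?P j} = T1" by auto
            thus ?thesis using 3 T1 by simp
          next
            case 4
            hence "{j. ?P j} = T2" by auto
            thus ?thesis using 4 T2 by simp
          next
            case 5
            hence "bs F {j. ?P j}" by (intro bs_full[OF F]) auto
            thus ?thesis using 5 by simp
          qed
        qed
        finally show "g (bit p) (bit q) (bit r) = bit (p \<and> (q \<or> r))" .
      qed
      ultimately show False using no by blast
    qed
  qed
  thus ?thesis using I sub by blast
qed

end

text \<open>
  Found by search: the term is the identity in \<open>r\<close> when the constants run through all three values,
  but collapses to \<open>rps r a\<close> when all constants are equal (\<open>rps_absorb\<close>).
\<close>
lemma rps_retract:
  "rps r (rps a (rps (a - 1) (rps (a - 2) (rps a (rps r (a - 1)))))) = r"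
proof -
  have "\<forall>r a::3. rps r (rps a (rps (a - 1) (rps (a - 2) (rps a (rps r (a - 1)))))) = r"
    by (simp add: Z3_all rps_def)
  thus ?thesis by blast
qed

lemma rps_absorb: "rps r (rps a (rps a (rps a (rps a (rps r a))))) = rps r a"
  by (simp add: rps_def)

lemma rps_cases: "rps r a = a \<or> rps r a = a - 1"
  by (auto simp: rps_def)

lemma rps_separates: "a \<noteq> b \<Longrightarrow> \<exists>v. rps v a \<noteq> rps v b"
proof -
  have "\<forall>a b. a \<noteq> b \<longrightarrow> (\<exists>v. rps v a \<noteq> rps v b)" by (simp add: Z3_all Z3_ex rps_def)
  thus "a \<noteq> b \<Longrightarrow> \<exists>v. rps v a \<noteq> rps v b" by blast
qed

section \<open>Two clones with the same 9-ary part\<close>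

locale rps_fams = K: rps_fam K + L: rps_fam L for K L :: fam +
  assumes eq9: "K 9 = L 9"
begin

text \<open>Two tuples show at most \<open>3 ^ 2 = 9\<close> columns; merging equal columns keeps
  the values of \<open>F\<close> at both and leaves a minor that \<open>K\<close> and
  \<open>L\<close> share.\<close>

lemma collapse_pair:
  fixes x y :: "nat \<Rightarrow> 3"
  assumes F: "F \<in> K n"
  shows "\<exists>\<rho>. (\<forall>i<n. \<rho> i < n \<and> x (\<rho> i) = x i \<and> y (\<rho> i) = y i \<and> (i \<in> I \<longrightarrow> \<rho> i \<in> I)) \<and>
    (\<lambda>z. F (\<lambda>i. z (\<rho> i))) \<in> L n"
proof -
  obtain \<rho> where \<rho>: "\<forall>i<n. \<rho> i < n \<and> (\<forall>z\<in>{x, y}. z (\<rho> i) = z i) \<and> (i \<in> I \<longrightarrow> \<rho> i \<in> I)"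
    and card: "card (\<rho> ` {..<n}) \<le> 3 ^ card {x, y}"
    using card_key_image[of "{x, y}" n I] by auto
  have "card {x, y} \<le> 2" by (simp add: card_insert_if)
  hence "(3::nat) ^ card {x, y} \<le> 3 ^ 2" by (rule power_increasing) simp
  hence "card (\<rho> ` {..<n}) \<le> 9" using card by simp
  hence "(\<lambda>z. F (\<lambda>i. z (\<rho> i))) \<in> L n"
    using \<rho> by (intro K.collapse[OF L.self_dual_fam_axioms eq9 F]) auto
  thus ?thesis using \<rho> by (intro exI[of _ \<rho>]) auto
qed

lemma ter_transfer: "ter K g \<Longrightarrow> ter L g"
  unfolding ter_def using K.collapse[OF L.self_dual_fam_axioms eq9, of _ 3 "\<lambda>i. i"] by simp

text \<open>A minor common to \<open>K\<close> and \<open>L\<close> separates a given true set from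
  a given false set. Products over all false sets, followed by disjunctions over all true sets
  guarded by the bounding variable \<open>i\<close>, assemble the Boolean part of
  \<open>F\<close>.\<close>

lemma same_bs_or:
  assumes g: "ter L g" "or_op g" and F: "F \<in> K n"
  shows "\<exists>G\<in>L n. \<forall>S. bs G S \<longleftrightarrow> bs F S"
proof -
  obtain i where i: "i < n" "\<And>S. bs F S \<Longrightarrow> i \<in> S" using K.guard_exists[OF F] by blast
  have sep2: "\<exists>w\<in>L n. bs w S \<and> \<not> bs w T" if S: "bs F S" and T: "\<not> bs F T" for S T
  proof -
    obtain \<rho> where \<rho>: "\<forall>i<n. \<rho> i < n \<and> step_tuple 1 S (\<rho> i) = step_tuple 1 S i \<and>
        step_tuple 1 T (\<rho> i) = step_tuple 1 T i" and mem: "(\<lambda>z. F (\<lambda>i. z (\<rho> i))) \<in> L n"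
      using collapse_pair[OF F, of "step_tuple 1 S" "step_tuple 1 T" "{}"] by auto
    have "F (\<lambda>i. step_tuple 1 S (\<rho> i)) = F (step_tuple 1 S)"
      "F (\<lambda>i. step_tuple 1 T (\<rho> i)) = F (step_tuple 1 T)"
      using \<rho> by (auto intro!: depD[OF K.dep[OF F]])
    hence "bs (\<lambda>z. F (\<lambda>i. z (\<rho> i))) S" "\<not> bs (\<lambda>z. F (\<lambda>i. z (\<rho> i))) T"
      using S T by (simp_all add: bs_def)
    thus ?thesis using mem by (intro bexI[of _ "\<lambda>z. F (\<lambda>i. z (\<rho> i))"]) auto
  qed
  have sep: "\<exists>w\<in>L n. bs w S \<and> (\<forall>T\<in>\<T>. \<not> bs w T)"
    if S: "bs F S" and "finite \<T>" "\<And>T. T \<in> \<T> \<Longrightarrow> \<not> bs F T" for S \<T>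
    using that(2,3)
  proof (induction \<T> rule: finite_induct)
    case empty
    show ?case using L.proj[OF i(1)] i(2)[OF S] by (intro bexI[of _ "\<lambda>x. x i"]) auto
  next
    case (insert T \<T>)
    then obtain w where w: "w \<in> L n" "bs w S" "\<forall>T\<in>\<T>. \<not> bs w T" by auto
    obtain w' where w': "w' \<in> L n" "bs w' S" "\<not> bs w' T" using sep2[OF S, of T] insert.prems by auto
    show ?case
      by (intro bexI[of _ "\<lambda>x. rps (w x) (w' x)"] L.bin_apply[OF L.rps])
        (use w w' L.bs_rps[OF w(1) w'(1)] in auto)
  qed
  have below: "\<exists>w\<in>L n. bs w S \<and> (\<forall>T. \<not> bs F T \<longrightarrow> \<not> bs w T)" if S: "bs F S" for S
  proof -
    have "\<exists>w\<in>L n. bs w S \<and> (\<forall>T\<in>{T. T \<subseteq> {..<n} \<and> \<not> bs F T}. \<not> bs w T)"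
      by (rule sep[OF S]) simp_all
    then obtain w where w: "w \<in> L n" "bs w S" "\<forall>T\<in>{T. T \<subseteq> {..<n} \<and> \<not> bs F T}. \<not> bs w T"
      by (elim bexE conjE)
    have "\<not> bs w T" if "\<not> bs F T" for T
    proof -
      have "\<not> bs F (T \<inter> {..<n})" using K.bs_local[OF F, of T "T \<inter> {..<n}"] that by simp
      hence "\<not> bs w (T \<inter> {..<n})" using w(3) by simp
      thus ?thesis using L.bs_local[OF w(1), of T "T \<inter> {..<n}"] by simp
    qed
    thus ?thesis using w by blast
  qed
  have join: "\<exists>w\<in>L n. (\<forall>T. \<not> bs F T \<longrightarrow> \<not> bs w T) \<and> (\<forall>S\<in>\<S>. bs w S)"
    if "finite \<S>" "\<S> \<noteq> {}" "\<And>S. S \<in> \<S> \<Longrightarrow> bs F S" for \<S>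
    using that
  proof (induction \<S> rule: finite_ne_induct)
    case (singleton S)
    thus ?case using below[of S] by auto
  next
    case (insert S \<S>)
    hence "\<exists>w\<in>L n. (\<forall>T. \<not> bs F T \<longrightarrow> \<not> bs w T) \<and> (\<forall>S\<in>\<S>. bs w S)" by simp
    then obtain w where w: "w \<in> L n" "\<forall>T. \<not> bs F T \<longrightarrow> \<not> bs w T" "\<forall>S\<in>\<S>. bs w S"
      by (elim bexE conjE)
    have S: "bs F S" using insert.prems by simp
    obtain w' where w': "w' \<in> L n" "bs w' S" "\<forall>T. \<not> bs F T \<longrightarrow> \<not> bs w' T"
      using below[OF S] by (elim bexE conjE)
    have bs: "bs (\<lambda>x. g (x i) (w x) (w' x)) T \<longleftrightarrow> i \<in> T \<and> (bs w T \<or> bs w' T)" for T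
      using L.bs_or[OF g(2) L.proj[OF i(1)] w(1) w'(1)] by simp
    show ?case
      by (intro bexI[of _ "\<lambda>x. g (x i) (w x) (w' x)"] L.ter_apply[OF g(1) L.proj[OF i(1)] w(1) w'(1)])
        (unfold bs, use w w' i(2) insert.prems in auto)
  qed
  define \<S> where "\<S> = {S. S \<subseteq> {..<n} \<and> bs F S}"
  have "{..<n} \<in> \<S>" using K.bs_full[OF F, of "{..<n}"] by (simp add: \<S>_def)
  hence "\<exists>w\<in>L n. (\<forall>T. \<not> bs F T \<longrightarrow> \<not> bs w T) \<and> (\<forall>S\<in>\<S>. bs w S)"
    by (intro join) (auto simp: \<S>_def)
  then obtain w where w: "w \<in> L n" "\<forall>T. \<not> bs F T \<longrightarrow> \<not> bs w T" "\<forall>S\<in>\<S>. bs w S"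
    by (elim bexE conjE)
  have "bs w S" if "bs F S" for S
  proof -
    have "bs F (S \<inter> {..<n})" using K.bs_local[OF F, of S "S \<inter> {..<n}"] that by simp
    hence "bs w (S \<inter> {..<n})" using w(3) by (simp add: \<S>_def)
    thus ?thesis using L.bs_local[OF w(1), of S "S \<inter> {..<n}"] by simp
  qed
  thus ?thesis using w by blast
qed

definition normal_ops :: "nat \<Rightarrow> ((nat \<Rightarrow> 3) \<Rightarrow> 3) \<Rightarrow> ((nat \<Rightarrow> 3) \<Rightarrow> 3) set" where
  "normal_ops n F = {G \<in> L n. normal G \<and> (\<forall>S. bs G S \<longleftrightarrow> bs F S)}"

lemma normal_opsD:
  assumes "H \<in> normal_ops n F"
  shows "H \<in> L n" "normal H" "bs H S \<longleftrightarrow> bs F S"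
  using assms by (simp_all add: normal_ops_def)

lemma rps_normal_ops:
  assumes G: "G \<in> normal_ops n F" and H: "H \<in> normal_ops n F"
  shows "(\<lambda>x. rps (G x) (H x)) \<in> normal_ops n F"
proof -
  note GD = normal_opsD[OF G] and HD = normal_opsD[OF H]
  have "bs (\<lambda>x. rps (G x) (H x)) S \<longleftrightarrow> bs F S" for S
    using L.bs_rps[OF GD(1) HD(1)] GD(3) HD(3) by blast
  thus ?thesis unfolding normal_ops_def
    using L.bin_apply[OF L.rps GD(1) HD(1)] normal_cong_rps[OF GD(2) HD(2) GD(3) HD(3)] by simp
qed

context
  fixes F n G i
  assumes F: "F \<in> K n" and G: "G \<in> L n" and bsG: "\<And>S. bs G S \<longleftrightarrow> bs F S"
    and i: "i < n" and guard: "\<And>S. bs F S \<Longrightarrow> i \<in> S"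
begin

lemma guardG: "bs G S \<Longrightarrow> i \<in> S"
  using guard bsG by simp

lemma nproj_normal_ops: "nproj G i (Suc k) \<in> normal_ops n F"
  unfolding normal_ops_def
  using L.nproj_mem[OF G i guardG] L.normal_nproj[OF G i guardG] L.bs_nproj[OF G i guardG] bsG
  by blast

lemma nproj_value: "(\<And>a. \<not> cut F x a) \<Longrightarrow> nproj G i k x = x i - of_nat k"
  using L.nproj_uncut[OF G i guardG] cut_cong[OF bsG] by blast

lemma normal_ops_surj:
  assumes "\<And>a. \<not> cut F x a"
  shows "\<exists>H\<in>normal_ops n F. H x = a"
proof -
  have "a = x i - of_nat (Suc 0) \<or> a = x i - of_nat (Suc 1) \<or> a = x i - of_nat (Suc 2)"
    using Z3_desc[of a "x i"] by auto
  thus ?thesis using nproj_value[of x, OF assms] nproj_normal_ops by metis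
qed

text \<open>The Boolean part of \<open>w\<close> lies above that of \<open>F\<close>, and its bit at
  \<open>a\<close> is true for \<open>x\<close> but false for \<open>z\<close>. A normal
  \<open>u\<close> built from \<open>w\<close> then differs at \<open>x\<close> and
  \<open>z\<close>. Multiplying by \<open>u\<close> stays inside \<open>normal_ops\<close>, which
  breaks the link.\<close>

lemma normal_ops_separate:
  assumes g: "ter L g" "or_op g"
    and x: "\<And>a. \<not> cut F x a" and z: "\<And>a. \<not> cut F z a"
    and link: "\<And>H. H \<in> normal_ops n F \<Longrightarrow> H z = H x" and iz: "z i = x i"
    and a: "a \<noteq> x i" and j: "j < n" "z j = a" "x j \<noteq> a"
  shows False
proof -
  define J where "J = {l. l < n \<and> x l \<noteq> a}"
  have J: "finite J" "J \<noteq> {}" "J \<subseteq> {..<n}" using i a by (auto simp: J_def)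
  obtain P where P: "P \<in> L n" "product_on J P" using L.rps_product[OF J] by blast
  define w where "w y = g (y i) (G y) (P y)" for y
  have w: "w \<in> L n" unfolding w_def[abs_def] by (rule L.ter_apply[OF g(1) L.proj[OF i] G P(1)])
  have bsw: "bs w S \<longleftrightarrow> i \<in> S \<and> (bs F S \<or> J \<subseteq> S)" for S
    unfolding w_def[abs_def] L.bs_or[OF g(2) L.proj[OF i] G P(1)] bs_product[OF P(2)] bsG by simp
  have wi: "i \<in> S" if "bs w S" for S using that bsw by simp
  have wF: "bs w S" if "bs F S" for S using that bsw guard by simp
  have cutw: "cut w y e \<longleftrightarrow> y i \<noteq> e \<and> (cut F y e \<or> J \<subseteq> {l. y l \<noteq> e})" for y e
    by (simp add: cut_def bsw)
  have cx: "cut w x a" using a by (auto simp: cutw J_def)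
  have ncx: "\<not> cut w x e" if "e \<noteq> a" for e
  proof -
    obtain l where "l < n" "x l = e" using K.cut_range[OF F x] by blast
    thus ?thesis using that x by (auto simp: cutw J_def)
  qed
  have ncz: "\<not> cut w z a" using j z by (auto simp: cutw J_def)
  \<comment> \<open>If all bits of \<open>w\<close> vanish at \<open>z\<close>, then
    \<open>u z = z i - of_nat (Suc k)\<close>; this \<open>k\<close> keeps it away from
    \<open>u x = a + 1\<close>.\<close>
  define k :: nat where "k = (if z i - 1 = a + 1 then 1 else 0)"
  define u where "u = nproj w i (Suc k)"
  have u: "u \<in> L n" unfolding u_def by (rule L.nproj_mem[OF w i]) (rule wi)
  have bsu: "bs u S \<longleftrightarrow> bs w S" for S unfolding u_def by (rule L.bs_nproj[OF w i wi])
  have u_cut: "u y = d" if "cut w y (d - 1)" "\<not> cut w y d" for y d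
    unfolding u_def by (rule L.nproj_cut[OF w i wi that])
  have ux: "u x = a + 1" by (rule u_cut) (use cx ncx in auto)
  have uz: "u z \<noteq> a + 1"
  proof (cases "\<exists>e. cut w z e")
    case True
    then obtain e where e: "cut w z e" by blast
    hence "e \<noteq> a" "e \<noteq> z i" using ncz by (auto simp: cutw)
    moreover have "z i \<noteq> a" using a iz by simp
    ultimately have "e + 1 = a \<or> e + 1 = z i" using Z3_third[of a "z i" e "e + 1"] by auto
    hence "\<not> cut w z (e + 1)" using ncz by (auto simp: cutw)
    hence "u z = e + 1" using e by (intro u_cut) auto
    thus ?thesis using \<open>e \<noteq> a\<close> by simp
  next
    case False
    hence "u z = z i - of_nat (Suc k)" unfolding u_def by (intro L.nproj_uncut[OF w i wi]) auto
    thus ?thesis by (auto simp: k_def)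
  qed
  have mem: "(\<lambda>y. rps (H y) (u y)) \<in> normal_ops n F" if H: "H \<in> normal_ops n F" for H
  proof -
    note HD = normal_opsD[OF H]
    have bs: "bs (\<lambda>y. rps (H y) (u y)) S \<longleftrightarrow> bs F S" for S
      unfolding L.bs_rps[OF HD(1) u] HD(3) bsu using wF by blast
    have "normal (\<lambda>y. rps (H y) (u y))"
      unfolding normal_def
    proof (intro allI impI)
      fix y d assume "cut (\<lambda>y. rps (H y) (u y)) y (d - 1)" "\<not> cut (\<lambda>y. rps (H y) (u y)) y d"
      hence c: "cut F y (d - 1)" "\<not> cut F y d" using cut_cong[OF bs] by blast+
      hence "H y = d" using HD(2) cut_cong[OF HD(3)] unfolding normal_def by blast
      have wd: "cut w y (d - 1)" using c(1) wF by (simp add: cut_def)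
      \<comment> \<open>The bits of \<open>w\<close> may drop at \<open>d + 1\<close> instead of
        \<open>d\<close>, but a value \<open>d + 1\<close> of \<open>u\<close> loses against
        \<open>H y = d\<close>.\<close>
      have "u y = d \<or> u y = d + 1"
      proof (cases "cut w y d")
        case True
        hence "y i \<noteq> d" "y i \<noteq> d - 1" using wd by (auto simp: cutw)
        hence "y i = d + 1" using Z3_near[of "y i" d] by blast
        hence "\<not> cut w y (d + 1)" by (auto simp: cutw)
        thus ?thesis using u_cut[of y "d + 1"] True by simp
      next
        case False thus ?thesis using u_cut[OF wd] by blast
      qed
      thus "rps (H y) (u y) = d" using \<open>H y = d\<close> by auto
    qed
    thus ?thesis unfolding normal_ops_def using L.bin_apply[OF L.rps HD(1) u] bs by simp
  qed
  obtain v where v: "rps v (u z) \<noteq> rps v (u x)" using rps_separates[of "u z" "u x"] ux uz by auto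
  obtain H where H: "H \<in> normal_ops n F" "H x = v" using normal_ops_surj[of x, OF x] by blast
  have "rps (H z) (u z) = rps (H x) (u x)" using link[OF mem[OF H(1)]] .
  thus False using link[OF H(1)] H(2) v by simp
qed

text \<open>If \<open>x\<close> and \<open>y\<close> are linked by a rotation, undo it to get
  \<open>z\<close>. At a coordinate where \<open>z\<close> and \<open>x\<close> differ, one of them
  has a value other than \<open>x i = z i\<close>, so separation applies in one of the two orders.
  Hence \<open>z\<close> and \<open>x\<close> agree below \<open>n\<close>, and \<open>F\<close>
  respects the link.\<close>

lemma pair_or:
  assumes g: "ter L g" "or_op g"
    and x: "\<And>a. \<not> cut F x a" and y: "\<And>a. \<not> cut F y a"
  shows "\<exists>H\<in>normal_ops n F. H x = F x \<and> H y = F y"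
proof -
  consider "\<forall>a b. \<exists>H\<in>normal_ops n F. H x = a \<and> H y = b"
    | c where "\<forall>H\<in>normal_ops n F. H y = H x + c"
    using L.rps_pair[of "normal_ops n F" x y, OF rps_normal_ops normal_ops_surj[of x, OF x]
        normal_ops_surj[of y, OF y]] by blast
  thus ?thesis
  proof cases
    case 1 thus ?thesis by blast
  next
    case 2
    define z where "z l = y l + (- c)" for l
    have cz: "\<not> cut F z a" for a
    proof -
      have "cut F z a \<longleftrightarrow> cut F y (a + c)" by (simp add: cut_def z_def eq_diff_eq[symmetric] diff_eq_eq)
      thus ?thesis using y by simp
    qed
    have link: "H z = H x" if "H \<in> normal_ops n F" for H
    proof -
      have "H z = H y + (- c)" unfolding z_def[abs_def] by (rule L.rot[OF normal_opsD(1)[OF that]])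
      thus ?thesis using 2[rule_format, OF that] by simp
    qed
    have iz: "z i = x i"
      using link[OF nproj_normal_ops[of 0]] nproj_value[of x "Suc 0", OF x] nproj_value[of z "Suc 0", OF cz]
      by simp
    have "z j = x j" if j: "j < n" for j
    proof (rule ccontr)
      assume ne: "z j \<noteq> x j"
      show False
      proof (cases "z j = x i")
        case True
        show False
        proof (rule normal_ops_separate[OF g, of z x "x j" j])
          show "H x = H z" if "H \<in> normal_ops n F" for H using link[OF that] by simp
        qed (use x cz iz ne j True in auto)
      next
        case False
        show False
          by (rule normal_ops_separate[OF g, of x z "z j" j]) (use x cz link iz ne j False in auto)
      qed
    qed
    hence "F z = F x" by (intro depD[OF K.dep[OF F]]) auto
    moreover have "F z = F y + (- c)" unfolding z_def[abs_def] by (rule K.rot[OF F])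
    ultimately have "F y = F x + c" by (simp add: algebra_simps)
    moreover obtain H where "H \<in> normal_ops n F" "H x = F x" using normal_ops_surj[of x, OF x] by blast
    ultimately show ?thesis using 2 by (intro bexI[of _ H]) auto
  qed
qed

text \<open>The common minor \<open>E\<close> is right at \<open>x\<close> and \<open>y\<close>, but
  may have a smaller conjunction as Boolean part and need not be normal. Feeding it
  \<open>A j\<close> repairs both: where all bits vanish \<open>A j z = z j\<close>, and where the
  value \<open>d\<close> is prescribed the arguments are \<open>d\<close> on \<open>I\<close> and
  \<open>d\<close> or \<open>d - 1\<close> elsewhere.\<close>

lemma pair_conjunction:
  assumes I: "I \<subseteq> {..<n}" "I \<noteq> {}" "\<And>S. bs F S \<longleftrightarrow> I \<subseteq> S"
    and x: "\<And>a. \<not> cut F x a" and y: "\<And>a. \<not> cut F y a"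
  shows "\<exists>H\<in>normal_ops n F. H x = F x \<and> H y = F y"
proof -
  \<comment> \<open>Representatives of columns meeting \<open>I\<close> stay in \<open>I\<close>, so
    \<open>E\<close> depends on bits only through variables that bound \<open>F\<close>.\<close>
  obtain \<rho> where \<rho>: "\<And>l. l < n \<Longrightarrow> \<rho> l < n \<and> x (\<rho> l) = x l \<and> y (\<rho> l) = y l"
    "\<And>l. l < n \<Longrightarrow> l \<in> I \<Longrightarrow> \<rho> l \<in> I" and mem: "(\<lambda>z. F (\<lambda>i. z (\<rho> i))) \<in> L n"
    using collapse_pair[OF F, of x y I] by blast
  define E where "E z = F (\<lambda>i. z (\<rho> i))" for z
  have E: "E \<in> L n" using mem by (simp add: E_def[abs_def])
  have bsE: "bs E S \<longleftrightarrow> \<rho> ` I \<subseteq> S" for S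
    unfolding E_def[abs_def] bs_minor[of F \<rho>] I(3) by auto
  have \<rho>I: "\<rho> ` I \<subseteq> I" "\<rho> ` I \<noteq> {}" using \<rho>(2) I(1,2) by auto
  define N where "N j k z = nproj G j (Suc k) z" for j k z
  \<comment> \<open>Where all bits vanish, \<open>N i 2\<close>, \<open>N i 0\<close>,
    \<open>N i 1\<close> are \<open>z i\<close>, \<open>z i - 1\<close>, \<open>z i - 2\<close>, as
    \<open>rps_retract\<close> wants; elsewhere they are equal and \<open>rps_absorb\<close>
    applies. For \<open>j \<in> I\<close> the index 2 means three shifts, which change nothing
    modulo 3.\<close>
  define A where "A j z = (if j \<in> I then N j 2 z else
      rps (z j) (rps (N i 2 z) (rps (N i 0 z) (rps (N i 1 z) (rps (N i 2 z) (rps (z j) (N i 0 z)))))))" for j z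
  define H where "H z = E (\<lambda>j. A j z)" for z
  have jn: "j < n" and jg: "\<And>S. bs G S \<Longrightarrow> j \<in> S" if "j \<in> I" for j
    using that I(1,3) bsG by auto
  have N: "N j k \<in> L n" if "j \<in> I" for j k
    unfolding N_def[abs_def] by (rule L.nproj_mem[OF G jn[OF that] jg[OF that]])
  have bsN: "bs (N j k) S \<longleftrightarrow> bs F S" if "j \<in> I" for j k S
    unfolding N_def[abs_def] using L.bs_nproj[OF G jn[OF that] jg[OF that], of k S] bsG by simp
  have N_cut: "N j k z = d" if "j \<in> I" "cut F z (d - 1)" "\<not> cut F z d" for j k z d
    unfolding N_def by (rule L.nproj_cut[OF G jn[OF that(1)] jg[OF that(1)]])
      (use that(2,3) cut_cong[OF bsG] in auto)
  have N_uncut: "N j k z = z j - of_nat (Suc k)" if "j \<in> I" "\<And>a. \<not> cut F z a" for j k z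
    unfolding N_def by (rule L.nproj_uncut[OF G jn[OF that(1)] jg[OF that(1)]])
      (use that(2) cut_cong[OF bsG] in auto)
  have iI: "i \<in> I" using guard[of I] I(3) by simp
  have A: "A j \<in> L n" if j: "j < n" for j
  proof (cases "j \<in> I")
    case True thus ?thesis using N[OF True] by (simp add: A_def[abs_def])
  next
    case False
    have "(\<lambda>z. rps (z j) (rps (N i 2 z) (rps (N i 0 z) (rps (N i 1 z) (rps (N i 2 z) (rps (z j) (N i 0 z))))))) \<in> L n"
      by (intro L.bin_apply[OF L.rps] L.proj[OF j] N[OF iI])
    thus ?thesis using False by (simp add: A_def[abs_def])
  qed
  have H: "H \<in> L n" unfolding H_def[abs_def] by (rule L.comp[OF E A])
  have bsH: "bs H S \<longleftrightarrow> bs F S" for S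
  proof -
    have "bs H S \<longleftrightarrow> \<rho> ` I \<subseteq> {j. bs (A j) S}"
      using L.bs_comp[OF E A] by (simp only: H_def[abs_def] bsE)
    also have "\<dots> \<longleftrightarrow> (\<forall>j\<in>\<rho> ` I. bs (N j 2) S)"
      using \<rho>I(1) by (auto simp: A_def[abs_def] subset_iff)
    also have "\<dots> \<longleftrightarrow> bs F S" using \<rho>I bsN by blast
    finally show ?thesis .
  qed
  have "normal H"
    unfolding normal_def
  proof (intro allI impI)
    fix z d assume "cut H z (d - 1)" "\<not> cut H z d"
    hence c: "cut F z (d - 1)" "\<not> cut F z d" using cut_cong[OF bsH] by blast+
    have "A j z = step_tuple d {j. A j z = d} j" for j
      using N_cut[OF _ c] iI rps_cases[of "z j" d] by (auto simp: A_def rps_absorb step_tuple_def)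
    hence "H z = E (step_tuple d {j. A j z = d})" unfolding H_def by (intro arg_cong[where f = E] ext)
    also have "\<dots> = d"
    proof -
      have "\<rho> ` I \<subseteq> {j. A j z = d}" using \<rho>I(1) N_cut[OF _ c] by (auto simp: A_def)
      thus ?thesis by (simp add: L.step_value[OF E] bsE)
    qed
    finally show "H z = d" .
  qed
  hence "H \<in> normal_ops n F" using H bsH by (simp add: normal_ops_def)
  moreover have "H z = E z" if z: "\<And>a. \<not> cut F z a" for z
  proof -
    have "A j z = z j" for j
    proof (cases "j \<in> I")
      case True thus ?thesis using N_uncut[OF True z, of 2] by (simp add: A_def)
    next
      case False
      have "N i 2 z = z i" "N i 1 z = z i - 2" "N i 0 z = z i - 1"
        using N_uncut[OF iI z] by simp_all
      thus ?thesis using False rps_retract[of "z j" "z i"] by (simp add: A_def)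
    qed
    thus ?thesis by (simp add: H_def)
  qed
  moreover have "E x = F x" "E y = F y"
    unfolding E_def using \<rho>(1) by (auto intro!: depD[OF K.dep[OF F]])
  ultimately show ?thesis using x y by (intro bexI[of _ H]) auto
qed

text \<open>Where some bit is true, \<open>normalize F\<close> and every member of
  \<open>normal_ops\<close> have the same prescribed value, so interpolating on the remaining tuples
  is enough.\<close>

lemma normalize_mem_of_pairs:
  assumes pairs: "\<And>x y. (\<And>a. \<not> cut F x a) \<Longrightarrow> (\<And>a. \<not> cut F y a) \<Longrightarrow>
    \<exists>H\<in>normal_ops n F. H x = F x \<and> H y = F y"
  shows "normalize F \<in> L n"
proof -
  define Z where "Z = {x \<in> padded n. \<forall>a. \<not> cut F x a}"
  have "\<exists>H\<in>normal_ops n F. \<forall>x\<in>Z. H x = F x"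
  proof (rule rps.interpolation)
    show "(\<lambda>x. rps (f x) (g x)) \<in> normal_ops n F"
      if "f \<in> normal_ops n F" "g \<in> normal_ops n F" for f g
      using that by (rule rps_normal_ops)
    show "normal_ops n F \<noteq> {}" using nproj_normal_ops by blast
    show "finite Z" using finite_padded by (simp add: Z_def)
    show "\<exists>H\<in>normal_ops n F. H x = a" if "x \<in> Z" for x a
      using that by (intro normal_ops_surj) (simp add: Z_def)
    show "\<exists>H\<in>normal_ops n F. H x = F x \<and> H y = F y" if "x \<in> Z" "y \<in> Z" for x y
      using that by (intro pairs) (simp_all add: Z_def)
  qed
  then obtain H where H: "H \<in> normal_ops n F" "\<And>x. x \<in> Z \<Longrightarrow> H x = F x" by blast
  note HD = normal_opsD[OF H(1)]
  have "normalize F x = H x" for x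
  proof (cases "\<exists>a. cut F x (a - 1) \<and> \<not> cut F x a")
    case True
    then obtain a where a: "cut F x (a - 1)" "\<not> cut F x a" by blast
    hence "H x = a" using HD(2) cut_cong[OF HD(3)] unfolding normal_def by blast
    thus ?thesis using normalize_eqI[OF a] by simp
  next
    case False
    hence x: "\<not> cut F x a" for a
      using cut_exists[of F x a "x i"] K.cut_guard[of F i x] guard by blast
    let ?y = "\<lambda>j. if j < n then x j else 0"
    have "\<not> cut F ?y a" for a using x K.cut_local[OF F, of x ?y a] by simp
    hence "H ?y = F ?y" by (intro H(2)) (simp add: Z_def padded_def)
    moreover have "H x = H ?y" by (rule depD[OF L.dep[OF HD(1)]]) simp
    moreover have "F x = F ?y" by (rule depD[OF K.dep[OF F]]) simp
    ultimately show ?thesis using normalize_outside[of F x, OF x] by simp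
  qed
  hence "normalize F = H" by blast
  thus ?thesis using HD(1) by simp
qed

end

lemma normalize_mem:
  assumes F: "F \<in> K n"
  shows "normalize F \<in> L n"
proof -
  obtain i where i: "i < n" "\<And>S. bs F S \<Longrightarrow> i \<in> S" using K.guard_exists[OF F] by blast
  show ?thesis
  proof (cases "\<exists>g. ter K g \<and> or_op g")
    case True
    then obtain g where g: "ter L g" "or_op g" using ter_transfer by blast
    obtain G where G: "G \<in> L n" "\<And>S. bs G S \<longleftrightarrow> bs F S" using same_bs_or[OF g F] by blast
    show ?thesis
      by (rule normalize_mem_of_pairs[OF F G i pair_or[OF F G i g]])
  next
    case False
    obtain I where I: "I \<subseteq> {..<n}" "I \<noteq> {}" "\<And>S. bs F S \<longleftrightarrow> I \<subseteq> S"
      using K.conjunction_or[OF False F] by blast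
    have "finite I" using I(1) finite_subset by blast
    then obtain G where G: "G \<in> L n" "product_on I G" using L.rps_product[OF _ I(2,1)] by blast
    have bsG: "bs G S \<longleftrightarrow> bs F S" for S using bs_product[OF G(2)] I(3) by simp
    show ?thesis
      by (rule normalize_mem_of_pairs[OF F G(1) bsG i pair_conjunction[OF F G(1) bsG i I]])
  qed
qed

lemma minor_le_normalize: "minor_le K L"
  by (rule minor_leI[where \<phi> = "\<lambda>n. normalize"]) (simp_all add: normalize_mem normalize_minor)

end

lemma countably_many_rps: "countably_many {K. idempotent_fam K \<and> bin K rps}"
proof (rule countably_many_subset)
  let ?C = "{K. idempotent_fam K \<and> \<not> conservative K}"
  let ?N = "{K. self_dual_fam K \<and> (\<exists>k. \<exists>N\<in>K k. is_nu k N)}"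
  have "countably_many {K. rps_fam K}"
  proof (rule countably_many_finite_part)
    show "self_dual_fam K" if "K \<in> {K. rps_fam K}" for K
    proof -
      interpret rps_fam K using that by simp
      show ?thesis by (rule self_dual_fam_axioms)
    qed
    fix K L assume "K \<in> {K. rps_fam K}" "L \<in> {K. rps_fam K}" and eq: "K 9 = L 9"
    then interpret K: rps_fam K + L: rps_fam L by simp_all
    interpret KL: rps_fams K L by unfold_locales (rule eq)
    interpret LK: rps_fams L K by unfold_locales (rule eq[symmetric])
    show "minor_eq K L" using KL.minor_le_normalize LK.minor_le_normalize by (simp add: minor_eq_def)
  qed
  thus "countably_many (?C \<union> (?N \<union> {K. rps_fam K}))"
    using countably_many_not_conservative countably_many_nu by (intro countably_many_Un)
  show "{K. idempotent_fam K \<and> bin K rps} \<subseteq> ?C \<union> (?N \<union> {K. rps_fam K})"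
  proof
    fix K assume K: "K \<in> {K. idempotent_fam K \<and> bin K rps}"
    then interpret idempotent_fam K by simp
    show "K \<in> ?C \<union> (?N \<union> {K. rps_fam K})"
      using K self_dual_fam_axioms
      by (auto simp: rps_fam_def conservative_fam_def conservative_fam_axioms_def rps_fam_axioms_def)
  qed
qed

section \<open>Conjugation by negation, and the conclusion\<close>

definition negated :: "fam \<Rightarrow> fam" where
  "negated K n = (\<lambda>F x. - F (\<lambda>i. - x i)) ` K n"

context idempotent_fam
begin

lemma negated_mem: "F \<in> K n \<Longrightarrow> (\<lambda>x. - F (\<lambda>i. - x i)) \<in> negated K n"
  by (simp add: negated_def)

lemma idempotent_negated: "idempotent_fam (negated K)"
proof
  fix F n assume "F \<in> negated K n"
  then obtain F' where F': "F' \<in> K n" "F = (\<lambda>x. - F' (\<lambda>i. - x i))" by (auto simp: negated_def)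
  show "dep n F"
    unfolding dep_def F'(2)
  proof (intro allI impI)
    fix x y :: "nat \<Rightarrow> 3" assume "\<forall>i<n. x i = y i"
    hence "F' (\<lambda>i. - x i) = F' (\<lambda>i. - y i)" by (intro depD[OF dep[OF F'(1)]]) simp
    thus "- F' (\<lambda>i. - x i) = - F' (\<lambda>i. - y i)" by simp
  qed
  show "F (\<lambda>i. x i + 1) = F x + 1" for x
  proof -
    have "(\<lambda>i. - x i + 2) = (\<lambda>i. - (x i + 1))" by (simp add: fun_eq_iff Z3_diff algebra_simps)
    hence "F' (\<lambda>i. - (x i + 1)) = F' (\<lambda>i. - x i) + 2" using rot[OF F'(1), of "\<lambda>i. - x i" 2] by simp
    hence "- F' (\<lambda>i. - (x i + 1)) = - F' (\<lambda>i. - x i) + 1" by simp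
    thus ?thesis unfolding F'(2) .
  qed
  show "F (\<lambda>i. a) = a" for a using idem[OF F'(1)] by (simp add: F'(2))
next
  fix i n :: nat assume "i < n"
  thus "(\<lambda>x. x i) \<in> negated K n" using negated_mem[OF proj] by fastforce
next
  fix F m n and G :: "nat \<Rightarrow> (nat \<Rightarrow> 3) \<Rightarrow> 3"
  assume "F \<in> negated K m" and G: "\<And>i. i < m \<Longrightarrow> G i \<in> negated K n"
  then obtain F' where F': "F' \<in> K m" "F = (\<lambda>x. - F' (\<lambda>i. - x i))" by (auto simp: negated_def)
  have "\<exists>H. H \<in> K n \<and> G i = (\<lambda>x. - H (\<lambda>i. - x i))" if "i < m" for i
    using G[OF that] by (auto simp: negated_def)
  then obtain H where H: "\<And>i. i < m \<Longrightarrow> H i \<in> K n" "\<And>i. i < m \<Longrightarrow> G i = (\<lambda>x. - H i (\<lambda>i. - x i))"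
    by metis
  have "F (\<lambda>i. G i x) = - F' (\<lambda>i. H i (\<lambda>i. - x i))" for x
    unfolding F'(2) by (intro arg_cong[where f = uminus] depD[OF dep[OF F'(1)]]) (simp add: H(2))
  thus "(\<lambda>x. F (\<lambda>i. G i x)) \<in> negated K n"
    using negated_mem[OF comp[OF F'(1), of H n]] H(1) by simp
qed

lemma minor_eq_negated: "minor_eq K (negated K)"
  unfolding minor_eq_def
proof
  show "minor_le K (negated K)"
    by (rule minor_leI[where \<phi> = "\<lambda>n F x. - F (\<lambda>i. - x i)"]) (simp_all add: negated_mem)
  show "minor_le (negated K) K"
  proof (rule minor_leI[where \<phi> = "\<lambda>n F x. - F (\<lambda>i. - x i)"])
    fix n F assume "F \<in> negated K n"
    then obtain F' where "F' \<in> K n" "F = (\<lambda>x. - F' (\<lambda>i. - x i))" by (auto simp: negated_def)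
    thus "(\<lambda>x. - F (\<lambda>i. - x i)) \<in> K n" by simp
  qed simp
qed

lemma bin_negated: "bin K g \<Longrightarrow> bin (negated K) (\<lambda>a b. - g (- a) (- b))"
  using negated_mem[of "\<lambda>x. g (x 0) (x 1)" 2] by (simp add: bin_def)

end

lemma countably_many_join: "countably_many {K. idempotent_fam K \<and> bin K join}"
proof (rule countably_many_reduce[OF countably_many_rps])
  fix K assume K: "K \<in> {K. idempotent_fam K \<and> bin K join}"
  then interpret idempotent_fam K by simp
  have "bin (negated K) (\<lambda>a b. - join (- a) (- b))" by (rule bin_negated) (use K in simp)
  hence "bin (negated K) rps" by (simp add: join_def)
  thus "\<exists>L\<in>{K. idempotent_fam K \<and> bin K rps}. minor_eq K L"
    using idempotent_negated minor_eq_negated by (intro bexI[of _ "negated K"]) auto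
qed

lemma countably_many_self_dual: "countably_many {K. self_dual_fam K}"
proof (rule countably_many_reduce)
  let ?R = "{K. idempotent_fam K \<and> bin K rps}"
  let ?J = "{K. idempotent_fam K \<and> bin K join}"
  let ?C = "{K. idempotent_fam K \<and> \<not> conservative K}"
  let ?N = "{K. self_dual_fam K \<and> (\<exists>k. \<exists>N\<in>K k. is_nu k N)}"
  let ?P = "{K. parity_fam K}"
  show "countably_many (?R \<union> (?J \<union> (?C \<union> (?N \<union> ?P))))"
    by (intro countably_many_Un countably_many_rps countably_many_join countably_many_not_conservative
        countably_many_nu countably_many_parity)
  fix K assume "K \<in> {K. self_dual_fam K}"
  then interpret self_dual_fam K by simp
  let ?K = "idempotent_part K"
  interpret I: idempotent_fam ?K by (rule idempotent_fam_part)
  have "?K \<in> ?R \<union> (?J \<union> (?C \<union> (?N \<union> ?P)))"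
    using I.idempotent_fam_axioms I.self_dual_fam_axioms
    by (auto simp: parity_fam_def conservative_fam_def conservative_fam_axioms_def parity_fam_axioms_def)
  thus "\<exists>L\<in>?R \<union> (?J \<union> (?C \<union> (?N \<union> ?P))). minor_eq K L"
    using minor_eq_idempotent_part by (intro bexI[of _ ?K])
qed

theorem corollary4p5:
  "countable (self_dual_clones // self_dual_minor_equivalence)"
  by (rule countable_quotient[OF countably_many_self_dual])

end
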